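(* Consider potentials $Q=\begin{pmatrix}0&q\\ r&0\end{pmatrix}$ that are smooth enough and vanish fast enough as $x\to\pm\infty$, with the Poisson brackets $$\{q_{ks}(y),r_{pi}(x)\}=i\,\delta_{ik}\delta_{ps}\,\delta(x-y)\qquad (1\le i,k\le n,\ 1\le p,s\le m),$$ where all brackets of entries of $q$ among themselves and of entries of $r$ among themselves vanish. Let $I_k$ and $J_k$, $k=1,2,\dots$, be the functionals of $Q$ defined by the asymptotic expansions as $\lambda\to\infty$ in $\mathbb C_+$ $$\ln\det a^+(\lambda)=\sum_{k=1}^\infty I_k\lambda^{-k},\qquad \ln\det c^+(\lambda)=\sum_{k=1}^\infty J_k\lambda^{-k}.$$ Then for all positive integers $k$ and $p$, $$\{I_k,I_p\}=\{I_k,J_p\}=\{J_k,J_p\}=0 .$$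
   Context: Let $n,m\ge1$, $J=\begin{pmatrix}\mathbb 1_n&0\\0&-\mathbb 1_m\end{pmatrix}$ and $Q(x)=\begin{pmatrix}0&q(x)\\ r(x)&0\end{pmatrix}$, where $q$ is an $n\times m$ and $r$ an $m\times n$ complex matrix function. Consider the linear system $$i\frac{d\psi}{dx}+(Q(x)-\lambda J)\psi=0 .$$ For $\lambda\in\mathbb R$ the Jost solutions $\psi,\phi$ are the fundamental solutions with $\lim_{x\to+\infty}\psi e^{i\lambda Jx}=\mathbb 1$ and $\lim_{x\to-\infty}\phi e^{i\lambda Jx}=\mathbb 1$. The scattering matrix $T(\lambda)$ is defined by $\phi=\psi T$, and its blocks are $$T=\begin{pmatrix}a^+&-b^-\\ b^+&a^-\end{pmatrix},\qquad T^{-1}=\begin{pmatrix}c^-&d^-\\-d^+&c^+\end{pmatrix}.$$ The blocks $a^+$ ($n\times n$) and $c^+$ ($m\times m$) extend analytically to the open upper half-plane $\mathbb C_+$ and tend to the identity as $\lambda\to\infty$. The coefficients $I_k,J_k$ are integrals over $x\in\mathbb R$ of densities depending only on $Q$ and its $x$-derivatives. For functionals $F,G$ of $(q,r)$ the stated brackets mean $$\{F,G\}=i\int_{-\infty}^\infty\sum_{k=1}^n\sum_{s=1}^m\left(\frac{\delta F}{\delta q_{ks}(x)}\frac{\delta G}{\delta r_{sk}(x)}-\frac{\delta F}{\delta r_{sk}(x)}\frac{\delta G}{\delta q_{ks}(x)}\right)dx .$$ *)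

theory Defs
  imports "HOL-Analysis.Analysis" "HOL-Library.Landau_Symbols"
begin

definition schwartz :: "(real \<Rightarrow> 'a::real_normed_vector) \<Rightarrow> bool" where
  "schwartz f \<longleftrightarrow>
     (\<exists>D :: nat \<Rightarrow> real \<Rightarrow> 'a. D 0 = f \<and>
        (\<forall>j x. (D j has_vector_derivative D (Suc j) x) (at x)) \<and>
        (\<forall>j l. bounded (range (\<lambda>x. x ^ l *\<^sub>R D j x))))"


section \<open>The linear system and the scattering matrix\<close>

text \<open>Matrices of size \<open>n + m\<close> are indexed by the sum type \<open>'n + 'm\<close>.\<close>

definition block_mat ::
  "'a^'n::finite^'n \<Rightarrow> 'a^'m::finite^'n \<Rightarrow> 'a^'n^'m \<Rightarrow> 'a^'m^'m \<Rightarrow> 'a^('n + 'm)^('n + 'm)" where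
  "block_mat A B C D = (\<chi> i j. case i of
      Inl i' \<Rightarrow> (case j of Inl j' \<Rightarrow> A $ i' $ j' | Inr j' \<Rightarrow> B $ i' $ j')
    | Inr i' \<Rightarrow> (case j of Inl j' \<Rightarrow> C $ i' $ j' | Inr j' \<Rightarrow> D $ i' $ j'))"

definition upper_left :: "'a^('n::finite + 'm::finite)^('n + 'm) \<Rightarrow> 'a^'n^'n" where
  "upper_left M = (\<chi> i j. M $ Inl i $ Inl j)"

definition lower_right :: "'a^('n::finite + 'm::finite)^('n + 'm) \<Rightarrow> 'a^'m^'m" where
  "lower_right M = (\<chi> i j. M $ Inr i $ Inr j)"

definition J_mat :: "complex^('n::finite + 'm::finite)^('n + 'm)" where
  "J_mat = block_mat (mat 1) 0 0 (- mat 1)"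

definition Q_mat ::
  "(real \<Rightarrow> complex^'m::finite^'n::finite) \<Rightarrow> (real \<Rightarrow> complex^'n^'m)
     \<Rightarrow> real \<Rightarrow> complex^('n + 'm)^('n + 'm)" where
  "Q_mat q r x = block_mat 0 (q x) (r x) 0"

text \<open>The matrix exponential \<open>exp (i \<lambda> J x)\<close>; since \<open>J\<close> is diagonal it is taken entrywise on
  the diagonal.\<close>

definition exp_J :: "complex \<Rightarrow> real \<Rightarrow> complex^('n::finite + 'm::finite)^('n + 'm)" where
  "exp_J z x = block_mat (mat (exp (\<i> * z * of_real x))) 0 0 (mat (exp (- \<i> * z * of_real x)))"

text \<open>Multiplication of a matrix by the scalar \<open>c\<close> is written \<open>mat c ** M\<close>.\<close>

definition solves_system ::
  "(real \<Rightarrow> complex^'m::finite^'n::finite) \<Rightarrow> (real \<Rightarrow> complex^'n^'m) \<Rightarrow> complex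
     \<Rightarrow> (real \<Rightarrow> complex^('n + 'm)^('n + 'm)) \<Rightarrow> bool" where
  "solves_system q r z \<psi> \<longleftrightarrow>
     (\<forall>x. \<psi> differentiable (at x) \<and>
          mat \<i> ** vector_derivative \<psi> (at x) + (Q_mat q r x - mat z ** J_mat) ** \<psi> x = 0)"

definition jost_psi ::
  "(real \<Rightarrow> complex^'m::finite^'n::finite) \<Rightarrow> (real \<Rightarrow> complex^'n^'m) \<Rightarrow> real
     \<Rightarrow> (real \<Rightarrow> complex^('n + 'm)^('n + 'm)) \<Rightarrow> bool" where
  "jost_psi q r l \<psi> \<longleftrightarrow> solves_system q r (of_real l) \<psi> \<and>
     ((\<lambda>x. \<psi> x ** exp_J (of_real l) x) \<longlongrightarrow> mat 1) at_top"

definition jost_phi ::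
  "(real \<Rightarrow> complex^'m::finite^'n::finite) \<Rightarrow> (real \<Rightarrow> complex^'n^'m) \<Rightarrow> real
     \<Rightarrow> (real \<Rightarrow> complex^('n + 'm)^('n + 'm)) \<Rightarrow> bool" where
  "jost_phi q r l \<phi> \<longleftrightarrow> solves_system q r (of_real l) \<phi> \<and>
     ((\<lambda>x. \<phi> x ** exp_J (of_real l) x) \<longlongrightarrow> mat 1) at_bot"

definition scattering_matrix ::
  "(real \<Rightarrow> complex^'m::finite^'n::finite) \<Rightarrow> (real \<Rightarrow> complex^'n^'m) \<Rightarrow> real
     \<Rightarrow> complex^('n + 'm)^('n + 'm)" where
  "scattering_matrix q r l =
     (THE T. \<exists>\<psi> \<phi>. jost_psi q r l \<psi> \<and> jost_phi q r l \<phi> \<and> (\<forall>x. \<phi> x = \<psi> x ** T))"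

definition a_plus ::
  "(real \<Rightarrow> complex^'m::finite^'n::finite) \<Rightarrow> (real \<Rightarrow> complex^'n^'m) \<Rightarrow> real
     \<Rightarrow> complex^'n^'n" where
  "a_plus q r l = upper_left (scattering_matrix q r l)"

definition c_plus ::
  "(real \<Rightarrow> complex^'m::finite^'n::finite) \<Rightarrow> (real \<Rightarrow> complex^'n^'m) \<Rightarrow> real
     \<Rightarrow> complex^'m^'m" where
  "c_plus q r l = lower_right (matrix_inv (scattering_matrix q r l))"


section \<open>The functionals \<open>I\<^sub>k\<close> and \<open>J\<^sub>k\<close>\<close>

text \<open>\<open>A\<close> is holomorphic in the open upper half-plane and continuous up to the real line, where it
  equals \<open>f\<close>. This determines \<open>A\<close> on the closed upper half-plane.\<close>

definition extends_to_upper_half_plane ::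
  "(real \<Rightarrow> complex^'k::finite^'k) \<Rightarrow> (complex \<Rightarrow> complex^'k^'k) \<Rightarrow> bool" where
  "extends_to_upper_half_plane f A \<longleftrightarrow>
     (\<forall>i j. (\<lambda>z. A z $ i $ j) holomorphic_on {z. Im z > 0}) \<and>
     continuous_on {z. Im z \<ge> 0} A \<and>
     (\<forall>l. A (of_real l) = f l)"

text \<open>Asymptotic expansion in the sense of Poincare, as \<open>z\<close> tends to infinity in the open upper
  half-plane. The determinant tends to \<open>1\<close> there, so the principal branch \<open>Ln\<close> is the branch of
  the logarithm that tends to \<open>0\<close>. The value \<open>c 0\<close> plays no role.\<close>

definition ln_det_expansion ::
  "(real \<Rightarrow> complex^'k::finite^'k) \<Rightarrow> (nat \<Rightarrow> complex) \<Rightarrow> bool" where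
  "ln_det_expansion f c \<longleftrightarrow>
     (\<exists>A. extends_to_upper_half_plane f A \<and>
        (\<forall>N. (\<lambda>z. Ln (det (A z)) - (\<Sum>k=1..N. c k / z ^ k))
               \<in> o[inf at_infinity (principal {z. Im z > 0})](\<lambda>z. 1 / z ^ N)))"

definition I_fun ::
  "nat \<Rightarrow> (real \<Rightarrow> complex^'m::finite^'n::finite) \<Rightarrow> (real \<Rightarrow> complex^'n^'m) \<Rightarrow> complex" where
  "I_fun k q r = (THE v. \<exists>c. ln_det_expansion (a_plus q r) c \<and> c k = v)"

definition J_fun ::
  "nat \<Rightarrow> (real \<Rightarrow> complex^'m::finite^'n::finite) \<Rightarrow> (real \<Rightarrow> complex^'n^'m) \<Rightarrow> complex" where
  "J_fun k q r = (THE v. \<exists>c. ln_det_expansion (c_plus q r) c \<and> c k = v)"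


section \<open>Functional derivatives and Poisson brackets\<close>

text \<open>\<open>Fq x $ k $ s\<close> and \<open>Fr x $ s $ k\<close> are the functional derivatives of \<open>F\<close> with respect to
  the entries \<open>q\<^sub>k\<^sub>s(x)\<close> and \<open>r\<^sub>s\<^sub>k(x)\<close>, at the potential \<open>(q, r)\<close>: the first variation of \<open>F\<close> in
  every Schwartz direction \<open>(h, g)\<close> is obtained by pairing with them. Continuity makes them
  unique.\<close>

definition has_functional_derivative ::
  "((real \<Rightarrow> complex^'m::finite^'n::finite) \<Rightarrow> (real \<Rightarrow> complex^'n^'m) \<Rightarrow> complex)
     \<Rightarrow> (real \<Rightarrow> complex^'m^'n) \<Rightarrow> (real \<Rightarrow> complex^'n^'m)
     \<Rightarrow> (real \<Rightarrow> complex^'m^'n) \<Rightarrow> (real \<Rightarrow> complex^'n^'m) \<Rightarrow> bool" where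
  "has_functional_derivative F q r Fq Fr \<longleftrightarrow>
     continuous_on UNIV Fq \<and> continuous_on UNIV Fr \<and>
     (\<forall>h g. schwartz h \<longrightarrow> schwartz g \<longrightarrow>
        (let v = (\<lambda>x. (\<Sum>k\<in>UNIV. \<Sum>s\<in>UNIV. Fq x $ k $ s * h x $ k $ s + Fr x $ s $ k * g x $ s $ k))
         in integrable lborel v \<and>
            ((\<lambda>\<epsilon>. F (\<lambda>x. q x + mat \<epsilon> ** h x) (\<lambda>x. r x + mat \<epsilon> ** g x))
               has_field_derivative (LINT x|lborel. v x)) (at 0)))"

text \<open>The bracket of \<open>F\<close> and \<open>G\<close> at \<open>(q, r)\<close> exists and has value \<open>b\<close>.\<close>

definition has_poisson_bracket ::
  "((real \<Rightarrow> complex^'m::finite^'n::finite) \<Rightarrow> (real \<Rightarrow> complex^'n^'m) \<Rightarrow> complex)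
     \<Rightarrow> ((real \<Rightarrow> complex^'m^'n) \<Rightarrow> (real \<Rightarrow> complex^'n^'m) \<Rightarrow> complex)
     \<Rightarrow> (real \<Rightarrow> complex^'m^'n) \<Rightarrow> (real \<Rightarrow> complex^'n^'m) \<Rightarrow> complex \<Rightarrow> bool" where
  "has_poisson_bracket F G q r b \<longleftrightarrow>
     (\<exists>Fq Fr Gq Gr. has_functional_derivative F q r Fq Fr \<and> has_functional_derivative G q r Gq Gr \<and>
        (let v = (\<lambda>x. (\<Sum>k\<in>UNIV. \<Sum>s\<in>UNIV. Fq x $ k $ s * Gr x $ s $ k - Fr x $ s $ k * Gq x $ k $ s))
         in integrable lborel v \<and> b = \<i> * (LINT x|lborel. v x)))"

end

theory Submission
  imports Defs "HOL-Complex_Analysis.Complex_Analysis" "HOL-Library.Function_Algebras"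
begin

text \<open>With \<open>u = i q\<close>, \<open>v = i r\<close> and \<open>\<zeta> = 2 i \<lambda>\<close>, the first block column of the Jost solution
  \<open>\<phi>\<close>, multiplied by \<open>exp (i \<lambda> x)\<close>, solves \<open>F' = u G\<close>, \<open>G' = v F + \<zeta> G\<close>, and \<open>a\<^sup>+\<close> is the limit of
  \<open>F\<close> at \<open>+\<infinity>\<close>. The quotient \<open>G F\<^sup>-\<^sup>1\<close> has the formal Riccati expansion \<open>Y\<close> in powers of
  \<open>1/\<zeta>\<close>, so that \<open>ln det a\<^sup>+\<close> expands into the integrals of \<open>tr (u Y)\<close>, which are local functionals of
  the potential. A second formal series \<open>B\<close> solves the adjoint linearized Riccati equation; the variation
  of \<open>\<integral> tr (u Y)\<close> is \<open>\<integral> tr (\<delta>u C) - tr (B \<delta>v)\<close> with \<open>C = Y + Y B Y\<close>. The entries of the resolvent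
  built from \<open>Y\<close> and \<open>B\<close> solve a linear first order system, by which
  \<open>(\<lambda> - \<mu>) tr (C(\<lambda>) B(\<mu>) - B(\<lambda>) C(\<mu>))\<close> is a total derivative. Comparing coefficients, the
  bracket of the functionals with indices \<open>k + 1\<close> and \<open>p\<close> equals that with indices \<open>k\<close> and \<open>p + 1\<close>,
  and it vanishes at index \<open>0\<close>. The reflection \<open>x \<mapsto> - x\<close> turns \<open>c\<^sup>+\<close> into \<open>a\<^sup>+\<close>; by uniqueness
  of the solution of the linear system, \<open>J\<^sub>k\<close> has the same gradient as \<open>I\<^sub>k\<close>.\<close>

text \<open>The functionals are given only by definite descriptions, so the scattering matrix, its
  extension to the half-plane and the coefficients of the expansion must each be shown unique before
  anything can be computed. Once this is done, scattering data are never differentiated with respect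
  to the potential: along a line of potentials the local functionals are polynomials in the
  parameter, and their first variation is algebra plus one integration by parts. The analytic
  obstacle is the error estimate. It must hold for all large z with Im z \<ge> 0, including real z,
  where the exponentials only oscillate. Moreover F can be singular at some x, so the quotient of G
  by F merely motivates the series Y; what is estimated is the difference G - Y F for a truncation
  of Y, and the determinant of F is differentiated row by row. The two-parameter identity for the
  bracket is used coefficientwise, multiplication by \<zeta> being a shift of the index, so no
  convergence of Y or B in \<zeta> enters.\<close>

no_notation fps_nth (infixl "$" 75)

section \<open>Matrices\<close>

type_synonym ('m, 'n) pot = "real \<Rightarrow> ((complex, 'm) vec, 'n) vec"

lemma bounded_bilinear_matrix_mult:
  "bounded_bilinear ((**) :: complex^'b::finite^'a::finite \<Rightarrow> complex^'c::finite^'b \<Rightarrow> complex^'c^'a)"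
proof -
  have "bilinear ((**) :: complex^'b::finite^'a::finite \<Rightarrow> complex^'c::finite^'b \<Rightarrow> complex^'c^'a)"
    unfolding bilinear_def
    by (auto intro!: linearI simp: matrix_add_ldistrib vec_eq_iff matrix_matrix_mult_def
        sum.distrib algebra_simps scaleR_sum_right)
  then show ?thesis
    by (simp add: bilinear_conv_bounded_bilinear)
qed

interpretation mm: bounded_bilinear
  "(**) :: complex^'b::finite^'a::finite \<Rightarrow> complex^'c::finite^'b \<Rightarrow> complex^'c^'a"
  by (rule bounded_bilinear_matrix_mult)

text \<open>Real scaling does not cover complex factors; \<open>mat_mult_eq_cscale\<close>
  translates the products \<open>mat c ** A\<close> of the statement into this bilinear map.\<close>

definition cscale :: "complex \<Rightarrow> complex^'b::finite^'a::finite \<Rightarrow> complex^'b^'a" where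
  "cscale c A = (\<chi> i j. c * A $ i $ j)"

abbreviation imul :: "('m::finite, 'n::finite) pot \<Rightarrow> ('m, 'n) pot" where
  "imul q \<equiv> \<lambda>x. cscale \<i> (q x)"

text \<open>The minus sign absorbs the one that d/dx acquires under x -> -x.\<close>

abbreviation nrefl :: "('m::finite, 'n::finite) pot \<Rightarrow> ('m, 'n) pot" where
  "nrefl q \<equiv> \<lambda>x. - q (- x)"

lemma cscale_nth [simp]: "cscale c A $ i $ j = c * A $ i $ j"
  by (simp add: cscale_def)

lemma mat_mult_eq_cscale: "mat c ** A = cscale c A"
  by (simp add: vec_eq_iff matrix_matrix_mult_def mat_def if_distrib if_distribR cong: if_cong)

lemma mult_mat_eq_cscale: "A ** mat c = cscale c A"
  by (simp add: vec_eq_iff matrix_matrix_mult_def mat_def if_distrib if_distribR mult.commute cong: if_cong)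

lemma bounded_bilinear_cscale:
  "bounded_bilinear (cscale :: complex \<Rightarrow> complex^'b::finite^'a::finite \<Rightarrow> complex^'b^'a)"
proof -
  have "bilinear (cscale :: complex \<Rightarrow> complex^'b::finite^'a::finite \<Rightarrow> complex^'b^'a)"
    unfolding bilinear_def by (auto intro!: linearI simp: vec_eq_iff algebra_simps)
  then show ?thesis
    by (simp add: bilinear_conv_bounded_bilinear)
qed

interpretation cscale: bounded_bilinear
  "cscale :: complex \<Rightarrow> complex^'b::finite^'a::finite \<Rightarrow> complex^'b^'a"
  by (rule bounded_bilinear_cscale)

lemma cscale_cscale [simp]: "cscale c (cscale d A) = cscale (c * d) A"
  by (simp add: vec_eq_iff mult.assoc)

lemma cscale_1 [simp]: "cscale 1 A = A"
  by (simp add: vec_eq_iff)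

lemma cscale_mult_left [simp]: "cscale c A ** B = cscale c (A ** B)"
  by (simp add: vec_eq_iff matrix_matrix_mult_def sum_distrib_left mult.assoc)

lemma cscale_mult_right [simp]: "A ** cscale c B = cscale c (A ** B)"
  by (simp add: vec_eq_iff matrix_matrix_mult_def sum_distrib_left algebra_simps)

lemma trace_cscale [simp]: "trace (cscale c A) = c * trace A"
  by (simp add: trace_def sum_distrib_left)

lemma bounded_linear_trace: "bounded_linear (trace :: complex^'n::finite^'n \<Rightarrow> complex)"
proof -
  have "linear (trace :: complex^'n::finite^'n \<Rightarrow> complex)"
    by (auto intro!: linearI simp: trace_def sum.distrib scaleR_sum_right)
  then show ?thesis
    by (simp add: linear_conv_bounded_linear)
qed

section \<open>Schwartz functions\<close>

abbreviation Dx :: "(real \<Rightarrow> 'a::real_normed_vector) \<Rightarrow> real \<Rightarrow> 'a" where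
  "Dx f \<equiv> \<lambda>x. vector_derivative f (at x)"

text \<open>Smoothness by coinduction: the derivative inside the class is picked by a choice
  function \<open>d\<close>, and its iterates form the chain of derivatives that
  \<open>schwartz\<close> asks for. Closure properties then only need a class stable under one
  differentiation.\<close>

lemma schwartz_coinduct:
  assumes "P f"
    and step: "\<And>f. P f \<Longrightarrow> \<exists>f'. (\<forall>x. (f has_vector_derivative f' x) (at x)) \<and> P f'"
    and decay: "\<And>f l. P f \<Longrightarrow> bounded (range (\<lambda>x. x ^ l *\<^sub>R f x))"
  shows "schwartz f"
proof -
  obtain d where d: "\<And>f. P f \<Longrightarrow> (\<forall>x. (f has_vector_derivative d f x) (at x)) \<and> P (d f)"
    using step by metis
  have P: "P ((d ^^ j) f)" for j
    by (induction j) (use d \<open>P f\<close> in auto)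
  show ?thesis
    unfolding schwartz_def
    by (rule exI[of _ "\<lambda>j. (d ^^ j) f"]) (use d P decay in auto)
qed

lemma schwartz_has_derivative: "schwartz f \<Longrightarrow> (f has_vector_derivative Dx f x) (at x)"
  unfolding schwartz_def by (metis vector_derivative_works differentiableI_vector)

lemma schwartz_Dx: "schwartz f \<Longrightarrow> schwartz (Dx f)"
proof -
  assume "schwartz f"
  then obtain D where D: "D 0 = f" "\<And>j x. (D j has_vector_derivative D (Suc j) x) (at x)"
      "\<And>j l. bounded (range (\<lambda>x. x ^ l *\<^sub>R D j x))"
    unfolding schwartz_def by blast
  have "Dx f = D (Suc 0)"
    using D(2)[of 0] unfolding D(1) by (auto simp: fun_eq_iff intro: vector_derivative_at)
  then show "schwartz (Dx f)"
    unfolding schwartz_def by (intro exI[of _ "\<lambda>j. D (Suc j)"]) (use D in auto)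
qed

lemma schwartz_bounded: "schwartz f \<Longrightarrow> bounded (range (\<lambda>x. x ^ l *\<^sub>R f x))"
  unfolding schwartz_def by metis

lemma schwartz_continuous: "schwartz f \<Longrightarrow> continuous_on A f"
  by (meson continuous_at_imp_continuous_on has_vector_derivative_continuous schwartz_has_derivative)

lemma schwartz_bilinear:
  assumes "bounded_bilinear pr" "schwartz f" "schwartz g"
  shows "schwartz (\<lambda>x. pr (f x) (g x))"
proof -
  interpret bounded_bilinear pr by fact
  \<comment> \<open>The derivative of a product is a sum of two products, so the class that is
    stable under differentiation consists of finite sums of products.\<close>
  define P where "P F \<longleftrightarrow> (\<exists>I :: nat set. \<exists>a b. finite I \<and> (\<forall>i. schwartz (a i) \<and> schwartz (b i)) \<and>
      F = (\<lambda>x. \<Sum>i\<in>I. pr (a i x) (b i x)))" for F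
  have base: "P (\<lambda>x. pr (a x) (b x))" if "schwartz a" "schwartz b" for a b
    unfolding P_def using that by (intro exI[of _ "{0}"] exI[of _ "\<lambda>_. a"] exI[of _ "\<lambda>_. b"]) auto
  have zero: "P (\<lambda>x. 0)"
    unfolding P_def using assms by (intro exI[of _ "{}"] exI[of _ "\<lambda>_. f"] exI[of _ "\<lambda>_. g"]) auto
  have add: "P (\<lambda>x. F x + pr (a x) (b x))" if "P F" "schwartz a" "schwartz b" for F a b
  proof -
    obtain I :: "nat set" and as bs where I: "finite I" "\<forall>i. schwartz (as i) \<and> schwartz (bs i)"
        "F = (\<lambda>x. \<Sum>i\<in>I. pr (as i x) (bs i x))"
      using \<open>P F\<close> unfolding P_def by blast
    obtain n where n: "n \<notin> I"
      using I(1) by (meson ex_new_if_finite infinite_UNIV_nat)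
    show ?thesis
      unfolding P_def using that I n
      by (intro exI[of _ "insert n I"] exI[of _ "as(n := a)"] exI[of _ "bs(n := b)"])
         (auto simp: fun_eq_iff add.commute intro!: sum.cong)
  qed
  have P_deriv: "P (\<lambda>x. \<Sum>i\<in>I. pr (a i x) (Dx (b i) x) + pr (Dx (a i) x) (b i x))"
    if "finite I" "\<forall>i. schwartz (a i) \<and> schwartz (b i)" for I :: "nat set" and a b
    using that
  proof (induction I)
    case empty
    then show ?case using zero by simp
  next
    case (insert i I)
    have "P (\<lambda>x. (\<Sum>i\<in>I. pr (a i x) (Dx (b i) x) + pr (Dx (a i) x) (b i x))
        + pr (a i x) (Dx (b i) x) + pr (Dx (a i) x) (b i x))"
      by (intro add insert) (use insert schwartz_Dx in auto)
    then show ?case using insert by (simp add: add.commute add.assoc add.left_commute)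
  qed
  show ?thesis
  proof (rule schwartz_coinduct[of P])
    show "P (\<lambda>x. pr (f x) (g x))" by (rule base) fact+
  next
    fix F assume "P F"
    then obtain I :: "nat set" and a b where I: "finite I" "\<forall>i. schwartz (a i) \<and> schwartz (b i)"
        "F = (\<lambda>x. \<Sum>i\<in>I. pr (a i x) (b i x))"
      unfolding P_def by blast
    show "\<exists>F'. (\<forall>x. (F has_vector_derivative F' x) (at x)) \<and> P F'"
    proof (intro exI conjI allI)
      show "P (\<lambda>x. \<Sum>i\<in>I. pr (a i x) (Dx (b i) x) + pr (Dx (a i) x) (b i x))"
        by (rule P_deriv) (use I in auto)
      show "(F has_vector_derivative (\<Sum>i\<in>I. pr (a i x) (Dx (b i) x) + pr (Dx (a i) x) (b i x))) (at x)" for x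
        unfolding I(3)
        by (intro has_vector_derivative_sum has_vector_derivative) (use I schwartz_has_derivative in auto)
    qed
  next
    fix F l assume "P F"
    then obtain I :: "nat set" and a b where I: "finite I" "\<forall>i. schwartz (a i) \<and> schwartz (b i)"
        "F = (\<lambda>x. \<Sum>i\<in>I. pr (a i x) (b i x))"
      unfolding P_def by blast
    have "\<exists>B. \<forall>x. norm (x ^ l *\<^sub>R pr (a i x) (b i x)) \<le> B" for i
    proof -
      obtain K where K: "K > 0" "\<And>x y. norm (pr x y) \<le> norm x * norm y * K"
        using pos_bounded by blast
      obtain B1 where B1: "\<And>x. norm (x ^ l *\<^sub>R a i x) \<le> B1"
        using schwartz_bounded[of "a i" l] I(2) unfolding bounded_iff by auto
      obtain B2 where B2: "\<And>x. norm (b i x) \<le> B2"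
        using schwartz_bounded[of "b i" 0] I(2) unfolding bounded_iff by auto
      have "norm (x ^ l *\<^sub>R pr (a i x) (b i x)) \<le> B1 * B2 * K" for x
      proof -
        have "norm (x ^ l *\<^sub>R pr (a i x) (b i x)) = norm (pr (x ^ l *\<^sub>R a i x) (b i x))"
          by (simp add: scaleR_left)
        also have "\<dots> \<le> norm (x ^ l *\<^sub>R a i x) * norm (b i x) * K" by (rule K)
        also have "\<dots> \<le> B1 * B2 * K"
          using B1[of x] B2[of x] K(1) norm_ge_zero order_trans
          by (intro mult_right_mono mult_mono) (blast intro: order_trans[OF norm_ge_zero] less_imp_le)+
        finally show ?thesis .
      qed
      then show ?thesis by blast
    qed
    then obtain B where B: "\<And>i x. norm (x ^ l *\<^sub>R pr (a i x) (b i x)) \<le> B i" by metis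
    have "norm (x ^ l *\<^sub>R F x) \<le> (\<Sum>i\<in>I. B i)" for x
      unfolding I(3) scaleR_sum_right by (rule order_trans[OF norm_sum sum_mono]) (rule B)
    then show "bounded (range (\<lambda>x. x ^ l *\<^sub>R F x))"
      unfolding bounded_iff by auto
  qed
qed

lemma schwartz_add:
  assumes "schwartz f" "schwartz g"
  shows "schwartz (\<lambda>x. f x + g x)"
proof (rule schwartz_coinduct[of "\<lambda>F. \<exists>a b. schwartz a \<and> schwartz b \<and> F = (\<lambda>x. a x + b x)"])
  show "\<exists>a b. schwartz a \<and> schwartz b \<and> (\<lambda>x. f x + g x) = (\<lambda>x. a x + b x)"
    using assms by blast
next
  fix F assume "\<exists>a b. schwartz a \<and> schwartz b \<and> F = (\<lambda>x. a x + b x :: 'a)"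
  then obtain a b where ab: "schwartz a" "schwartz b" "F = (\<lambda>x. a x + b x)" by blast
  show "\<exists>f'. (\<forall>x. (F has_vector_derivative f' x) (at x)) \<and>
            (\<exists>a b. schwartz a \<and> schwartz b \<and> f' = (\<lambda>x. a x + b x))"
    by (rule exI[of _ "\<lambda>x. Dx a x + Dx b x"])
       (use ab schwartz_Dx schwartz_has_derivative in \<open>auto intro!: has_vector_derivative_add\<close>)
next
  fix F l assume "\<exists>a b. schwartz a \<and> schwartz b \<and> F = (\<lambda>x. a x + b x :: 'a)"
  then obtain a b where ab: "schwartz a" "schwartz b" "F = (\<lambda>x. a x + b x)" by blast
  show "bounded (range (\<lambda>x. x ^ l *\<^sub>R F x))"
    using bounded_plus_comp[OF schwartz_bounded[OF ab(1), of l] schwartz_bounded[OF ab(2), of l]]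
    unfolding ab(3) by (simp add: scaleR_add_right)
qed

lemma schwartz_linear:
  assumes "bounded_linear L" "schwartz f"
  shows "schwartz (\<lambda>x. L (f x))"
proof (rule schwartz_coinduct[of "\<lambda>F. \<exists>a. schwartz a \<and> F = (\<lambda>x. L (a x))"])
  interpret bounded_linear L by fact
  show "\<exists>a. schwartz a \<and> (\<lambda>x. L (f x)) = (\<lambda>x. L (a x))"
    using assms by blast
  fix F assume "\<exists>a. schwartz a \<and> F = (\<lambda>x. L (a x))"
  then obtain a where a: "schwartz a" "F = (\<lambda>x. L (a x))" by blast
  show "\<exists>f'. (\<forall>x. (F has_vector_derivative f' x) (at x)) \<and> (\<exists>a. schwartz a \<and> f' = (\<lambda>x. L (a x)))"
    by (rule exI[of _ "\<lambda>x. L (Dx a x)"])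
       (use a schwartz_Dx schwartz_has_derivative in \<open>auto intro!: has_vector_derivative\<close>)
  fix l show "bounded (range (\<lambda>x. x ^ l *\<^sub>R F x))"
    using bounded_linear_image[OF schwartz_bounded[OF a(1), of l] assms(1)]
    unfolding a(2) by (simp add: image_image scaleR)
qed

lemma has_vector_derivative_reflect:
  assumes "\<And>x. (f has_vector_derivative f' x) (at x)"
  shows "((\<lambda>x. f (- x)) has_vector_derivative - f' (- x)) (at x)"
proof -
  have "(uminus has_vector_derivative (- 1 :: real)) (at x)"
    by (auto intro!: derivative_eq_intros)
  then show ?thesis
    using vector_diff_chain_at[OF _ assms, of uminus "-1" x]
    by (simp add: o_def)
qed

lemma schwartz_reflect:
  assumes "schwartz f"
  shows "schwartz (\<lambda>x. f (- x))"
proof (rule schwartz_coinduct[of "\<lambda>F. \<exists>a. schwartz a \<and> F = (\<lambda>x. a (- x))"])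
  show "\<exists>a. schwartz a \<and> (\<lambda>x. f (- x)) = (\<lambda>x. a (- x))"
    using assms by blast
  fix F assume "\<exists>a. schwartz a \<and> F = (\<lambda>x. a (- x) :: 'a)"
  then obtain a where a: "schwartz a" "F = (\<lambda>x. a (- x))" by blast
  have "((\<lambda>x. a (- x)) has_vector_derivative - Dx a (- x)) (at x)" for x
    by (rule has_vector_derivative_reflect[OF schwartz_has_derivative[OF a(1)]])
  then show "\<exists>f'. (\<forall>x. (F has_vector_derivative f' x) (at x)) \<and> (\<exists>a. schwartz a \<and> f' = (\<lambda>x. a (- x)))"
    using schwartz_linear[OF bounded_linear_minus[OF bounded_linear_ident] schwartz_Dx[OF a(1)]]
    unfolding a(2) by (intro exI[of _ "\<lambda>x. - Dx a (- x)"] conjI exI[of _ "\<lambda>x. - Dx a x"]) auto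
  fix l
  obtain B where B: "\<And>x. norm (x ^ l *\<^sub>R a x) \<le> B"
    using schwartz_bounded[OF a(1), of l] unfolding bounded_iff by auto
  have "norm (x ^ l *\<^sub>R F x) \<le> B" for x
    using B[of "- x"] unfolding a(2) by (simp add: power_abs)
  then show "bounded (range (\<lambda>x. x ^ l *\<^sub>R F x))"
    unfolding bounded_iff by auto
qed

lemma schwartz_uminus: "schwartz f \<Longrightarrow> schwartz (\<lambda>x. - f x)"
  by (rule schwartz_linear[OF bounded_linear_minus[OF bounded_linear_ident]])

lemma schwartz_diff: "schwartz f \<Longrightarrow> schwartz g \<Longrightarrow> schwartz (\<lambda>x. f x - g x)"
  using schwartz_add[OF _ schwartz_uminus, of f g] by simp

lemma schwartz_zero [simp]: "schwartz (\<lambda>x. 0)"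
  by (rule schwartz_coinduct[of "\<lambda>F. F = (\<lambda>x. 0)"]) (auto simp: bounded_iff)

lemma schwartz_sum: "(\<And>i. i \<in> I \<Longrightarrow> schwartz (f i)) \<Longrightarrow> schwartz (\<lambda>x. \<Sum>i\<in>I. f i x)"
  by (induction I rule: infinite_finite_induct) (auto intro!: schwartz_add)

lemma schwartz_if: "(b \<Longrightarrow> schwartz f) \<Longrightarrow> (\<not> b \<Longrightarrow> schwartz g) \<Longrightarrow> schwartz (\<lambda>x. if b then f x else g x)"
  by (cases b) auto

lemmas schwartz_mult = schwartz_bilinear[OF bounded_bilinear_matrix_mult]
lemmas schwartz_trace = schwartz_linear[OF bounded_linear_trace]
lemmas schwartz_cscale = schwartz_linear[OF cscale.bounded_linear_right]

lemmas schwartz_intros = schwartz_add schwartz_diff schwartz_uminus schwartz_zero schwartz_sum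
  schwartz_if schwartz_mult schwartz_trace schwartz_cscale schwartz_Dx

section \<open>Decay like 1 / (1 + x^2), integrability, and integrals of total derivatives\<close>

abbreviation wt :: "real \<Rightarrow> real" where
  "wt x \<equiv> inverse (1 + x\<^sup>2)"

text \<open>The moments of order 0 and 2 together control |f| (1 + x^2); the summand 1 makes the
  constant positive.\<close>

lemma schwartz_decay:
  assumes "schwartz f"
  shows "\<exists>c>0. \<forall>x. norm (f x) \<le> c * wt x"
proof -
  obtain B0 where B0: "\<And>x. norm (f x) \<le> B0"
    using schwartz_bounded[OF assms, of 0] unfolding bounded_iff by auto
  obtain B2 where B2: "\<And>x. norm (x\<^sup>2 *\<^sub>R f x) \<le> B2"
    using schwartz_bounded[OF assms, of 2] unfolding bounded_iff by auto
  have "norm (f x) \<le> (\<bar>B0\<bar> + \<bar>B2\<bar> + 1) * wt x" for x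
  proof -
    have "norm (f x) * (1 + x\<^sup>2) = norm (f x) + norm (x\<^sup>2 *\<^sub>R f x)"
      by (simp add: algebra_simps)
    also have "\<dots> \<le> \<bar>B0\<bar> + \<bar>B2\<bar> + 1"
      using B0[of x] B2[of x] by linarith
    finally have "norm (f x) * (1 + x\<^sup>2) \<le> \<bar>B0\<bar> + \<bar>B2\<bar> + 1" .
    moreover have "1 + x\<^sup>2 > 0"
      by (simp add: add_pos_nonneg)
    ultimately show ?thesis
      by (simp add: field_simps)
  qed
  then show ?thesis
    by (intro exI[of _ "\<bar>B0\<bar> + \<bar>B2\<bar> + 1"]) auto
qed

lemma integrable_inverse_1_plus_square: "integrable lborel (\<lambda>x::real. wt x)"
proof -
  have "set_integrable lborel (einterval (-\<infinity>) \<infinity>) (\<lambda>x::real. wt x)"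
  proof (rule interval_integral_FTC_nonneg[where F = arctan and A = "-pi/2" and B = "pi/2"])
    show "isCont (\<lambda>x::real. wt x) x" for x
    proof -
      have "1 + x\<^sup>2 > 0" by (simp add: add_pos_nonneg)
      then show ?thesis by (auto intro!: continuous_intros)
    qed
  qed (auto intro!: derivative_eq_intros tendsto_arctan_at_bot tendsto_arctan_at_top
      simp: ereal_tendsto_simps)
  then show ?thesis
    by (simp add: set_integrable_def)
qed

lemma integrable_decay:
  fixes f :: "real \<Rightarrow> 'a::euclidean_space"
  assumes "f \<in> borel_measurable borel" "\<And>x. norm (f x) \<le> c * wt x"
  shows "integrable lborel f"
proof (rule Bochner_Integration.integrable_bound)
  show "integrable lborel (\<lambda>x. c * wt x)"
    using integrable_inverse_1_plus_square by simp
  show "AE x in lborel. norm (f x) \<le> norm (c * wt x)"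
    using assms(2) by (auto intro!: AE_I2 order_trans[OF assms(2)])
qed (use assms in simp)

lemma schwartz_integrable:
  fixes f :: "real \<Rightarrow> 'a::euclidean_space"
  assumes "schwartz f"
  shows "integrable lborel f"
  using schwartz_decay[OF assms] integrable_decay
  by (metis assms borel_measurable_continuous_onI schwartz_continuous)

lemma tendsto_inverse_1_plus_square:
  "((\<lambda>x::real. wt x) \<longlongrightarrow> 0) at_top" "((\<lambda>x::real. wt x) \<longlongrightarrow> 0) at_bot"
proof -
  show "((\<lambda>x::real. wt x) \<longlongrightarrow> 0) at_top"
    by (rule tendsto_inverse_0_at_top)
       (intro filterlim_tendsto_add_at_top[OF tendsto_const] filterlim_pow_at_top filterlim_ident; simp)
  show "((\<lambda>x::real. wt x) \<longlongrightarrow> 0) at_bot"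
    by (rule tendsto_inverse_0_at_top)
       (intro filterlim_tendsto_add_at_top[OF tendsto_const] filterlim_pow_at_bot_even filterlim_ident; simp)
qed

lemma tendsto_0_decay:
  assumes "\<And>x. norm (f x) \<le> c * wt x"
  shows "(f \<longlongrightarrow> 0) at_top" "(f \<longlongrightarrow> 0) at_bot"
proof -
  show "(f \<longlongrightarrow> 0) at_top"
    by (rule Lim_null_comparison[OF always_eventually, of f "\<lambda>x. c * wt x"])
       (use assms tendsto_mult_right_zero[OF tendsto_inverse_1_plus_square(1)] in auto)
  show "(f \<longlongrightarrow> 0) at_bot"
    by (rule Lim_null_comparison[OF always_eventually, of f "\<lambda>x. c * wt x"])
       (use assms tendsto_mult_right_zero[OF tendsto_inverse_1_plus_square(2)] in auto)
qed

lemma schwartz_tendsto_0: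
  assumes "schwartz f"
  shows "(f \<longlongrightarrow> 0) at_top" "(f \<longlongrightarrow> 0) at_bot"
  using schwartz_decay[OF assms] tendsto_0_decay by metis+

text \<open>Both the variation formula and the involution rest on this: densities that differ by the
  derivative of a Schwartz function have equal integrals.\<close>

lemma integral_Dx_schwartz:
  fixes f :: "real \<Rightarrow> 'a::euclidean_space"
  assumes "schwartz f"
  shows "(LINT x|lborel. Dx f x) = 0"
proof -
  have "(LBINT x=-\<infinity>..\<infinity>. Dx f x) = 0 - 0"
  proof (rule interval_integral_FTC_integrable[where F = f])
    show "(f has_vector_derivative Dx f x) (at x)" for x
      by (rule schwartz_has_derivative) fact
    show "isCont (Dx f) x" for x
      using schwartz_continuous[OF schwartz_Dx[OF assms], of UNIV]
      by (simp add: continuous_on_eq_continuous_at)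
    show "set_integrable lborel (einterval (-\<infinity>) \<infinity>) (Dx f)"
      using schwartz_integrable[OF schwartz_Dx[OF assms]] by (simp add: set_integrable_def)
  qed (use schwartz_tendsto_0[OF assms] in \<open>auto simp: ereal_tendsto_simps\<close>)
  then show ?thesis
    by (simp add: interval_lebesgue_integral_def set_lebesgue_integral_def)
qed

text \<open>Decay fixes the constant of integration; this is what makes the local system below
  uniquely solvable.\<close>

lemma schwartz_derivative_zero:
  fixes f :: "real \<Rightarrow> 'a::real_normed_vector"
  assumes "schwartz f" "\<And>x. (f has_vector_derivative 0) (at x)"
  shows "f = (\<lambda>x. 0)"
proof -
  obtain c where c: "\<And>x. f x = c"
    using has_vector_derivative_zero_constant[of UNIV f] assms(2) by (auto)
  then have "f = (\<lambda>x. c)" by auto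
  then have "c = 0"
    using schwartz_tendsto_0(1)[OF assms(1)] by (simp add: tendsto_const_iff)
  then show ?thesis using c by auto
qed

lemma integral_reflect:
  fixes f :: "real \<Rightarrow> 'a::euclidean_space"
  shows "(LINT x|lborel. f (- x)) = (LINT x|lborel. f x)"
  using lborel_integral_real_affine[of "-1" f 0] by simp

section \<open>Formal power series with matrix coefficients\<close>

text \<open>Cauchy product of coefficient sequences. The factors are rectangular blocks of varying
  shape, so they do not form one ring over which a type of power series could be taken.\<close>

definition conv :: "(nat \<Rightarrow> complex^'b::finite^'a::finite) \<Rightarrow> (nat \<Rightarrow> complex^'c::finite^'b) \<Rightarrow> nat \<Rightarrow> complex^'c^'a"
    (infixr "\<star>" 70) where
  "(f \<star> g) k = (\<Sum>i\<le>k. f i ** g (k - i))"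

definition cs :: "'a::zero \<Rightarrow> nat \<Rightarrow> 'a" where
  "cs u k = (if k = 0 then u else 0)"

text \<open>Multiplication by \<zeta> of a series in 1/\<zeta> without constant term. The product
  rules \<open>conv_sh_left\<close> and \<open>conv_sh_right\<close> assume that the dropped
  coefficient is 0.\<close>

definition sh :: "(nat \<Rightarrow> 'a) \<Rightarrow> nat \<Rightarrow> 'a" where
  "sh f k = f (Suc k)"

lemma conv_assoc: "(f \<star> g) \<star> h = f \<star> g \<star> h"
proof
  fix n
  have "((f \<star> g) \<star> h) n = (\<Sum>j=0..n. \<Sum>i=0..j. f i ** g (j - i) ** h (n - j))"
    by (simp add: conv_def mm.sum_left atLeast0AtMost)
  also have "\<dots> = (\<Sum>j=0..n. \<Sum>i=0..n - j. f j ** g i ** h (n - j - i))"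
    by (rule fps_mult_assoc_lemma[of "\<lambda>a b c. f a ** g b ** h c" n])
  also have "\<dots> = (f \<star> g \<star> h) n"
    by (simp add: conv_def mm.sum_right atLeast0AtMost matrix_mul_assoc)
  finally show "((f \<star> g) \<star> h) n = (f \<star> g \<star> h) n" .
qed

lemma conv_add_left: "(f + g) \<star> h = f \<star> h + g \<star> h"
  and conv_diff_left: "(f - g) \<star> h = f \<star> h - g \<star> h"
  and conv_add_right: "f \<star> (h + k) = f \<star> h + f \<star> k"
  and conv_diff_right: "f \<star> (h - k) = f \<star> h - f \<star> k"
  by (simp_all add: fun_eq_iff conv_def mm.add_left mm.add_right mm.diff_left mm.diff_right
      sum.distrib sum_subtractf)

lemma conv_cs_left: "(cs u \<star> f) k = u ** f k"
  by (simp add: conv_def cs_def if_distribR if_distrib sum.delta cong: if_cong)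

lemma conv_cs_right: "(f \<star> cs u) k = f k ** u"
proof -
  have "(f \<star> cs u) k = (\<Sum>i\<le>k. if i = k then f i ** u else 0)"
    unfolding conv_def by (intro sum.cong) (auto simp: cs_def)
  then show ?thesis by (simp add: sum.delta)
qed

lemma conv_sh_left: "f 0 = 0 \<Longrightarrow> sh f \<star> g = sh (f \<star> g)"
  by (simp add: fun_eq_iff conv_def sh_def sum.atMost_Suc_shift del: sum.atMost_Suc)

lemma conv_sh_right: "g 0 = 0 \<Longrightarrow> f \<star> sh g = sh (f \<star> g)"
  by (auto simp: fun_eq_iff conv_def sh_def Suc_diff_le intro!: sum.cong)

lemma trace_sum: "trace (\<Sum>i\<in>I. f i :: complex^'n::finite^'n) = (\<Sum>i\<in>I. trace (f i))"
  by (induction I rule: infinite_finite_induct) (simp_all add: trace_add, simp_all add: trace_def)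

lemma trace_conv_commute: "trace ((f \<star> g) k) = trace ((g \<star> f) k)"
proof -
  have "trace ((f \<star> g) k) = (\<Sum>i\<le>k. trace (g (k - i) ** f i))"
    by (simp add: conv_def trace_sum trace_mul_sym[of "f _"])
  also have "\<dots> = (\<Sum>i\<le>k. trace (g i ** f (k - i)))"
    using sum.nat_diff_reindex[of "\<lambda>i. trace (g (k - i) ** f i)" "Suc k"]
    by (simp add: lessThan_Suc_atMost)
  also have "\<dots> = trace ((g \<star> f) k)"
    by (simp add: conv_def trace_sum)
  finally show ?thesis .
qed

lemma conv_has_derivative:
  assumes "\<And>k. (f k has_vector_derivative f' k) (at x)" "\<And>k. (g k has_vector_derivative g' k) (at x)"
  shows "((\<lambda>t. ((\<lambda>k. f k t) \<star> (\<lambda>k. g k t)) k) has_vector_derivative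
           (f' \<star> (\<lambda>k. g k x) + (\<lambda>k. f k x) \<star> g') k) (at x)"
proof -
  have "((\<lambda>t. ((\<lambda>k. f k t) \<star> (\<lambda>k. g k t)) k) has_vector_derivative
      (\<Sum>i\<le>k. f i x ** g' (k - i) + f' i ** g (k - i) x)) (at x)"
    unfolding conv_def
    by (intro has_vector_derivative_sum mm.has_vector_derivative assms)
  then show ?thesis
    by (simp add: conv_def sum.distrib add.commute)
qed

lemma schwartz_conv:
  assumes "\<And>k. schwartz (f k)" "\<And>k. schwartz (g k)"
  shows "schwartz (\<lambda>x. ((\<lambda>k. f k x) \<star> (\<lambda>k. g k x)) k)"
  unfolding conv_def by (intro schwartz_intros assms)


section \<open>The formal Riccati solution and the resolvent\<close>

text \<open>Coefficients of Y in Y' = v + \<zeta> Y - Y u Y, solved for the term that \<zeta> Y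
  contributes one index higher. The start value 0 selects the formal solution that vanishes at
  \<zeta> = infinity.\<close>

fun ric :: "('m::finite, 'n::finite) pot \<Rightarrow> ('n, 'm) pot \<Rightarrow> nat \<Rightarrow> ('n, 'm) pot" where
  "ric u v 0 = (\<lambda>x. 0)"
| "ric u v (Suc k) = (\<lambda>x. Dx (ric u v k) x - (if k = 0 then v x else 0)
      + (\<Sum>a\<le>k. ric u v a x ** u x ** ric u v (k - a) x))"

declare ric.simps(2) [simp del]

text \<open>Coefficients of B in B' = u - \<zeta> B + B Y u + u Y B. In the pairing tr (B d) the
  homogeneous part is minus the adjoint of the linearized Riccati operator d \<mapsto> \<zeta> d - d
  u Y - Y u d, and the source u is the derivative of tr (u Y) with respect to Y.\<close>

fun res :: "('m::finite, 'n::finite) pot \<Rightarrow> ('n, 'm) pot \<Rightarrow> nat \<Rightarrow> ('m, 'n) pot" where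
  "res u v 0 = (\<lambda>x. 0)"
| "res u v (Suc k) = (\<lambda>x. (if k = 0 then u x else 0) - Dx (res u v k) x
      + (\<Sum>a\<le>k. res u v a x ** ric u v (k - a) x) ** u x
      + u x ** (\<Sum>a\<le>k. ric u v a x ** res u v (k - a) x))"

declare res.simps(2) [simp del]

lemma schwartz_ric:
  assumes "schwartz u" "schwartz v"
  shows "schwartz (ric u v k)"
proof (induction k rule: less_induct)
  case (less k)
  show ?case
    by (cases k) (use less assms in \<open>auto simp: ric.simps intro!: schwartz_intros\<close>)
qed

lemma schwartz_res:
  assumes "schwartz u" "schwartz v"
  shows "schwartz (res u v k)"
proof (induction k rule: less_induct)
  case (less k)
  show ?case
    by (cases k) (use less assms schwartz_ric in \<open>auto simp: res.simps intro!: schwartz_intros\<close>)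
qed

lemma ric_has_derivative:
  assumes "schwartz u" "schwartz v"
  shows "(ric u v k has_vector_derivative
     (cs (v x) + sh (\<lambda>k. ric u v k x) - (\<lambda>k. ric u v k x) \<star> cs (u x) \<star> (\<lambda>k. ric u v k x)) k) (at x)"
proof -
  have "(cs (v x) + sh (\<lambda>k. ric u v k x) - (\<lambda>k. ric u v k x) \<star> cs (u x) \<star> (\<lambda>k. ric u v k x)) k
      = Dx (ric u v k) x"
    unfolding conv_assoc[symmetric]
    by (simp add: cs_def sh_def ric.simps(2) conv_cs_right conv_def[of "_ \<star> _"])
  then show ?thesis
    using schwartz_has_derivative[OF schwartz_ric[OF assms]] by metis
qed

lemma res_has_derivative:
  assumes "schwartz u" "schwartz v"
  shows "(res u v k has_vector_derivative
     (cs (u x) - sh (\<lambda>k. res u v k x) + (\<lambda>k. res u v k x) \<star> (\<lambda>k. ric u v k x) \<star> cs (u x)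
      + cs (u x) \<star> (\<lambda>k. ric u v k x) \<star> (\<lambda>k. res u v k x)) k) (at x)"
proof -
  have "(cs (u x) - sh (\<lambda>k. res u v k x) + (\<lambda>k. res u v k x) \<star> (\<lambda>k. ric u v k x) \<star> cs (u x)
      + cs (u x) \<star> (\<lambda>k. ric u v k x) \<star> (\<lambda>k. res u v k x)) k = Dx (res u v k) x"
    unfolding conv_assoc[symmetric, of _ _ "cs _"]
    by (simp add: cs_def sh_def res.simps(2) conv_cs_right conv_cs_left)
       (simp add: conv_def)
  then show ?thesis
    using schwartz_has_derivative[OF schwartz_res[OF assms]] by metis
qed

definition res_nn :: "('m::finite, 'n::finite) pot \<Rightarrow> ('n, 'm) pot \<Rightarrow> nat \<Rightarrow> real \<Rightarrow> complex^'n^'n" where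
  "res_nn u v k x = ((\<lambda>k. res u v k x) \<star> (\<lambda>k. ric u v k x)) k"

definition res_mm :: "('m::finite, 'n::finite) pot \<Rightarrow> ('n, 'm) pot \<Rightarrow> nat \<Rightarrow> real \<Rightarrow> complex^'m^'m" where
  "res_mm u v k x = ((\<lambda>k. ric u v k x) \<star> (\<lambda>k. res u v k x)) k"

definition res_mn :: "('m::finite, 'n::finite) pot \<Rightarrow> ('n, 'm) pot \<Rightarrow> nat \<Rightarrow> ('n, 'm) pot" where
  "res_mn u v k x = ric u v k x + ((\<lambda>k. ric u v k x) \<star> (\<lambda>k. res u v k x) \<star> (\<lambda>k. ric u v k x)) k"

text \<open>With \<open>\<beta>, \<delta>, C, B\<close> the formal series in \<open>1/\<zeta>\<close> whose coefficients these are, the block matrix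
  with rows \<open>1 + \<beta>, - B\<close> and \<open>C, - \<delta>\<close> commutes with \<open>d/dx - U\<close>, where \<open>U\<close> has
  the rows \<open>0, u\<close> and \<open>v, \<zeta>\<close>.\<close>

definition local_sys ::
  "('m::finite, 'n::finite) pot \<Rightarrow> ('n, 'm) pot \<Rightarrow> (nat \<Rightarrow> real \<Rightarrow> complex^'n^'n) \<Rightarrow>
   (nat \<Rightarrow> real \<Rightarrow> complex^'m^'m) \<Rightarrow> (nat \<Rightarrow> ('n, 'm) pot) \<Rightarrow> (nat \<Rightarrow> ('m, 'n) pot) \<Rightarrow> bool" where
  "local_sys u v \<beta> \<delta> C B \<longleftrightarrow>
     (\<forall>k. schwartz (\<beta> k) \<and> schwartz (\<delta> k) \<and> schwartz (C k) \<and> schwartz (B k)) \<and>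
     C 0 = (\<lambda>x. 0) \<and> B 0 = (\<lambda>x. 0) \<and>
     (\<forall>k x. (\<beta> k has_vector_derivative u x ** C k x + B k x ** v x) (at x)) \<and>
     (\<forall>k x. (\<delta> k has_vector_derivative v x ** B k x + C k x ** u x) (at x)) \<and>
     (\<forall>k x. (C k has_vector_derivative
        (if k = 0 then v x else 0) + v x ** \<beta> k x + \<delta> k x ** v x + C (Suc k) x) (at x)) \<and>
     (\<forall>k x. (B k has_vector_derivative
        (if k = 0 then u x else 0) + \<beta> k x ** u x + u x ** \<delta> k x - B (Suc k) x) (at x))"

lemma local_sysD:
  assumes "local_sys u v \<beta> \<delta> C B"
  shows "schwartz (\<beta> k)" "schwartz (\<delta> k)" "schwartz (C k)" "schwartz (B k)"
    and "(\<beta> k has_vector_derivative u x ** C k x + B k x ** v x) (at x)"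
    and "(\<delta> k has_vector_derivative v x ** B k x + C k x ** u x) (at x)"
    and "(C k has_vector_derivative
        (if k = 0 then v x else 0) + v x ** \<beta> k x + \<delta> k x ** v x + C (Suc k) x) (at x)"
    and "(B k has_vector_derivative
        (if k = 0 then u x else 0) + \<beta> k x ** u x + u x ** \<delta> k x - B (Suc k) x) (at x)"
  using assms unfolding local_sys_def by blast+

text \<open>In the product rule for B Y, Y B and Y B Y, the cubic and quartic terms produced by the
  Riccati equation cancel against those in the equation for B, which leaves equations linear in the
  four blocks.\<close>

lemma local_sys_res:
  fixes u :: "('m::finite, 'n::finite) pot" and v :: "('n, 'm) pot"
  assumes uv: "schwartz u" "schwartz v"
  shows "local_sys u v (res_nn u v) (res_mm u v) (res_mn u v) (res u v)"
proof -
  define y where "y x k = ric u v k x" for x k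
  define b where "b x k = res u v k x" for x k
  have y0: "y x 0 = 0" and b0: "b x 0 = 0" for x
    by (simp_all add: y_def b_def)
  define y' where "y' x = cs (v x) + sh (y x) - y x \<star> cs (u x) \<star> y x" for x
  define b' where "b' x = cs (u x) - sh (b x) + b x \<star> y x \<star> cs (u x) + cs (u x) \<star> y x \<star> b x" for x
  have dy: "((\<lambda>x. y x k) has_vector_derivative y' x k) (at x)" for x k
    using ric_has_derivative[OF uv] by (simp add: y_def[abs_def] y'_def)
  have db: "((\<lambda>x. b x k) has_vector_derivative b' x k) (at x)" for x k
    using res_has_derivative[OF uv] by (simp add: b_def[abs_def] y_def[abs_def] b'_def)
  have sb: "schwartz (\<lambda>x. b x k)" and sy: "schwartz (\<lambda>x. y x k)" for k
    using uv by (simp_all add: b_def y_def schwartz_res schwartz_ric)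
  have shs: "sh (b x) \<star> y x = sh (b x \<star> y x)" "b x \<star> sh (y x) = sh (b x \<star> y x)"
     "sh (y x) \<star> b x = sh (y x \<star> b x)" "y x \<star> sh (b x) = sh (y x \<star> b x)" for x
    using y0 b0 by (simp_all add: conv_sh_left conv_sh_right)
  have e1: "b' x \<star> y x + b x \<star> y' x = cs (u x) \<star> (y x + y x \<star> b x \<star> y x) + b x \<star> cs (v x)" for x
    unfolding b'_def y'_def
    by (simp add: conv_add_left conv_diff_left conv_add_right conv_diff_right conv_assoc shs algebra_simps)
  have e2: "y' x \<star> b x + y x \<star> b' x = cs (v x) \<star> b x + (y x + y x \<star> b x \<star> y x) \<star> cs (u x)" for x
    unfolding b'_def y'_def
    by (simp add: conv_add_left conv_diff_left conv_add_right conv_diff_right conv_assoc shs algebra_simps)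
  have shy: "y x \<star> sh (b x \<star> y x) = sh (y x \<star> b x \<star> y x)" "sh (y x) \<star> b x \<star> y x = sh (y x \<star> b x \<star> y x)" for x
    by (subst conv_sh_right) (auto simp: conv_def b0 y0 conv_sh_left)
  \<comment> \<open>Y B Y is differentiated as Y (B Y), so that \<open>e1\<close> can be inserted
    for the derivative of the inner product.\<close>
  have e3: "y' x + (y' x \<star> (b x \<star> y x) + y x \<star> (b' x \<star> y x + b x \<star> y' x))
      = cs (v x) + cs (v x) \<star> b x \<star> y x + y x \<star> b x \<star> cs (v x) + sh (y x + y x \<star> b x \<star> y x)" for x
    unfolding e1 unfolding y'_def
    by (simp add: conv_add_left conv_diff_left conv_add_right conv_diff_right conv_assoc shs shy algebra_simps)
       (simp add: fun_eq_iff sh_def)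
  have dby: "((\<lambda>t. (b t \<star> y t) k) has_vector_derivative (b' x \<star> y x + b x \<star> y' x) k) (at x)" for x k
    using conv_has_derivative[where f = "\<lambda>k t. b t k" and g = "\<lambda>k t. y t k", OF db dy] by simp
  have dyb: "((\<lambda>t. (y t \<star> b t) k) has_vector_derivative (y' x \<star> b x + y x \<star> b' x) k) (at x)" for x k
    using conv_has_derivative[where f = "\<lambda>k t. y t k" and g = "\<lambda>k t. b t k", OF dy db] by simp
  have dyby: "((\<lambda>t. (y t \<star> b t \<star> y t) k) has_vector_derivative
      (y' x \<star> (b x \<star> y x) + y x \<star> (b' x \<star> y x + b x \<star> y' x)) k) (at x)" for x k
    using conv_has_derivative[where f = "\<lambda>k t. y t k" and g = "\<lambda>k t. (b t \<star> y t) k", OF dy dby] by (simp add: plus_fun_def)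
  have nn: "res_nn u v = (\<lambda>k x. (b x \<star> y x) k)" and mm: "res_mm u v = (\<lambda>k x. (y x \<star> b x) k)"
    and mn: "res_mn u v = (\<lambda>k x. y x k + (y x \<star> b x \<star> y x) k)" and b: "res u v = (\<lambda>k x. b x k)"
    by (simp_all add: res_nn_def[abs_def] res_mm_def[abs_def] res_mn_def[abs_def] b_def[abs_def] y_def[abs_def])
  show ?thesis
    unfolding local_sys_def
  proof (intro conjI allI)
    fix k x
    show "schwartz (res_nn u v k)" "schwartz (res_mm u v k)" "schwartz (res u v k)"
      unfolding nn mm b by (intro schwartz_conv sb sy)+
    show "schwartz (res_mn u v k)"
      unfolding mn by (intro schwartz_add schwartz_conv sb sy)
    show "(res_nn u v k has_vector_derivative u x ** res_mn u v k x + res u v k x ** v x) (at x)"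
      using dby[of k x] unfolding nn mn b e1 by (simp add: conv_cs_left conv_cs_right)
    show "(res_mm u v k has_vector_derivative v x ** res u v k x + res_mn u v k x ** u x) (at x)"
      using dyb[of k x] unfolding mm mn b e2 by (simp add: conv_cs_left conv_cs_right)
    show "(res_mn u v k has_vector_derivative (if k = 0 then v x else 0) + v x ** res_nn u v k x +
          res_mm u v k x ** v x + res_mn u v (Suc k) x) (at x)"
    proof -
      have "((\<lambda>x. y x k + (y x \<star> b x \<star> y x) k) has_vector_derivative
          (y' x + (y' x \<star> (b x \<star> y x) + y x \<star> (b' x \<star> y x + b x \<star> y' x))) k) (at x)"
        using has_vector_derivative_add[OF dy dyby] by simp
      then show ?thesis
        unfolding e3 nn mm mn
        by (simp add: conv_cs_left conv_cs_right conv_assoc[symmetric, of _ _ "cs _"] cs_def sh_def)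
    qed
    show "(res u v k has_vector_derivative (if k = 0 then u x else 0) + res_nn u v k x ** u x +
          u x ** res_mm u v k x - res u v (Suc k) x) (at x)"
      using db[of k x] unfolding b'_def nn mm b
      by (simp add: conv_cs_left conv_cs_right conv_assoc[symmetric, of _ _ "cs _"] cs_def sh_def algebra_simps)
  qed (auto simp: res_mn_def conv_def)
qed

text \<open>Induction on the index: \<open>C k\<close> and \<open>B k\<close> fix the derivatives of
  \<open>\<beta> k\<close> and \<open>\<delta> k\<close>, hence these functions by decay; the
  equations for the derivatives of \<open>C k\<close> and \<open>B k\<close> then determine
  \<open>C (Suc k)\<close> and \<open>B (Suc k)\<close>.\<close>

lemma local_sys_unique:
  assumes "local_sys u v \<beta> \<delta> C B" "local_sys u v \<beta>' \<delta>' C' B'"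
  shows "\<beta> k = \<beta>' k \<and> \<delta> k = \<delta>' k \<and> C k = C' k \<and> B k = B' k"
proof -
  note S = assms[unfolded local_sys_def]
  have nn: "\<beta> k = \<beta>' k \<and> \<delta> k = \<delta>' k" if "C k = C' k" "B k = B' k" for k
  proof -
    have "(\<lambda>x. \<beta> k x - \<beta>' k x) = (\<lambda>x. 0)"
    proof (rule schwartz_derivative_zero)
      show "((\<lambda>x. \<beta> k x - \<beta>' k x) has_vector_derivative 0) (at x)" for x
        using has_vector_derivative_diff[OF local_sysD(5)[OF assms(1)] local_sysD(5)[OF assms(2)], of k k x] that by simp
    qed (intro schwartz_diff local_sysD(1)[OF assms(1)] local_sysD(1)[OF assms(2)])
    moreover have "(\<lambda>x. \<delta> k x - \<delta>' k x) = (\<lambda>x. 0)"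
    proof (rule schwartz_derivative_zero)
      show "((\<lambda>x. \<delta> k x - \<delta>' k x) has_vector_derivative 0) (at x)" for x
        using has_vector_derivative_diff[OF local_sysD(6)[OF assms(1)] local_sysD(6)[OF assms(2)], of k k x] that by simp
    qed (intro schwartz_diff local_sysD(2)[OF assms(1)] local_sysD(2)[OF assms(2)])
    ultimately show ?thesis
      by (auto simp: fun_eq_iff)
  qed
  have "C k = C' k \<and> B k = B' k"
  proof (induction k)
    case 0
    then show ?case using S by auto
  next
    case (Suc k)
    have *: "(if k = 0 then v x else 0) + v x ** \<beta> k x + \<delta> k x ** v x + C (Suc k) x =
        (if k = 0 then v x else 0) + v x ** \<beta>' k x + \<delta>' k x ** v x + C' (Suc k) x"
      "(if k = 0 then u x else 0) + \<beta> k x ** u x + u x ** \<delta> k x - B (Suc k) x =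
        (if k = 0 then u x else 0) + \<beta>' k x ** u x + u x ** \<delta>' k x - B' (Suc k) x" for x
    proof -
      have C': "(C k has_vector_derivative (if k = 0 then v x else 0) + v x ** \<beta>' k x + \<delta>' k x ** v x + C' (Suc k) x) (at x)"
        and B': "(B k has_vector_derivative (if k = 0 then u x else 0) + \<beta>' k x ** u x + u x ** \<delta>' k x - B' (Suc k) x) (at x)"
        using local_sysD(7,8)[OF assms(2)] Suc by simp_all
      show "(if k = 0 then v x else 0) + v x ** \<beta> k x + \<delta> k x ** v x + C (Suc k) x =
          (if k = 0 then v x else 0) + v x ** \<beta>' k x + \<delta>' k x ** v x + C' (Suc k) x"
        by (rule vector_derivative_unique_at[OF local_sysD(7)[OF assms(1)] C'])
      show "(if k = 0 then u x else 0) + \<beta> k x ** u x + u x ** \<delta> k x - B (Suc k) x =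
          (if k = 0 then u x else 0) + \<beta>' k x ** u x + u x ** \<delta>' k x - B' (Suc k) x"
        by (rule vector_derivative_unique_at[OF local_sysD(8)[OF assms(1)] B'])
    qed
    show ?case
      using *(1) *(2) nn[of k] Suc by (auto simp: fun_eq_iff)
  qed
  then show ?thesis
    using nn by blast
qed

text \<open>Reflection interchanges the two diagonal and the two off-diagonal blocks: d/dx changes
  sign, and so do the potentials and the shift term, whose signs differ between the equations for C
  and B.\<close>

lemma local_sys_reflect:
  assumes "local_sys (nrefl v) (nrefl u) \<beta> \<delta> C B"
  shows "local_sys u v (\<lambda>k x. \<delta> k (- x)) (\<lambda>k x. \<beta> k (- x)) (\<lambda>k x. B k (- x)) (\<lambda>k x. C k (- x))"
proof -
  note S = assms[unfolded local_sys_def]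
  note d = local_sysD(5-8)[OF assms]
  show ?thesis
    unfolding local_sys_def
  proof (intro conjI allI)
    fix k x
    show "((\<lambda>x. \<delta> k (- x)) has_vector_derivative u x ** B k (- x) + C k (- x) ** v x) (at x)"
      using has_vector_derivative_reflect[OF d(2), of k x] by (simp add: mm.minus_left mm.minus_right add.commute)
    show "((\<lambda>x. \<beta> k (- x)) has_vector_derivative v x ** C k (- x) + B k (- x) ** u x) (at x)"
      using has_vector_derivative_reflect[OF d(1), of k x] by (simp add: mm.minus_left mm.minus_right add.commute)
    show "((\<lambda>x. B k (- x)) has_vector_derivative (if k = 0 then v x else 0) + v x ** \<delta> k (- x) +
           \<beta> k (- x) ** v x + B (Suc k) (- x)) (at x)"
      using has_vector_derivative_reflect[OF d(4), of k x]
      by (simp add: mm.minus_left mm.minus_right algebra_simps split: if_splits)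
    show "((\<lambda>x. C k (- x)) has_vector_derivative (if k = 0 then u x else 0) + \<delta> k (- x) ** u x +
           u x ** \<beta> k (- x) - C (Suc k) (- x)) (at x)"
      using has_vector_derivative_reflect[OF d(3), of k x]
      by (simp add: mm.minus_left mm.minus_right algebra_simps split: if_splits)
  qed (use S in \<open>auto simp: schwartz_reflect\<close>)
qed

text \<open>Let R be the block matrix with R' = [U, R]. Then tr (R(\<zeta>) R(\<mu>)) has the
  derivative tr ((U(\<zeta>) - U(\<mu>)) [R(\<zeta>), R(\<mu>)]), and U(\<zeta>) - U(\<mu>) has only
  the lower right block \<zeta> - \<mu>. Up to sign this leaves (\<zeta> - \<mu>) times the trace in
  question.\<close>

lemma local_sys_involution:
  fixes u :: "('m::finite, 'n::finite) pot"
  assumes "local_sys u v \<beta> \<delta> C B"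
  shows "(LINT x|lborel. trace (C a x ** B c x) - trace (B a x ** C c x)) = 0"
\<comment> \<open>Lowering the first index raises the second one, so the latter has to stay
  arbitrary.\<close>
proof (induction a arbitrary: c)
  case 0
  then show ?case
    using assms by (simp add: local_sys_def trace_def)
next
  case (Suc a)
  note S = assms[unfolded local_sys_def]
  note d = local_sysD(5-8)[OF assms] and s = local_sysD(1-4)[OF assms]
  define K where "K a c x = trace (C a x ** B c x) - trace (B a x ** C c x)" for a c x
  \<comment> \<open>The coefficient of -tr (R(\<zeta>) R(\<mu>)) without the constant tr 1; the two
    conditional terms stem from the 1 in the block 1 + \<beta>.\<close>
  define S1 where "S1 x = trace (C a x ** B c x) + trace (B a x ** C c x) - trace (\<beta> a x ** \<beta> c x)
      - trace (\<delta> a x ** \<delta> c x) - (if a = 0 then trace (\<beta> c x) else 0) - (if c = 0 then trace (\<beta> a x) else 0)" for x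
  have sS: "schwartz S1"
    unfolding S1_def by (intro schwartz_intros s)
  have dS: "(S1 has_vector_derivative K (Suc a) c x - K a (Suc c) x) (at x)" for x
  proof -
    let ?D = "\<lambda>f f' g g'. trace (f ** g') + trace (f' ** g) :: complex"
    let ?b' = "\<lambda>k. u x ** C k x + B k x ** v x" and ?d' = "\<lambda>k. v x ** B k x + C k x ** u x"
    let ?C' = "\<lambda>k. (if k = 0 then v x else 0) + v x ** \<beta> k x + \<delta> k x ** v x + C (Suc k) x"
    let ?B' = "\<lambda>k. (if k = 0 then u x else 0) + \<beta> k x ** u x + u x ** \<delta> k x - B (Suc k) x"
    have trd: "((\<lambda>t. trace (f t ** g t)) has_vector_derivative trace (f x ** g') + trace (f' ** g x)) (at x)"
      if "(f has_vector_derivative f') (at x)" "(g has_vector_derivative g') (at x)"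
      for f :: "real \<Rightarrow> complex^'b::finite^'a::finite" and g f' g'
      using bounded_linear.has_vector_derivative[OF bounded_linear_trace mm.has_vector_derivative[OF that]]
      by (simp add: trace_add)
    have trd1: "((\<lambda>t. if b then trace (\<beta> k t) else 0) has_vector_derivative (if b then trace (?b' k) else 0)) (at x)" for b k
      using bounded_linear.has_vector_derivative[OF bounded_linear_trace d(1)] by (cases b) auto
    have "(S1 has_vector_derivative ?D (C a x) (?C' a) (B c x) (?B' c) + ?D (B a x) (?B' a) (C c x) (?C' c)
        - ?D (\<beta> a x) (?b' a) (\<beta> c x) (?b' c) - ?D (\<delta> a x) (?d' a) (\<delta> c x) (?d' c)
        - (if a = 0 then trace (?b' c) else 0) - (if c = 0 then trace (?b' a) else 0)) (at x)"
      unfolding S1_def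
      by (intro has_vector_derivative_add has_vector_derivative_diff trd trd1 d)
    also have "?D (C a x) (?C' a) (B c x) (?B' c) + ?D (B a x) (?B' a) (C c x) (?C' c)
        - ?D (\<beta> a x) (?b' a) (\<beta> c x) (?b' c) - ?D (\<delta> a x) (?d' a) (\<delta> c x) (?d' c)
        - (if a = 0 then trace (?b' c) else 0) - (if c = 0 then trace (?b' a) else 0)
      = K (Suc a) c x - K a (Suc c) x"
    proof -
      have cyc: "trace (f ** g ** h) = trace (g ** h ** f)" for f :: "complex^'b::finite^'a::finite" and g :: "complex^'c::finite^'b" and h
        using trace_mul_sym[of f "g ** h"] by (simp add: matrix_mul_assoc)
      show ?thesis
        by (cases "a = 0"; cases "c = 0")
           (simp_all add: K_def trace_add trace_sub matrix_add_ldistrib mm.add_left mm.diff_left mm.diff_right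
             matrix_mul_assoc cyc[of "v x" "\<beta> _ x" "B _ x"] cyc[of "u x" "\<delta> _ x" "C _ x"]
             cyc[of "u x" "C _ x" "\<beta> _ x"] cyc[of "v x" "B _ x" "\<delta> _ x"]
             trace_mul_sym[of "v x" "B _ x"] trace_mul_sym[of "u x" "C _ x"])
    qed
    finally show ?thesis .
  qed
  have "Dx S1 = (\<lambda>x. K (Suc a) c x - K a (Suc c) x)"
    using dS by (auto simp: fun_eq_iff intro: vector_derivative_at)
  then have "(LINT x|lborel. K (Suc a) c x - K a (Suc c) x) = 0"
    using integral_Dx_schwartz[OF sS] by simp
  moreover have "integrable lborel (K i j)" for i j
    unfolding K_def by (intro schwartz_integrable schwartz_intros s)
  ultimately have "(LINT x|lborel. K (Suc a) c x) = (LINT x|lborel. K a (Suc c) x)"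
    by (simp add: Bochner_Integration.integral_diff)
  then show ?case
    using Suc by (simp add: K_def)
qed

section \<open>Variation of the local functionals\<close>

text \<open>\<open>efam f f'\<close>: the family \<open>f\<close> is polynomial in the parameter with Schwartz coefficients, and
  its linear coefficient is \<open>f'\<close>.\<close>

inductive efam :: "(complex \<Rightarrow> real \<Rightarrow> complex^'b::finite^'a::finite) \<Rightarrow> (real \<Rightarrow> complex^'b^'a) \<Rightarrow> bool" where
  monom: "schwartz c \<Longrightarrow> efam (\<lambda>\<epsilon> x. cscale (\<epsilon> ^ j) (c x)) (\<lambda>x. if j = 1 then c x else 0)"
| add: "efam f f' \<Longrightarrow> efam g g' \<Longrightarrow> efam (\<lambda>\<epsilon> x. f \<epsilon> x + g \<epsilon> x) (\<lambda>x. f' x + g' x)"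

lemma efam_schwartz:
  assumes "efam f f'"
  shows "schwartz (f \<epsilon>)" "schwartz f'"
  using assms by (induction) (auto intro!: schwartz_intros)

lemma efam_const: "schwartz c \<Longrightarrow> efam (\<lambda>\<epsilon>. c) (\<lambda>x. 0)"
  using efam.monom[of c 0] by simp

lemma efam_linear: "schwartz c \<Longrightarrow> efam (\<lambda>\<epsilon> x. cscale \<epsilon> (c x)) c"
  using efam.monom[of c 1] by simp

lemma efam_uminus: "efam f f' \<Longrightarrow> efam (\<lambda>\<epsilon> x. - f \<epsilon> x) (\<lambda>x. - f' x)"
proof (induction rule: efam.induct)
  case (monom c j)
  have "(\<lambda>x. - (if j = 1 then c x else 0)) = (\<lambda>x. if j = 1 then - c x else 0)"
    by auto
  then show ?case
    using efam.monom[OF schwartz_uminus[OF monom], of j] by (simp add: cscale.minus_right)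
next
  case (add f f' g g')
  then show ?case
    using efam.add[OF add.IH] by simp
qed

lemma efam_diff: "efam f f' \<Longrightarrow> efam g g' \<Longrightarrow> efam (\<lambda>\<epsilon> x. f \<epsilon> x - g \<epsilon> x) (\<lambda>x. f' x - g' x)"
  using efam.add[OF _ efam_uminus] by fastforce

lemma efam_sum:
  assumes "finite I" "\<And>i. i \<in> I \<Longrightarrow> efam (f i) (f' i)"
  shows "efam (\<lambda>\<epsilon> x. \<Sum>i\<in>I. f i \<epsilon> x) (\<lambda>x. \<Sum>i\<in>I. f' i x)"
  using assms
proof (induction I)
  case empty
  then show ?case using efam_const[OF schwartz_zero] by simp
next
  case (insert i I)
  then show ?case
    using efam.add[of "f i" "f' i" "\<lambda>\<epsilon> x. \<Sum>i\<in>I. f i \<epsilon> x" "\<lambda>x. \<Sum>i\<in>I. f' i x"] by simp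
qed

lemma efam_mult:
  assumes "efam f f'" "efam g g'"
  shows "efam (\<lambda>\<epsilon> x. f \<epsilon> x ** g \<epsilon> x) (\<lambda>x. f' x ** g 0 x + f 0 x ** g' x)"
  using assms(1)
proof (induction rule: efam.induct)
  case (monom c j)
  note c = monom
  show ?case
    using assms(2)
  proof (induction rule: efam.induct)
    case (monom d i)
    have "efam (\<lambda>\<epsilon> x. cscale (\<epsilon> ^ (j + i)) (c x ** d x)) (\<lambda>x. if j + i = 1 then c x ** d x else 0)"
      by (intro efam.monom schwartz_mult c monom)
    moreover have "(\<lambda>x. if j + i = 1 then c x ** d x else 0) =
        (\<lambda>x. (if j = 1 then c x else 0) ** cscale (0 ^ i) (d x) + cscale (0 ^ j) (c x) ** (if i = 1 then d x else 0))"
      by (auto simp: fun_eq_iff power_0_left cscale.zero_left)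
    ultimately show ?case
      by (simp add: power_add mult.commute)
  next
    case (add g g' h h')
    show ?case
      using efam.add[OF add.IH] by (simp add: matrix_add_ldistrib algebra_simps)
  qed
next
  case (add h h' f f')
  show ?case
    using efam.add[OF add.IH] by (simp add: mm.add_left algebra_simps)
qed

lemma Dx_add_schwartz:
  assumes "schwartz f" "schwartz g"
  shows "Dx (\<lambda>x. f x + g x) = (\<lambda>x. Dx f x + Dx g x)"
  using has_vector_derivative_add[OF schwartz_has_derivative[OF assms(1)] schwartz_has_derivative[OF assms(2)]]
  by (auto simp: fun_eq_iff intro: vector_derivative_at)

lemma efam_Dx: "efam f f' \<Longrightarrow> efam (\<lambda>\<epsilon>. Dx (f \<epsilon>)) (Dx f')"
proof (induction rule: efam.induct)
  case (monom c j)
  have "Dx (\<lambda>x. cscale e (c x)) = (\<lambda>x. cscale e (Dx c x))" for e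
    using bounded_linear.has_vector_derivative[OF cscale.bounded_linear_right schwartz_has_derivative[OF monom]]
    by (auto simp: fun_eq_iff intro: vector_derivative_at)
  moreover have "Dx (\<lambda>x. if j = 1 then c x else 0) = (\<lambda>x. if j = 1 then Dx c x else 0)"
    by (cases "j = 1") auto
  ultimately show ?case
    using efam.monom[OF schwartz_Dx[OF monom], of j] by simp
next
  case (add f f' g g')
  have "Dx (\<lambda>x. f \<epsilon> x + g \<epsilon> x) = (\<lambda>x. Dx (f \<epsilon>) x + Dx (g \<epsilon>) x)" for \<epsilon>
    by (rule Dx_add_schwartz) (use efam_schwartz(1) add in blast)+
  moreover have "Dx (\<lambda>x. f' x + g' x) = (\<lambda>x. Dx f' x + Dx g' x)"
    by (rule Dx_add_schwartz) (use efam_schwartz(2) add in blast)+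
  ultimately show ?case
    using efam.add[OF add.IH] by simp
qed

text \<open>The integral is a polynomial in the parameter whose coefficients are integrals of
  Schwartz functions. Hence no limit has to be interchanged with the integral, and the derivative is
  the complex one that \<open>has_functional_derivative\<close> demands.\<close>

lemma efam_integral:
  assumes "efam f f'"
  shows "((\<lambda>\<epsilon>. LINT x|lborel. trace (f \<epsilon> x)) has_field_derivative (LINT x|lborel. trace (f' x))) (at 0)"
  using assms
proof (induction rule: efam.induct)
  case (monom c j)
  have "((\<lambda>\<epsilon>. \<epsilon> ^ j * (LINT x|lborel. trace (c x))) has_field_derivative
      of_nat j * 0 ^ (j - 1) * (LINT x|lborel. trace (c x))) (at 0)"
    by (auto intro!: derivative_eq_intros)
  moreover have "(LINT x|lborel. trace (if j = 1 then c x else 0)) = of_nat j * 0 ^ (j - 1) * (LINT x|lborel. trace (c x))"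
    by (cases "j = 1") (auto simp: power_0_left trace_def)
  ultimately show ?case
    by simp
next
  case (add f f' g g')
  have "integrable lborel (\<lambda>x. trace (h x))" if "schwartz h" for h :: "real \<Rightarrow> complex^'a^'a"
    by (intro schwartz_integrable schwartz_trace that)
  then show ?case
    using DERIV_add[OF add.IH] efam_schwartz[OF add(1)] efam_schwartz[OF add(2)]
    by (simp add: trace_add)
qed

text \<open>The recursion of \<open>ric\<close> differentiated formally in the direction (h, g);
  \<open>efam_ric\<close> confirms that this is the linear coefficient.\<close>

fun dric :: "('m::finite, 'n::finite) pot \<Rightarrow> ('n, 'm) pot \<Rightarrow> ('m, 'n) pot \<Rightarrow>
    ('n, 'm) pot \<Rightarrow> nat \<Rightarrow> ('n, 'm) pot" where
  "dric u v h g 0 = (\<lambda>x. 0)"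
| "dric u v h g (Suc k) = (\<lambda>x. Dx (dric u v h g k) x - (if k = 0 then g x else 0)
      + (\<Sum>a\<le>k. (dric u v h g a x ** u x + ric u v a x ** h x) ** ric u v (k - a) x
             + ric u v a x ** u x ** dric u v h g (k - a) x))"

declare dric.simps(2) [simp del]

lemma efam_ric:
  assumes "schwartz u" "schwartz v" "schwartz h" "schwartz g"
  shows "efam (\<lambda>\<epsilon>. ric (\<lambda>x. u x + cscale \<epsilon> (h x)) (\<lambda>x. v x + cscale \<epsilon> (g x)) k) (dric u v h g k)"
proof (induction k rule: less_induct)
  case (less k)
  let ?u = "\<lambda>\<epsilon> x. u x + cscale \<epsilon> (h x)" and ?v = "\<lambda>\<epsilon> x. v x + cscale \<epsilon> (g x)"
  have U: "efam ?u h" and V: "efam ?v g"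
    using efam.add[OF efam_const efam_linear] assms by fastforce+
  show ?case
  proof (cases k)
    case 0
    then show ?thesis using efam_const[OF schwartz_zero] by simp
  next
    case (Suc j)
    have D: "efam (\<lambda>\<epsilon>. Dx (ric (?u \<epsilon>) (?v \<epsilon>) j)) (Dx (dric u v h g j))"
      by (rule efam_Dx, rule less) (simp add: Suc)
    have V': "efam (\<lambda>\<epsilon> x. if j = 0 then ?v \<epsilon> x else 0) (\<lambda>x. if j = 0 then g x else 0)"
      using V efam_const[OF schwartz_zero] by (cases "j = 0") auto
    have M: "efam (\<lambda>\<epsilon> x. ric (?u \<epsilon>) (?v \<epsilon>) a x ** ?u \<epsilon> x ** ric (?u \<epsilon>) (?v \<epsilon>) (j - a) x)
        (\<lambda>x. (dric u v h g a x ** u x + ric u v a x ** h x) ** ric u v (j - a) x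
             + ric u v a x ** u x ** dric u v h g (j - a) x)" if "a \<le> j" for a
      using efam_mult[OF efam_mult[OF less U] less, of a "j - a"] that Suc
      by (simp add: cscale.zero_left)
    show ?thesis
      unfolding Suc ric.simps dric.simps
      by (intro efam.add efam_diff D V' efam_sum M) auto
  qed
qed

lemma schwartz_dric:
  assumes "schwartz u" "schwartz v" "schwartz h" "schwartz g"
  shows "schwartz (dric u v h g k)"
  using efam_schwartz(2)[OF efam_ric[OF assms]] .

text \<open>Candidate for the coefficient of \<zeta>^(-k) in ln det a^+: where F is invertible, the
  logarithmic derivative of det F is the trace of u G times the inverse of F.\<close>

definition loc_fun :: "nat \<Rightarrow> ('m::finite, 'n::finite) pot \<Rightarrow> ('n, 'm) pot \<Rightarrow> complex" where
  "loc_fun k u v = (LINT x|lborel. trace (u x ** ric u v k x))"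

lemma dric_has_derivative:
  assumes "schwartz u" "schwartz v" "schwartz h" "schwartz g"
  shows "(dric u v h g k has_vector_derivative
     (cs (g x) + sh (\<lambda>k. dric u v h g k x) - ((\<lambda>k. dric u v h g k x) \<star> cs (u x) \<star> (\<lambda>k. ric u v k x)
       + (\<lambda>k. ric u v k x) \<star> cs (h x) \<star> (\<lambda>k. ric u v k x)
       + (\<lambda>k. ric u v k x) \<star> cs (u x) \<star> (\<lambda>k. dric u v h g k x))) k) (at x)"
proof -
  have "(cs (g x) + sh (\<lambda>k. dric u v h g k x) - ((\<lambda>k. dric u v h g k x) \<star> cs (u x) \<star> (\<lambda>k. ric u v k x)
       + (\<lambda>k. ric u v k x) \<star> cs (h x) \<star> (\<lambda>k. ric u v k x)
       + (\<lambda>k. ric u v k x) \<star> cs (u x) \<star> (\<lambda>k. dric u v h g k x))) k = Dx (dric u v h g k) x"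
    unfolding conv_assoc[symmetric]
    by (simp add: cs_def sh_def dric.simps(2) conv_cs_right conv_def[of "_ \<star> _"] sum.distrib mm.add_left)
  then show ?thesis
    using schwartz_has_derivative[OF schwartz_dric[OF assms]] by metis
qed

text \<open>Adjointness at work: in the derivative of tr (B d), d being the variation of Y, the
  terms with \<zeta> cancel and those with both u and Y cancel by cyclicity of the trace. This
  trades d, which depends on the direction, for C and B, which do not.\<close>

lemma variation_total_derivative:
  fixes u h :: "('m::finite, 'n::finite) pot" and v g :: "('n, 'm) pot"
  assumes S: "schwartz u" "schwartz v" "schwartz h" "schwartz g"
  shows "((\<lambda>x. trace (((\<lambda>k. res u v k x) \<star> (\<lambda>k. dric u v h g k x)) k)) has_vector_derivative
     trace (h x ** ric u v k x + u x ** dric u v h g k x) -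
       (trace (h x ** res_mn u v k x) - trace (res u v k x ** g x))) (at x)"
proof -
  define y where "y k = ric u v k x" for k
  define b where "b k = res u v k x" for k
  define d where "d k = dric u v h g k x" for k
  define b' where "b' = cs (u x) - sh b + b \<star> y \<star> cs (u x) + cs (u x) \<star> y \<star> b"
  define d' where "d' = cs (g x) + sh d - (d \<star> cs (u x) \<star> y + y \<star> cs (h x) \<star> y + y \<star> cs (u x) \<star> d)"
  have eqs: "(\<lambda>k. ric u v k x) = y" "(\<lambda>k. res u v k x) = b" "(\<lambda>k. dric u v h g k x) = d"
    by (simp_all add: fun_eq_iff y_def b_def d_def)
  have 1: "(res u v k has_vector_derivative b' k) (at x)" for k
    using res_has_derivative[OF S(1,2), of k x] unfolding eqs b'_def .
  have 2: "(dric u v h g k has_vector_derivative d' k) (at x)" for k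
    using dric_has_derivative[OF S, of k x] unfolding eqs d'_def .
  have shs: "sh b \<star> d = sh (b \<star> d)" "b \<star> sh d = sh (b \<star> d)"
    by (simp_all add: conv_sh_left conv_sh_right b_def d_def)
  have "b' \<star> d + b \<star> d' = cs (u x) \<star> d + cs (u x) \<star> y \<star> b \<star> d + b \<star> cs (g x) - b \<star> d \<star> cs (u x) \<star> y
      - b \<star> y \<star> cs (h x) \<star> y"
    unfolding b'_def d'_def
    by (simp add: conv_add_left conv_diff_left conv_add_right conv_diff_right conv_assoc shs algebra_simps)
  moreover have "trace ((cs (u x) \<star> y \<star> b \<star> d) k) = trace ((b \<star> d \<star> cs (u x) \<star> y) k)"
    using trace_conv_commute[of "cs (u x) \<star> y" "b \<star> d"] by (simp add: conv_assoc)
  moreover have "trace ((b \<star> y \<star> cs (h x) \<star> y) k) = trace ((cs (h x) \<star> y \<star> b \<star> y) k)"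
    using trace_conv_commute[of "b \<star> y" "cs (h x) \<star> y"] by (simp add: conv_assoc)
  ultimately have "trace ((b' \<star> d + b \<star> d') k) = trace (h x ** ric u v k x + u x ** dric u v h g k x) -
       (trace (h x ** res_mn u v k x) - trace (res u v k x ** g x))"
    by (simp add: trace_add trace_sub conv_cs_left conv_cs_right res_mn_def eqs matrix_add_ldistrib)
       (simp add: y_def b_def d_def)
  then show ?thesis
    using bounded_linear.has_vector_derivative[OF bounded_linear_trace conv_has_derivative[where f = "res u v" and g = "dric u v h g", OF 1 2], of k]
    unfolding eqs by simp
qed

lemma loc_fun_variation:
  fixes u h :: "('m::finite, 'n::finite) pot" and v g :: "('n, 'm) pot"
  assumes S: "schwartz u" "schwartz v" "schwartz h" "schwartz g"
  shows "((\<lambda>\<epsilon>. loc_fun k (\<lambda>x. u x + cscale \<epsilon> (h x)) (\<lambda>x. v x + cscale \<epsilon> (g x))) has_field_derivative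
    (LINT x|lborel. trace (h x ** res_mn u v k x) - trace (res u v k x ** g x))) (at 0)"
proof -
  have U: "efam (\<lambda>\<epsilon> x. u x + cscale \<epsilon> (h x)) h"
    using efam.add[OF efam_const efam_linear] S by fastforce
  let ?t = "\<lambda>x. trace (((\<lambda>k. res u v k x) \<star> (\<lambda>k. dric u v h g k x)) k)"
  let ?p = "\<lambda>x. trace (h x ** ric u v k x + u x ** dric u v h g k x)"
  let ?r = "\<lambda>x. trace (h x ** res_mn u v k x) - trace (res u v k x ** g x)"
  note sch = S schwartz_dric[OF S] schwartz_ric[OF S(1,2)] schwartz_res[OF S(1,2)]
    local_sysD(3)[OF local_sys_res[OF S(1,2)]]
  have sp: "integrable lborel ?p" and sr: "integrable lborel ?r"
    by (intro schwartz_integrable schwartz_intros sch)+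
  have "schwartz ?t"
    by (intro schwartz_trace schwartz_conv sch)
  moreover have "Dx ?t = (\<lambda>x. ?p x - ?r x)"
    using variation_total_derivative[OF S] by (auto simp: fun_eq_iff intro: vector_derivative_at)
  ultimately have "(LINT x|lborel. ?p x - ?r x) = 0"
    using integral_Dx_schwartz[of ?t] by (simp only:)
  then have "(LINT x|lborel. ?p x) = (LINT x|lborel. ?r x)"
    using sp sr by (simp add: Bochner_Integration.integral_diff)
  moreover have "((\<lambda>\<epsilon>. loc_fun k (\<lambda>x. u x + cscale \<epsilon> (h x)) (\<lambda>x. v x + cscale \<epsilon> (g x))) has_field_derivative
      (LINT x|lborel. ?p x)) (at 0)"
    using efam_integral[OF efam_mult[OF U efam_ric[OF S, of k]]]
    unfolding loc_fun_def by (simp add: cscale.zero_left)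
  ultimately show ?thesis
    by simp
qed

section \<open>Parameter integrals\<close>

text \<open>Cauchy's inequality turns the bound W on f into the bound W / r on its derivative in z,
  uniformly near z0. The difference quotients are thereby dominated by W / r, and dominated
  convergence differentiates under the integral.\<close>

lemma holomorphic_on_parameter_integral:
  fixes f :: "complex \<Rightarrow> real \<Rightarrow> complex"
  assumes S: "open S"
    and hol: "\<And>y. (\<lambda>z. f z y) holomorphic_on S"
    and meas: "\<And>z. z \<in> S \<Longrightarrow> f z \<in> borel_measurable borel"
    and bound: "\<And>z y. z \<in> S \<Longrightarrow> norm (f z y) \<le> W y"
    and W: "integrable lborel W"
  shows "(\<lambda>z. LINT y|lborel. f z y) holomorphic_on S"
proof -
  have "(\<lambda>z. LINT y|lborel. f z y) field_differentiable (at z0)" if z0: "z0 \<in> S" for z0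
  proof -
    obtain R where R: "R > 0" "ball z0 R \<subseteq> S"
      using S z0 open_contains_ball by blast
    \<comment> \<open>Closed balls of radius r around points of \<open>ball z0 r\<close> stay within
      2 r < R of z0.\<close>
    define r where "r = R / 3"
    have r: "r > 0" using R by (simp add: r_def)
    have sub: "cball z r \<subseteq> S" if "z \<in> ball z0 r" for z
    proof
      fix w assume "w \<in> cball z r"
      then have "dist z0 w < R"
        using that dist_triangle[of z0 w z] r by (simp add: r_def)
      then show "w \<in> S" using R by auto
    qed
    have W0: "W y \<ge> 0" for y
      using bound[OF z0, of y] norm_ge_zero order_trans by blast
    have deriv_bound: "norm (deriv (\<lambda>z. f z y) z) \<le> W y / r" if z: "z \<in> ball z0 r" for z y
    proof -
      have "norm ((deriv ^^ 1) (\<lambda>z. f z y) z) \<le> fact 1 * W y / r ^ 1"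
      proof (rule Cauchy_inequality)
        show "(\<lambda>z. f z y) holomorphic_on ball z r"
          using hol sub[OF z] ball_subset_cball holomorphic_on_subset by blast
        show "continuous_on (cball z r) (\<lambda>z. f z y)"
          using hol[of y] sub[OF z] holomorphic_on_imp_continuous_on continuous_on_subset by blast
        show "norm (f x y) \<le> W y" if "norm (z - x) = r" for x
          by (rule bound) (use that sub[OF z] in \<open>auto simp: dist_norm\<close>)
      qed fact
      then show ?thesis by simp
    qed
    have sub0: "ball z0 r \<subseteq> S"
      using sub r by (meson centre_in_cball less_imp_le subset_iff)
    have lip: "norm (f z y - f z0 y) \<le> W y / r * norm (z - z0)" if z: "z \<in> ball z0 r" for z y
    proof (rule field_differentiable_bound[where S = "ball z0 r" and f' = "deriv (\<lambda>z. f z y)"])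
      show "((\<lambda>z. f z y) has_field_derivative deriv (\<lambda>z. f z y) w) (at w within ball z0 r)"
        if "w \<in> ball z0 r" for w
        using hol[of y] S sub0 that by (meson has_field_derivative_at_within holomorphic_derivI subset_iff)
    qed (use z r deriv_bound in auto)
    have "((\<lambda>z. ((LINT y|lborel. f z y) - (LINT y|lborel. f z0 y)) / (z - z0)) \<longlongrightarrow>
        (LINT y|lborel. deriv (\<lambda>z. f z y) z0)) (at z0 within ball z0 r)"
      unfolding tendsto_at_iff_sequentially
    proof (intro allI impI)
      fix X assume X: "\<forall>i. X i \<in> ball z0 r - {z0}" and lim: "X \<longlonglongrightarrow> z0"
      have XS: "X i \<in> S" "X i \<noteq> z0" "X i \<in> ball z0 r" for i
        using X sub0 by blast+
      have "((\<lambda>z. (f z y - f z0 y) / (z - z0)) \<longlongrightarrow> deriv (\<lambda>z. f z y) z0) (at z0)" for y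
        using holomorphic_derivI[OF hol[of y] S z0] by (simp add: has_field_derivative_iff)
      then have 1: "(\<lambda>i. (f (X i) y - f z0 y) / (X i - z0)) \<longlonglongrightarrow> deriv (\<lambda>z. f z y) z0" for y
        unfolding tendsto_at_iff_sequentially o_def using XS lim by auto
      have m: "(\<lambda>y. (f (X i) y - f z0 y) / (X i - z0)) \<in> borel_measurable lborel" for i
        using meas[OF XS(1)] meas[OF z0] by simp
      have "(\<lambda>i. LINT y|lborel. (f (X i) y - f z0 y) / (X i - z0)) \<longlonglongrightarrow> (LINT y|lborel. deriv (\<lambda>z. f z y) z0)"
      proof (rule integral_dominated_convergence)
        show "(\<lambda>y. deriv (\<lambda>z. f z y) z0) \<in> borel_measurable lborel"
          by (rule borel_measurable_LIMSEQ_metric[OF m 1])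
        show "integrable lborel (\<lambda>y. W y / r)"
          using W by simp
        show "AE y in lborel. norm ((f (X i) y - f z0 y) / (X i - z0)) \<le> W y / r" for i
          using lip[OF XS(3)[of i]] XS(2)[of i] by (auto simp: norm_divide divide_simps)
      qed (use 1 m in auto)
      moreover have int: "integrable lborel (f z)" if "z \<in> S" for z
        by (rule Bochner_Integration.integrable_bound[OF W])
           (use meas[OF that] bound[OF that] W0 in auto)
      ultimately show "((\<lambda>z. ((LINT y|lborel. f z y) - (LINT y|lborel. f z0 y)) / (z - z0)) \<circ> X) \<longlonglongrightarrow>
          (LINT y|lborel. deriv (\<lambda>z. f z y) z0)"
        using XS(1) z0 by (simp add: o_def Bochner_Integration.integral_diff)
    qed
    then show ?thesis
      unfolding field_differentiable_def has_field_derivative_iff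
      using r by (auto simp: at_within_open[of z0 "ball z0 r"])
  qed
  then show ?thesis
    using field_differentiable_at_within holomorphic_on_def by blast
qed

section \<open>Matrix functions holomorphic in the open upper half-plane and continuous up to the
  real line\<close>

definition hol_uhp :: "(complex \<Rightarrow> complex^'b::finite^'a::finite) \<Rightarrow> bool" where
  "hol_uhp X \<longleftrightarrow> (\<forall>i j. (\<lambda>z. X z $ i $ j) holomorphic_on {z. Im z > 0}) \<and> continuous_on {z. Im z \<ge> 0} X"

lemma bounded_linear_entry: "bounded_linear (\<lambda>A. A $ i $ j)"
  by (rule bounded_linear_compose[OF bounded_linear_vec_nth bounded_linear_vec_nth])

lemma open_uhp: "open {z. Im z > 0}"
  by (rule open_halfspace_Im_gt)

lemma hol_uhp_const: "hol_uhp (\<lambda>z. A)"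
  by (simp add: hol_uhp_def)

lemma hol_uhp_mult_left:
  assumes "hol_uhp X"
  shows "hol_uhp (\<lambda>z. A ** X z)"
  using assms unfolding hol_uhp_def
  by (auto simp: matrix_matrix_mult_def intro!: holomorphic_intros mm.continuous_on continuous_intros)

lemma hol_uhp_cscale:
  assumes "hol_uhp X" "c holomorphic_on UNIV"
  shows "hol_uhp (\<lambda>z. cscale (c z) (X z))"
  using assms unfolding hol_uhp_def
  by (auto intro!: holomorphic_intros cscale.continuous_on
      intro: holomorphic_on_subset holomorphic_on_imp_continuous_on)

lemma hol_uhp_add:
  assumes "hol_uhp X" "hol_uhp Y"
  shows "hol_uhp (\<lambda>z. X z + Y z)"
  using assms unfolding hol_uhp_def by (auto intro!: holomorphic_intros continuous_intros)

lemma hol_uhp_integral: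
  fixes f :: "complex \<Rightarrow> real \<Rightarrow> complex^'b::finite^'a::finite"
  assumes hol: "\<And>y. hol_uhp (\<lambda>z. f z y)"
    and meas: "\<And>z. Im z \<ge> 0 \<Longrightarrow> f z \<in> borel_measurable borel"
    and bound: "\<And>z y. Im z \<ge> 0 \<Longrightarrow> norm (f z y) \<le> W y"
    and W: "integrable lborel W"
  shows "hol_uhp (\<lambda>z. LINT y|lborel. f z y)"
  unfolding hol_uhp_def
proof (intro conjI allI)
  have int: "integrable lborel (f z)" if "Im z \<ge> 0" for z
    by (rule Bochner_Integration.integrable_bound[OF W])
       (use meas[OF that] bound[OF that] in \<open>auto intro!: AE_I2 order_trans[OF _ abs_ge_self]\<close>)
  show "continuous_on {z. Im z \<ge> 0} (\<lambda>z. LINT y|lborel. f z y)"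
  proof (rule continuous_on_sequentiallyI)
    fix X :: "nat \<Rightarrow> complex" and z
    assume X: "\<forall>n. X n \<in> {z. Im z \<ge> 0}" and z: "z \<in> {z. Im z \<ge> 0}" and lim: "X \<longlonglongrightarrow> z"
    show "(\<lambda>n. LINT y|lborel. f (X n) y) \<longlonglongrightarrow> (LINT y|lborel. f z y)"
    proof (rule integral_dominated_convergence[OF _ _ W])
      show "AE y in lborel. (\<lambda>n. f (X n) y) \<longlonglongrightarrow> f z y"
        using hol X z lim unfolding hol_uhp_def continuous_on_sequentially o_def by blast
    qed (use meas X z bound in auto)
  qed
  fix i j
  have "(\<lambda>z. LINT y|lborel. f z y $ i $ j) holomorphic_on {z. Im z > 0}"
  proof (rule holomorphic_on_parameter_integral[OF open_uhp _ _ _ W])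
    show "(\<lambda>z. f z y $ i $ j) holomorphic_on {z. Im z > 0}" for y
      using hol by (simp add: hol_uhp_def)
    show "(\<lambda>y. f z y $ i $ j) \<in> borel_measurable borel" if "z \<in> {z. Im z > 0}" for z
      by (rule measurable_compose[OF meas]) (use that in \<open>auto intro!: borel_measurable_continuous_onI continuous_intros\<close>)
    show "norm (f z y $ i $ j) \<le> W y" if "z \<in> {z. Im z > 0}" for z y
      by (rule order_trans[OF order_trans[OF Finite_Cartesian_Product.norm_nth_le Finite_Cartesian_Product.norm_nth_le] bound])
         (use that in simp)
  qed
  moreover have "(LINT y|lborel. f z y $ i $ j) = (LINT y|lborel. f z y) $ i $ j" if "Im z > 0" for z
    using integral_bounded_linear[OF bounded_linear_entry int] that by simp
  ultimately show "(\<lambda>z. (LINT y|lborel. f z y) $ i $ j) holomorphic_on {z. Im z > 0}"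
    by (auto intro: holomorphic_transform)
qed

lemma hol_uhp_suminf:
  fixes X :: "nat \<Rightarrow> complex \<Rightarrow> complex^'b::finite^'a::finite"
  assumes hol: "\<And>k. hol_uhp (X k)"
    and bound: "\<And>k z. Im z \<ge> 0 \<Longrightarrow> norm (X k z) \<le> C k"
    and C: "summable C"
  shows "hol_uhp (\<lambda>z. \<Sum>k. X k z)"
  unfolding hol_uhp_def
proof (intro conjI allI)
  have ul: "uniform_limit {z. Im z \<ge> 0} (\<lambda>n z. \<Sum>i<n. X i z) (\<lambda>z. \<Sum>k. X k z) sequentially"
    by (rule Weierstrass_m_test[OF _ C]) (use bound in auto)
  show "continuous_on {z. Im z \<ge> 0} (\<lambda>z. \<Sum>k. X k z)"
    by (rule uniform_limit_theorem[OF always_eventually ul])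
       (use hol in \<open>auto simp: hol_uhp_def intro!: continuous_on_sum\<close>)
  fix i j
  show "(\<lambda>z. (\<Sum>k. X k z) $ i $ j) holomorphic_on {z. Im z > 0}"
  proof (rule holomorphic_uniform_sequence[OF open_uhp])
    show "(\<lambda>z. (\<Sum>i<n. X i z) $ i $ j) holomorphic_on {z. Im z > 0}" for n
      using hol by (auto simp: hol_uhp_def intro!: holomorphic_intros)
    fix z :: complex assume z: "z \<in> {z. Im z > 0}"
    obtain d where d: "d > 0" "cball z d \<subseteq> {z. Im z > 0}"
      using open_uhp z open_contains_cball by blast
    have uld: "uniform_limit (cball z d) (\<lambda>n z. \<Sum>i<n. X i z) (\<lambda>z. \<Sum>k. X k z) sequentially"
      by (rule uniform_limit_on_subset[OF ul]) (use d in \<open>auto simp: subset_iff less_imp_le\<close>)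
    have "uniform_limit (cball z d) (\<lambda>n z. (\<Sum>i<n. X i z) $ i $ j) (\<lambda>z. (\<Sum>k. X k z) $ i $ j) sequentially"
      by (rule bounded_linear.uniform_limit[OF bounded_linear_entry uld])
    then show "\<exists>d>0. cball z d \<subseteq> {z. Im z > 0} \<and>
        uniform_limit (cball z d) (\<lambda>n z. (\<Sum>i<n. X i z) $ i $ j) (\<lambda>z. (\<Sum>k. X k z) $ i $ j) sequentially"
      using d by blast
  qed
qed


section \<open>Integrals over half-lines\<close>

text \<open>Cutting at x - 1 reduces the claim to the fundamental theorem on the compact interval
  from x - 1 to x + 1.\<close>

lemma set_integral_atMost_has_derivative:
  fixes h :: "real \<Rightarrow> 'a::euclidean_space"
  assumes cont: "continuous_on UNIV h" and int: "\<And>x. set_integrable lborel {..x} h"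
  shows "((\<lambda>x. LINT y:{..x}|lborel. h y) has_vector_derivative h x) (at x)"
proof -
  have split: "(LINT y:{..t}|lborel. h y) = (LINT y:{..x - 1}|lborel. h y) + integral {x - 1..t} h"
    if "t > x - 1" for t
  proof -
    have i2: "set_integrable lborel {x - 1<..t} h"
      by (rule set_integrable_subset[OF int[of t]]) auto
    have i3: "set_integrable lborel {x - 1..t} h"
      by (rule set_integrable_subset[OF int[of t]]) auto
    have "{..t} = {..x - 1} \<union> {x - 1<..t}"
      using that by auto
    then have "(LINT y:{..t}|lborel. h y) = (LINT y:{..x - 1}|lborel. h y) + (LINT y:{x - 1<..t}|lborel. h y)"
      using set_integral_Un[OF _ int[of "x - 1"] i2] by (simp add: disjoint_iff)
    moreover have "(LINT y:{x - 1<..t}|lborel. h y) = integral {x - 1<..t} h"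
      by (rule set_borel_integral_eq_integral(2)[OF i2])
    moreover have "integral {x - 1<..t} h = integral {x - 1..t} h"
      by (rule integral_subset_negligible) (auto intro: negligible_subset[of "{x - 1}"])
    ultimately show ?thesis by simp
  qed
  have "((\<lambda>t. integral {x - 1..t} h) has_vector_derivative h x) (at x within {x - 1..x + 1})"
    by (rule integral_has_vector_derivative[OF continuous_on_subset[OF cont]]) auto
  then have "((\<lambda>t. integral {x - 1..t} h) has_vector_derivative h x) (at x)"
    by (simp add: at_within_Icc_at)
  then have "((\<lambda>t. (LINT y:{..x - 1}|lborel. h y) + integral {x - 1..t} h) has_vector_derivative h x) (at x)"
    by (auto intro!: derivative_eq_intros)
  then show ?thesis
  proof (rule has_vector_derivative_transform_within_open[where S = "{x - 1<..}"])
  qed (use split in auto)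
qed


section \<open>The Volterra operator\<close>

lemma norm_cscale [simp]: "norm (cscale c A) = norm c * norm A"
proof -
  have "norm (cscale c A) = L2_set (\<lambda>i. norm c * L2_set (\<lambda>j. norm (A $ i $ j)) UNIV) UNIV"
    by (simp add: norm_vec_def norm_mult L2_set_right_distrib)
  also have "\<dots> = norm c * norm A"
    by (simp add: norm_vec_def L2_set_right_distrib)
  finally show ?thesis .
qed

text \<open>A weight in the style of Bielecki: its derivative is 2 K / (1 + x^2) times itself, so
  integrating K / (1 + y^2) against it up to x gives at most half of it back
  (\<open>integral_weight\<close>). Each Volterra step thus gains a factor 1/2, however large the
  potential is.\<close>

definition wexp :: "real \<Rightarrow> real \<Rightarrow> real" where
  "wexp K x = exp (2 * K * (arctan x + pi / 2))"

abbreviation vwt :: "real \<Rightarrow> real \<Rightarrow> real" where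
  "vwt K y \<equiv> K * wt y * wexp K y"

lemma wexp_pos: "wexp K x > 0"
  by (simp add: wexp_def)

lemma wexp_ge_1: "K \<ge> 0 \<Longrightarrow> wexp K x \<ge> 1"
  using arctan_lbound[of x] by (simp add: wexp_def)

lemma wexp_le: "K \<ge> 0 \<Longrightarrow> wexp K x \<le> exp (2 * K * pi)"
  using arctan_ubound[of x] by (auto simp: wexp_def intro!: mult_left_mono)

lemma wexp_has_derivative:
  "(wexp K has_real_derivative 2 * (vwt K x)) (at x)"
proof -
  have "((\<lambda>x. 2 * K * (arctan x + pi / 2)) has_real_derivative 2 * K * wt x) (at x)"
    by (auto intro!: derivative_eq_intros)
  from DERIV_fun_exp[OF this] show ?thesis
    by (simp add: wexp_def[abs_def] mult_ac)
qed

lemma continuous_on_wexp [continuous_intros]: "continuous_on A (wexp K)"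
  using wexp_has_derivative by (meson DERIV_isCont continuous_at_imp_continuous_on)

lemma wexp_at_bot: "(wexp K \<longlongrightarrow> 1) at_bot"
proof -
  have "((\<lambda>x. exp (2 * K * (arctan x + pi / 2))) \<longlongrightarrow> exp (2 * K * (- (pi / 2) + pi / 2))) at_bot"
    by (intro tendsto_intros tendsto_arctan_at_bot)
  then show ?thesis by (simp add: wexp_def[abs_def])
qed

lemma one_plus_square_pos: "1 + x\<^sup>2 > (0::real)"
  by (simp add: add_pos_nonneg)

lemma continuous_on_inverse_1_plus_square [continuous_intros]: "continuous_on A (\<lambda>x::real. wt x)"
  using one_plus_square_pos by (intro continuous_intros) (metis less_irrefl)

lemma integrable_weight:
  assumes "K \<ge> 0"
  shows "integrable lborel (\<lambda>y. vwt K y)"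
proof (rule integrable_decay)
  show "norm (vwt K x) \<le> (K * exp (2 * K * pi)) * wt x" for x
    using mult_left_mono[OF wexp_le[OF assms], of "K * wt x" x] assms wexp_pos[of K x]
      one_plus_square_pos[of x]
    by (simp add: abs_mult mult.commute mult.left_commute)
qed (intro borel_measurable_continuous_onI continuous_intros)

lemma integral_weight:
  assumes "K \<ge> 0"
  shows "(LINT y:{..x}|lborel. vwt K y) = (wexp K x - 1) / 2"
proof -
  let ?h = "\<lambda>y. vwt K y"
  have cont: "continuous_on UNIV ?h"
    by (intro continuous_intros)
  have "(LBINT y=-\<infinity>..ereal x. ?h y) = wexp K x / 2 - 1 / 2"
  proof (rule interval_integral_FTC_integrable[where F = "\<lambda>x. wexp K x / 2"])
    show "((\<lambda>x. wexp K x / 2) has_vector_derivative ?h y) (at y)" for y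
      using DERIV_cdivide[OF wexp_has_derivative[of K y], of 2]
      by (simp add: has_real_derivative_iff_has_vector_derivative)
    show "isCont ?h y" for y
      using cont continuous_on_eq_continuous_at[of UNIV ?h] by blast
    show "set_integrable lborel (einterval (- \<infinity>) (ereal x)) ?h"
      unfolding set_integrable_def by (intro integrable_mult_indicator integrable_weight assms) auto
    have "isCont (wexp K) x"
      using continuous_on_wexp[of UNIV K] by (simp add: continuous_on_eq_continuous_at)
    then have "(wexp K \<longlongrightarrow> wexp K x) (at_left x)"
      by (simp add: isCont_def filterlim_at_split)
    then show "(((\<lambda>x. wexp K x / 2) \<circ> real_of_ereal) \<longlongrightarrow> wexp K x / 2) (at_left (ereal x))"
      by (simp add: ereal_tendsto_simps tendsto_intros)
    show "(((\<lambda>x. wexp K x / 2) \<circ> real_of_ereal) \<longlongrightarrow> 1 / 2) (at_right (- \<infinity>))"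
      using wexp_at_bot[of K] by (simp add: ereal_tendsto_simps tendsto_intros)
  qed simp
  also have "(LBINT y=-\<infinity>..ereal x. ?h y) = (LINT y:{..<x}|lborel. ?h y)"
    by (simp add: interval_lebesgue_integral_def)
  also have "\<dots> = (LINT y:{..x}|lborel. ?h y)"
    unfolding set_lebesgue_integral_def
  proof (rule integral_cong_AE)
    show "AE y in lborel. indicator {..<x} y *\<^sub>R ?h y = indicator {..x} y *\<^sub>R ?h y"
      using AE_lborel_singleton[of x] by eventually_elim (auto split: split_indicator)
  qed (use integrable_weight[OF assms] in \<open>auto dest: borel_measurable_integrable\<close>)
  finally show ?thesis by (simp add: diff_divide_distrib)
qed

lemma norm_half_line_integral:
  fixes h :: "real \<Rightarrow> 'a::euclidean_space"
  assumes K: "K \<ge> 0" and h: "integrable lborel h" "\<And>y. norm (h y) \<le> c * vwt K y" "\<And>y. y > x \<Longrightarrow> h y = 0"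
  shows "norm (LINT y|lborel. h y) \<le> c * ((wexp K x - 1) / 2)"
proof -
  have "norm (LINT y|lborel. h y) \<le> (LINT y|lborel. c * (indicator {..x} y *\<^sub>R vwt K y))"
  proof (rule Bochner_Integration.integral_norm_bound_integral[OF h(1)])
    show "integrable lborel (\<lambda>y. c * (indicator {..x} y *\<^sub>R vwt K y))"
      by (intro integrable_mult_right integrable_mult_indicator integrable_weight[OF K]) auto
    show "norm (h y) \<le> c * (indicator {..x} y *\<^sub>R vwt K y)" for y
      using h(2,3)[of y] by (cases "y \<le> x") auto
  qed
  also have "\<dots> = c * ((wexp K x - 1) / 2)"
    using integral_weight[OF K, of x] by (simp add: set_lebesgue_integral_def)
  finally show ?thesis .
qed

text \<open>Variation of constants: a solution of X' = \<zeta> X + p f that vanishes at -infinity.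
  For Re \<zeta> \<le> 0 the exponential has modulus at most 1 on y \<le> x.\<close>

definition vint :: "complex \<Rightarrow> (real \<Rightarrow> complex^'b::finite^'a::finite) \<Rightarrow> (real \<Rightarrow> complex^'c::finite^'b) \<Rightarrow> real \<Rightarrow> complex^'c^'a" where
  "vint \<zeta> p f x = (LINT y:{..x}|lborel. cscale (exp (\<zeta> * of_real (x - y))) (p y ** f y))"

context
  fixes p :: "real \<Rightarrow> complex^'b::finite^'a::finite" and f :: "real \<Rightarrow> complex^'c::finite^'b"
    and \<zeta> :: complex and K c :: real
  assumes p: "continuous_on UNIV p" and f: "continuous_on UNIV f" and \<zeta>: "Re \<zeta> \<le> 0"
    and K: "K \<ge> 0"
    and bound: "\<And>y. norm (p y ** f y) \<le> c * (vwt K y)"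
begin

lemma vint_integrand_bound:
  "norm (indicator {..x} y *\<^sub>R cscale (exp (\<zeta> * of_real (x - y))) (p y ** f y)) \<le>
     c * (vwt K y)"
proof (cases "y \<le> x")
  case True
  have "Re \<zeta> * (x - y) \<le> 0"
    using \<zeta> True by (simp add: mult_nonpos_nonneg)
  then have "norm (cscale (exp (\<zeta> * of_real (x - y))) (p y ** f y)) \<le> norm (p y ** f y)"
    by (simp add: norm_exp_eq_Re mult_left_le_one_le)
  then show ?thesis using True bound[of y] by simp
next
  case False
  then show ?thesis using order_trans[OF norm_ge_zero bound[of y]] by simp
qed

lemma vint_measurable:
  "(\<lambda>y. indicator {..x} y *\<^sub>R cscale (exp (\<zeta> * of_real (x - y))) (p y ** f y)) \<in> borel_measurable borel"
  by (intro borel_measurable_scaleR borel_measurable_indicator borel_measurable_continuous_onI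
      cscale.continuous_on mm.continuous_on p f continuous_intros) auto

lemma vint_integrable:
  "integrable lborel (\<lambda>y. indicator {..x} y *\<^sub>R cscale (exp (\<zeta> * of_real (x - y))) (p y ** f y))"
proof (rule Bochner_Integration.integrable_bound)
  show "integrable lborel (\<lambda>y. c * (vwt K y))"
    using integrable_weight[OF K] by simp
  show "AE y in lborel. norm (indicator {..x} y *\<^sub>R cscale (exp (\<zeta> * of_real (x - y))) (p y ** f y)) \<le>
      norm (c * (vwt K y))"
    unfolding real_norm_def by (intro AE_I2 order_trans[OF vint_integrand_bound abs_ge_self])
qed (use vint_measurable in simp)

lemma norm_vint: "norm (vint \<zeta> p f x) \<le> c * ((wexp K x - 1) / 2)"
  unfolding vint_def set_lebesgue_integral_def
  by (rule norm_half_line_integral[OF K vint_integrable vint_integrand_bound]) auto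

lemma vint_has_derivative:
  "(vint \<zeta> p f has_vector_derivative cscale \<zeta> (vint \<zeta> p f x) + p x ** f x) (at x)"
proof -
  let ?h = "\<lambda>y. cscale (exp (- \<zeta> * of_real y)) (p y ** f y)"
  have exp_split: "exp (\<zeta> * of_real (x - y)) = exp (\<zeta> * of_real x) * exp (- \<zeta> * of_real y)" for x y
    by (simp add: exp_add[symmetric] algebra_simps)
  have *: "indicator {..x} y *\<^sub>R ?h y = cscale (exp (- \<zeta> * of_real x))
      (indicator {..x} y *\<^sub>R cscale (exp (\<zeta> * of_real (x - y))) (p y ** f y))" for x y
    unfolding exp_split by (cases "y \<le> x") (auto simp: exp_minus mult.assoc[symmetric] cscale.zero_right)
  have int: "set_integrable lborel {..x} ?h" for x
    unfolding set_integrable_def *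
    by (rule integrable_bounded_linear[OF cscale.bounded_linear_right vint_integrable])
  \<comment> \<open>With exp (\<zeta> x) pulled out, x occurs in the remaining integral only as the
    upper limit.\<close>
  have eq: "vint \<zeta> p f = (\<lambda>x. cscale (exp (\<zeta> * of_real x)) (LINT y:{..x}|lborel. ?h y))"
  proof
    fix x
    have "cscale (exp (\<zeta> * of_real x)) (LINT y:{..x}|lborel. ?h y) =
        (LINT y|lborel. cscale (exp (\<zeta> * of_real x)) (indicator {..x} y *\<^sub>R ?h y))"
      unfolding set_lebesgue_integral_def
      by (rule integral_bounded_linear[OF cscale.bounded_linear_right int[unfolded set_integrable_def], symmetric])
    also have "\<dots> = vint \<zeta> p f x"
      unfolding vint_def set_lebesgue_integral_def exp_split
      by (intro Bochner_Integration.integral_cong) (auto simp: indicator_def cscale.zero_right)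
    finally show "vint \<zeta> p f x = cscale (exp (\<zeta> * of_real x)) (LINT y:{..x}|lborel. ?h y)" by simp
  qed
  have dexp: "((\<lambda>x. exp (\<zeta> * of_real x)) has_vector_derivative \<zeta> * exp (\<zeta> * of_real x)) (at x)"
    by (rule has_vector_derivative_real_field) (auto intro!: derivative_eq_intros)
  have dint: "((\<lambda>x. LINT y:{..x}|lborel. ?h y) has_vector_derivative ?h x) (at x)"
    by (rule set_integral_atMost_has_derivative[OF _ int])
       (intro cscale.continuous_on mm.continuous_on p f continuous_intros)
  show ?thesis
    using cscale.has_vector_derivative[OF dexp dint]
    unfolding eq by (simp add: exp_minus add.commute)
qed

lemma vint_at_bot: "(vint \<zeta> p f \<longlongrightarrow> 0) at_bot"
proof (rule Lim_null_comparison)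
  show "\<forall>\<^sub>F x in at_bot. norm (vint \<zeta> p f x) \<le> c * ((wexp K x - 1) / 2)"
    using norm_vint by simp
  have "((\<lambda>x. c * ((wexp K x - 1) / 2)) \<longlongrightarrow> c * ((1 - 1) / 2)) at_bot"
    by (intro tendsto_intros wexp_at_bot) auto
  then show "((\<lambda>x. c * ((wexp K x - 1) / 2)) \<longlongrightarrow> 0) at_bot" by simp
qed

end

section \<open>The Neumann series\<close>

lemma hol_uhp_vint:
  fixes f :: "complex \<Rightarrow> real \<Rightarrow> complex^'c::finite^'b::finite"
  assumes p: "continuous_on UNIV p" and f: "\<And>z. Im z \<ge> 0 \<Longrightarrow> continuous_on UNIV (f z)"
    and \<zeta>: "\<And>z. Im z \<ge> 0 \<Longrightarrow> Re (\<zeta> z) \<le> 0" "\<zeta> holomorphic_on UNIV" and K: "K \<ge> 0"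
    and bound: "\<And>z y. Im z \<ge> 0 \<Longrightarrow> norm (p y ** f z y) \<le> c * (vwt K y)"
    and hol: "\<And>y. hol_uhp (\<lambda>z. f z y)"
  shows "hol_uhp (\<lambda>z. vint (\<zeta> z) p (f z) x)"
  unfolding vint_def set_lebesgue_integral_def
proof (rule hol_uhp_integral)
  show "hol_uhp (\<lambda>z. indicat_real {..x} y *\<^sub>R cscale (exp (\<zeta> z * complex_of_real (x - y))) (p y ** f z y))" for y
  proof (cases "y \<le> x")
    case True
    then show ?thesis
      by (auto intro!: hol_uhp_cscale hol_uhp_mult_left hol \<zeta>(2) holomorphic_intros simp del: of_real_diff)
  qed (simp add: hol_uhp_const)
  show "(\<lambda>y. indicat_real {..x} y *\<^sub>R cscale (exp (\<zeta> z * complex_of_real (x - y))) (p y ** f z y)) \<in> borel_measurable borel"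
    if "Im z \<ge> 0" for z
    by (rule vint_measurable[OF p f[OF that] \<zeta>(1)[OF that] K bound[OF that]])
  show "norm (indicat_real {..x} y *\<^sub>R cscale (exp (\<zeta> z * complex_of_real (x - y))) (p y ** f z y))
      \<le> c * (vwt K y)" if "Im z \<ge> 0" for z y
    by (rule vint_integrand_bound[OF p f[OF that] \<zeta>(1)[OF that] K bound[OF that]])
  show "integrable lborel (\<lambda>y. c * (vwt K y))"
    using integrable_weight[OF K] by simp
qed

lemma vint_sums:
  fixes f :: "nat \<Rightarrow> real \<Rightarrow> complex^'c::finite^'b::finite"
  assumes p: "continuous_on UNIV p" and f: "\<And>k. continuous_on UNIV (f k)"
    and \<zeta>: "Re \<zeta> \<le> 0" and K: "K \<ge> 0" and c: "summable c"
    and bound: "\<And>k y. norm (p y ** f k y) \<le> c k * (vwt K y)"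
    and summ: "\<And>y. summable (\<lambda>k. f k y)"
  shows "(\<Sum>k. vint \<zeta> p (f k) x) = vint \<zeta> p (\<lambda>y. \<Sum>k. f k y) x"
proof -
  let ?h = "\<lambda>k y. indicat_real {..x} y *\<^sub>R cscale (exp (\<zeta> * complex_of_real (x - y))) (p y ** f k y)"
  let ?w = "\<lambda>y. vwt K y"
  note b = vint_integrand_bound[OF p f \<zeta> K bound] and i = vint_integrable[OF p f \<zeta> K bound]
  have s: "summable (\<lambda>k. norm (?h k y))" for y
    by (rule summable_comparison_test'[OF summable_mult2[OF c, of "?w y"], of 0]) (use b[of x y] in auto)
  have "(LINT y|lborel. (\<Sum>k. ?h k y)) = (\<Sum>k. LINT y|lborel. ?h k y)"
  proof (rule integral_suminf)
    show "AE y in lborel. summable (\<lambda>k. norm (?h k y))"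
      using s by simp
    show "summable (\<lambda>k. LINT y|lborel. norm (?h k y))"
    proof (rule summable_comparison_test'[OF summable_mult2[OF c, of "LINT y|lborel. ?w y"], of 0])
      fix k :: nat
      have "(LINT y|lborel. norm (?h k y)) \<le> (LINT y|lborel. c k * ?w y)"
        using integrable_weight[OF K] by (intro integral_mono integrable_norm i b) auto
      then show "norm (LINT y|lborel. norm (?h k y)) \<le> c k * (LINT y|lborel. ?w y)"
        by simp
    qed
  qed (rule i)
  moreover have "(\<Sum>k. ?h k y) = indicat_real {..x} y *\<^sub>R cscale (exp (\<zeta> * complex_of_real (x - y))) (p y ** (\<Sum>k. f k y))" for y
  proof -
    have bl: "bounded_linear (\<lambda>A. indicat_real {..x} y *\<^sub>R cscale (exp (\<zeta> * complex_of_real (x - y))) (p y ** A))"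
      by (intro bounded_linear_compose[OF bounded_linear_scaleR_right] bounded_linear_compose[OF cscale.bounded_linear_right]
          mm.bounded_linear_right)
    show ?thesis
      using bounded_linear.suminf[OF bl summ] by simp
  qed
  ultimately show ?thesis
    by (simp add: vint_def set_lebesgue_integral_def)
qed

text \<open>Terms of the Neumann series for the coupled equations F = 1 + (integral of u G) and G =
  (integral of v F with kernel exp (2 i z (x - y))), both integrals starting at -infinity.
  \<open>neumG\<close> is the inner integral.\<close>

fun neumF :: "('m::finite, 'n::finite) pot \<Rightarrow> ('n, 'm) pot \<Rightarrow> nat \<Rightarrow> complex \<Rightarrow> real \<Rightarrow> complex^'n^'n" where
  "neumF u v 0 z = (\<lambda>x. mat 1)"
| "neumF u v (Suc k) z = vint 0 u (vint (2 * \<i> * z) v (neumF u v k z))"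

definition neumG :: "('m::finite, 'n::finite) pot \<Rightarrow> ('n, 'm) pot \<Rightarrow> nat \<Rightarrow> complex \<Rightarrow> ('n, 'm) pot" where
  "neumG u v k z = vint (2 * \<i> * z) v (neumF u v k z)"

definition jostF :: "('m::finite, 'n::finite) pot \<Rightarrow> ('n, 'm) pot \<Rightarrow> complex \<Rightarrow> real \<Rightarrow> complex^'n^'n" where
  "jostF u v z x = (\<Sum>k. neumF u v k z x)"

definition jostG :: "('m::finite, 'n::finite) pot \<Rightarrow> ('n, 'm) pot \<Rightarrow> complex \<Rightarrow> ('n, 'm) pot" where
  "jostG u v z x = (\<Sum>k. neumG u v k z x)"

text \<open>The integral equation for F read at x = +infinity. In this form holomorphy in z follows
  from \<open>hol_uhp_integral\<close>; \<open>jostF_at_top\<close> shows that it is the limit of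
  F.\<close>

definition jostA :: "('m::finite, 'n::finite) pot \<Rightarrow> ('n, 'm) pot \<Rightarrow> complex \<Rightarrow> complex^'n^'n" where
  "jostA u v z = mat 1 + (LINT y|lborel. u y ** jostG u v z y)"

text \<open>One step for F applies the Volterra operator twice, each time with gain 1/2, hence the
  ratio 1/4; \<open>c0\<close> will be the norm of the initial term \<open>mat 1\<close>.\<close>

definition neumC :: "real \<Rightarrow> nat \<Rightarrow> real" where
  "neumC c0 k = c0 * (1 / 4) ^ k"

definition neumB :: "real \<Rightarrow> real \<Rightarrow> real" where
  "neumB c0 K = (\<Sum>k. neumC c0 k) * exp (2 * K * pi)"

context
  fixes u :: "('m::finite, 'n::finite) pot" and v :: "('n, 'm) pot" and K c0 :: real
  assumes u: "continuous_on UNIV u" and v: "continuous_on UNIV v" and K: "K \<ge> 0"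
    and uK: "\<And>y (X :: complex^'n^'m). norm (u y ** X) \<le> K * wt y * norm X"
    and vK: "\<And>y (X :: complex^'n^'n). norm (v y ** X) \<le> K * wt y * norm X"
    and c0: "c0 = norm (mat 1 :: complex^'n^'n)"
begin

lemma weighted:
  assumes "norm (P ** X) \<le> K * wt y * norm X" "norm X \<le> c * wexp K y"
  shows "norm (P ** X) \<le> c * (vwt K y)"
proof -
  have "K * wt y * norm X \<le> K * wt y * (c * wexp K y)"
    using assms(2) K one_plus_square_pos[of y] by (intro mult_left_mono) auto
  then show ?thesis
    using assms(1) by (simp add: mult_ac)
qed

lemma Re_phase: "Im z \<ge> 0 \<Longrightarrow> Re (2 * \<i> * z) \<le> 0"
  by simp

text \<open>Continuity and the weighted bound go through one induction, since the estimate of the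
  next integral presupposes both for the current term.\<close>

lemma neum_props:
  assumes z: "Im z \<ge> 0"
  shows "continuous_on UNIV (neumF u v k z) \<and> (\<forall>x. norm (neumF u v k z x) \<le> neumC c0 k * wexp K x) \<and>
    continuous_on UNIV (neumG u v k z) \<and> (\<forall>x. norm (neumG u v k z x) \<le> neumC c0 k / 2 * wexp K x)"
proof -
  have C0: "neumC c0 k \<ge> 0" for k by (simp add: neumC_def c0)
  have half: "norm X \<le> c / 2 * wexp K x" if "norm X \<le> c * ((wexp K x - 1) / 2)" "c \<ge> 0" for X :: "complex^'c::finite^'b::finite" and c x
    using that by (simp add: field_simps)
  have G: "continuous_on UNIV (neumG u v k z) \<and> (\<forall>x. norm (neumG u v k z x) \<le> neumC c0 k / 2 * wexp K x)"
    if F: "continuous_on UNIV (neumF u v k z)" "\<forall>x. norm (neumF u v k z x) \<le> neumC c0 k * wexp K x" for k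
  proof -
    have b: "norm (v y ** neumF u v k z y) \<le> neumC c0 k * (vwt K y)" for y
      by (rule weighted[OF vK]) (use F in auto)
    note a = v F(1) Re_phase[OF z] K b
    show ?thesis
      unfolding neumG_def
      using vint_has_derivative[OF a] half[OF norm_vint[OF a] C0]
      by (meson continuous_at_imp_continuous_on has_vector_derivative_continuous)
  qed
  have F: "continuous_on UNIV (neumF u v k z) \<and> (\<forall>x. norm (neumF u v k z x) \<le> neumC c0 k * wexp K x)" for k
  proof (induction k)
    case 0
    have "norm (mat 1 :: complex^'n^'n) * 1 \<le> norm (mat 1 :: complex^'n^'n) * wexp K x" for x
      by (intro mult_left_mono wexp_ge_1 K) auto
    then show ?case by (auto simp: neumC_def c0)
  next
    case (Suc k)
    note g = G[OF conjunct1[OF Suc] conjunct2[OF Suc]]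
    have b: "norm (u y ** neumG u v k z y) \<le> neumC c0 k / 2 * (vwt K y)" for y
      by (rule weighted[OF uK]) (use g in auto)
    have "Re 0 \<le> 0" by simp
    note a = u conjunct1[OF g] this K b
    have C2: "neumC c0 k / 2 \<ge> 0" "neumC c0 (Suc k) = neumC c0 k / 2 / 2" using C0 by (simp_all add: neumC_def)
    have eq: "neumF u v (Suc k) z = vint 0 u (neumG u v k z)"
      by (simp add: neumG_def)
    show ?case
      unfolding eq C2(2)
      using vint_has_derivative[OF a] half[OF norm_vint[OF a] C2(1)]
      by (meson continuous_at_imp_continuous_on has_vector_derivative_continuous)
  qed
  show ?thesis
    using F G by blast
qed

lemma neumG_bound: "Im z \<ge> 0 \<Longrightarrow> norm (neumG u v k z x) \<le> neumC c0 k * wexp K x"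
proof -
  assume z: "Im z \<ge> 0"
  have "neumC c0 k / 2 * wexp K x \<le> neumC c0 k * wexp K x"
    using wexp_pos[of K x] by (simp add: neumC_def c0)
  then show ?thesis
    using neum_props[OF z, of k] order_trans by blast
qed

lemma hol_uhp_neum: "hol_uhp (\<lambda>z. neumF u v k z x) \<and> hol_uhp (\<lambda>z. neumG u v k z x)"
proof -
  have G: "hol_uhp (\<lambda>z. neumG u v k z x)" if F: "\<And>x. hol_uhp (\<lambda>z. neumF u v k z x)" for k x
    unfolding neumG_def
  proof (rule hol_uhp_vint[OF v _ Re_phase _ K _ F])
    show "norm (v y ** neumF u v k z y) \<le> neumC c0 k * (vwt K y)" if "Im z \<ge> 0" for z y
      by (rule weighted[OF vK]) (use neum_props[OF that] in auto)
  qed (use neum_props in \<open>auto intro!: holomorphic_intros\<close>)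
  have F: "hol_uhp (\<lambda>z. neumF u v k z x)" for x
  proof (induction k arbitrary: x)
    case 0
    then show ?case by (simp add: hol_uhp_const)
  next
    case (Suc k)
    have eq: "neumF u v (Suc k) z = vint 0 u (neumG u v k z)" for z
      by (simp add: neumG_def)
    show ?case
      unfolding eq
    proof (rule hol_uhp_vint[OF u _ _ _ K _ G[OF Suc]])
      show "norm (u y ** neumG u v k z y) \<le> neumC c0 k * (vwt K y)" if "Im z \<ge> 0" for z y
        by (rule weighted[OF uK]) (rule neumG_bound[OF that])
    qed (use neum_props in \<open>auto intro!: holomorphic_intros\<close>)
  qed
  then show ?thesis using G by blast
qed

lemma summable_neumC: "summable (neumC c0)"
  unfolding neumC_def[abs_def] by (intro summable_mult summable_geometric) simp

lemma neum_uniform: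
  assumes z: "Im z \<ge> 0"
  shows "norm (neumF u v k z x) \<le> neumC c0 k * exp (2 * K * pi)"
    and "norm (neumG u v k z x) \<le> neumC c0 k * exp (2 * K * pi)"
proof -
  have "neumC c0 k * wexp K x \<le> neumC c0 k * exp (2 * K * pi)"
    by (intro mult_left_mono wexp_le K) (simp add: neumC_def c0)
  then show "norm (neumF u v k z x) \<le> neumC c0 k * exp (2 * K * pi)"
    "norm (neumG u v k z x) \<le> neumC c0 k * exp (2 * K * pi)"
    using neum_props[OF z, of k] neumG_bound[OF z, of k x] order_trans by blast+
qed

lemma summable_neum:
  assumes z: "Im z \<ge> 0"
  shows "summable (\<lambda>k. neumF u v k z x)" "summable (\<lambda>k. neumG u v k z x)"
  by (rule summable_comparison_test'[OF summable_mult2[OF summable_neumC, of "exp (2 * K * pi)"], of 0];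
      use neum_uniform[OF z] in auto)+

lemma jost_bound:
  assumes z: "Im z \<ge> 0"
  shows "norm (jostF u v z x) \<le> neumB c0 K" "norm (jostG u v z x) \<le> neumB c0 K"
proof -
  have *: "norm (\<Sum>k. f k) \<le> neumB c0 K" if "\<And>k. norm (f k) \<le> neumC c0 k * exp (2 * K * pi)" for f :: "nat \<Rightarrow> complex^'c::finite^'b::finite"
  proof -
    have s: "summable (\<lambda>k. norm (f k))"
      by (rule summable_comparison_test'[OF summable_mult2[OF summable_neumC, of "exp (2 * K * pi)"], of 0]) (use that in auto)
    have "norm (\<Sum>k. f k) \<le> (\<Sum>k. norm (f k))" by (rule summable_norm[OF s])
    also have "\<dots> \<le> (\<Sum>k. neumC c0 k * exp (2 * K * pi))"
      by (rule suminf_le[OF that s summable_mult2[OF summable_neumC]])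
    also have "\<dots> = neumB c0 K"
      unfolding neumB_def by (rule suminf_mult2[OF summable_neumC, symmetric])
    finally show ?thesis .
  qed
  show "norm (jostF u v z x) \<le> neumB c0 K" "norm (jostG u v z x) \<le> neumB c0 K"
    unfolding jostF_def jostG_def by (rule *, rule neum_uniform[OF z])+
qed

lemma continuous_jost:
  assumes z: "Im z \<ge> 0"
  shows "continuous_on UNIV (jostF u v z)" "continuous_on UNIV (jostG u v z)"
proof -
  have *: "continuous_on UNIV (\<lambda>x. \<Sum>k. f k x)"
    if "\<And>k. continuous_on UNIV (f k)" "\<And>k x. norm (f k x) \<le> neumC c0 k * exp (2 * K * pi)"
    for f :: "nat \<Rightarrow> real \<Rightarrow> complex^'c::finite^'b::finite"
  proof (rule uniform_limit_theorem[OF always_eventually])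
    show "uniform_limit UNIV (\<lambda>n x. \<Sum>i<n. f i x) (\<lambda>x. \<Sum>k. f k x) sequentially"
      by (rule Weierstrass_m_test[OF that(2) summable_mult2[OF summable_neumC]])
  qed (use that in \<open>auto intro!: continuous_on_sum\<close>)
  show "continuous_on UNIV (jostF u v z)" "continuous_on UNIV (jostG u v z)"
    unfolding jostF_def[abs_def] jostG_def[abs_def]
    by (rule *; use neum_uniform[OF z] neum_props[OF z] in blast)+
qed

lemma hol_uhp_jostG: "hol_uhp (\<lambda>z. jostG u v z x)"
  unfolding jostG_def
  by (rule hol_uhp_suminf[OF _ neum_uniform(2) summable_mult2[OF summable_neumC]]) (use hol_uhp_neum in auto)

lemma jostG_eq:
  assumes z: "Im z \<ge> 0"
  shows "jostG u v z x = vint (2 * \<i> * z) v (jostF u v z) x"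
  unfolding jostG_def neumG_def jostF_def[abs_def]
proof (rule vint_sums[OF v _ Re_phase[OF z] K summable_neumC])
  show "norm (v y ** neumF u v k z y) \<le> neumC c0 k * (vwt K y)" for k y
    by (rule weighted[OF vK]) (use neum_props[OF z] in auto)
qed (use neum_props[OF z] summable_neum[OF z] in auto)

lemma jostF_eq:
  assumes z: "Im z \<ge> 0"
  shows "jostF u v z x = mat 1 + vint 0 u (jostG u v z) x"
proof -
  have "(\<Sum>k. vint 0 u (neumG u v k z) x) = vint 0 u (\<lambda>y. \<Sum>k. neumG u v k z y) x"
  proof (rule vint_sums[OF u _ _ K summable_neumC])
    show "norm (u y ** neumG u v k z y) \<le> neumC c0 k * (vwt K y)" for k y
      by (rule weighted[OF uK]) (rule neumG_bound[OF z])
  qed (use neum_props[OF z] summable_neum[OF z] in auto)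
  moreover have "jostF u v z x = mat 1 + (\<Sum>k. vint 0 u (neumG u v k z) x)"
    unfolding jostF_def using suminf_split_head[OF summable_neum(1)[OF z, of x]]
    by (simp add: neumG_def)
  ultimately show ?thesis
    by (simp add: jostG_def[abs_def])
qed

lemma jost_weighted:
  assumes z: "Im z \<ge> 0"
  shows "norm (v y ** jostF u v z y) \<le> neumB c0 K * (vwt K y)"
    and "norm (u y ** jostG u v z y) \<le> neumB c0 K * (vwt K y)"
proof -
  have "neumB c0 K * 1 \<le> neumB c0 K * wexp K y"
    using order_trans[OF norm_ge_zero jost_bound(1)[OF z]] by (intro mult_left_mono wexp_ge_1 K)
  then have "norm (jostF u v z y) \<le> neumB c0 K * wexp K y" "norm (jostG u v z y) \<le> neumB c0 K * wexp K y"
    using jost_bound[OF z, of y] by linarith+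
  then show "norm (v y ** jostF u v z y) \<le> neumB c0 K * (vwt K y)"
    "norm (u y ** jostG u v z y) \<le> neumB c0 K * (vwt K y)"
    by (auto intro!: weighted uK vK)
qed

lemma jost_ode:
  assumes z: "Im z \<ge> 0"
  shows "(jostF u v z has_vector_derivative u x ** jostG u v z x) (at x)"
    and "(jostG u v z has_vector_derivative cscale (2 * \<i> * z) (jostG u v z x) + v x ** jostF u v z x) (at x)"
    and "(jostF u v z \<longlongrightarrow> mat 1) at_bot" "(jostG u v z \<longlongrightarrow> 0) at_bot"
proof -
  have r0: "Re 0 \<le> 0" by simp
  note a = v continuous_jost(1)[OF z] Re_phase[OF z] K jost_weighted(1)[OF z]
  note b = u continuous_jost(2)[OF z] r0 K jost_weighted(2)[OF z]
  have eqG: "jostG u v z = vint (2 * \<i> * z) v (jostF u v z)"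
    and eqF: "jostF u v z = (\<lambda>x. mat 1 + vint 0 u (jostG u v z) x)"
    using jostG_eq[OF z] jostF_eq[OF z] by auto
  show "(jostG u v z has_vector_derivative cscale (2 * \<i> * z) (jostG u v z x) + v x ** jostF u v z x) (at x)"
    using vint_has_derivative[OF a, of x] unfolding eqG[symmetric] .
  show "(jostG u v z \<longlongrightarrow> 0) at_bot"
    using vint_at_bot[OF a] unfolding eqG[symmetric] .
  show "(jostF u v z has_vector_derivative u x ** jostG u v z x) (at x)"
    using has_vector_derivative_add[OF has_vector_derivative_const[of "mat 1"] vint_has_derivative[OF b, of x]]
    unfolding eqF[symmetric] by (simp add: cscale.zero_left)
  show "(jostF u v z \<longlongrightarrow> mat 1) at_bot"
    using tendsto_add[OF tendsto_const vint_at_bot[OF b], of "mat 1"] unfolding eqF[symmetric] by simp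
qed

lemma jostF_at_top:
  assumes z: "Im z \<ge> 0"
  shows "(jostF u v z \<longlongrightarrow> jostA u v z) at_top"
proof -
  have r0: "Re 0 \<le> 0" by simp
  note b = u continuous_jost(2)[OF z] r0 K jost_weighted(2)[OF z]
  let ?W = "\<lambda>y. neumB c0 K * (vwt K y)"
  have "((\<lambda>x. LINT y|lborel. indicat_real {..x} y *\<^sub>R cscale (exp (0 * complex_of_real (x - y))) (u y ** jostG u v z y))
      \<longlongrightarrow> (LINT y|lborel. u y ** jostG u v z y)) at_top"
  proof (rule integral_dominated_convergence_at_top)
    show "integrable lborel ?W"
      using integrable_weight[OF K] by simp
    show "AE y in lborel. ((\<lambda>x. indicat_real {..x} y *\<^sub>R cscale (exp (0 * complex_of_real (x - y))) (u y ** jostG u v z y))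
        \<longlongrightarrow> u y ** jostG u v z y) at_top"
    proof (rule AE_I2, rule tendsto_eventually)
      fix y :: real
      show "\<forall>\<^sub>F x in at_top. indicat_real {..x} y *\<^sub>R cscale (exp (0 * complex_of_real (x - y))) (u y ** jostG u v z y)
          = u y ** jostG u v z y"
        using eventually_ge_at_top[of y] by eventually_elim simp
    qed
    show "\<forall>\<^sub>F x in at_top. AE y in lborel. norm (indicat_real {..x} y *\<^sub>R cscale (exp (0 * complex_of_real (x - y))) (u y ** jostG u v z y)) \<le> ?W y"
      by (intro always_eventually allI AE_I2 vint_integrand_bound[OF b])
    show "(\<lambda>y. u y ** jostG u v z y) \<in> borel_measurable lborel"
      using mm.continuous_on[OF u continuous_jost(2)[OF z]] by (simp add: borel_measurable_continuous_onI)
    show "(\<lambda>y. indicat_real {..x} y *\<^sub>R cscale (exp (0 * complex_of_real (x - y))) (u y ** jostG u v z y)) \<in> borel_measurable lborel" for x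
      using vint_measurable[OF b, of x] by simp
  qed
  then have "((\<lambda>x. mat 1 + vint 0 u (jostG u v z) x) \<longlongrightarrow> jostA u v z) at_top"
    unfolding jostA_def vint_def set_lebesgue_integral_def by (intro tendsto_intros)
  moreover have "jostF u v z = (\<lambda>x. mat 1 + vint 0 u (jostG u v z) x)"
    using jostF_eq[OF z] by auto
  ultimately show ?thesis
    by metis
qed

lemma hol_uhp_jostA: "hol_uhp (jostA u v)"
proof -
  have "hol_uhp (\<lambda>z. LINT y|lborel. u y ** jostG u v z y)"
  proof (rule hol_uhp_integral[OF hol_uhp_mult_left[OF hol_uhp_jostG] _ jost_weighted(2)])
    show "integrable lborel (\<lambda>y. neumB c0 K * (vwt K y))"
      using integrable_weight[OF K] by simp
    show "(\<lambda>y. u y ** jostG u v z y) \<in> borel_measurable borel" if "Im z \<ge> 0" for z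
      by (intro borel_measurable_continuous_onI mm.continuous_on u continuous_jost(2)[OF that])
  qed
  then show ?thesis
    unfolding jostA_def[abs_def] by (intro hol_uhp_add hol_uhp_const)
qed

end

text \<open>Phrased for the product with an arbitrary X, so that the constant of the bilinear matrix
  product is absorbed into K once and for all.\<close>

lemma mult_decay:
  assumes "schwartz (p :: real \<Rightarrow> complex^'b::finite^'a::finite)"
  shows "\<exists>K>0. \<forall>y (X :: complex^'c::finite^'b). norm (p y ** X) \<le> K * wt y * norm X"
proof -
  obtain c where c: "c > 0" "\<And>x. norm (p x) \<le> c * wt x"
    using schwartz_decay[OF assms] by blast
  obtain B where B: "B > 0" "\<And>A (X :: complex^'c^'b). norm ((A :: complex^'b^'a) ** X) \<le> norm A * norm X * B"
    using mm.pos_bounded by blast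
  have "norm (p y ** X) \<le> (c * B) * wt y * norm X" for y and X :: "complex^'c^'b"
  proof -
    have "norm (p y ** X) \<le> norm (p y) * norm X * B" by (rule B)
    also have "\<dots> \<le> (c * wt y) * norm X * B"
      using c B by (intro mult_right_mono) auto
    finally show ?thesis by (simp add: mult_ac)
  qed
  then show ?thesis using c B by (intro exI[of _ "c * B"]) auto
qed

text \<open>One constant K is chosen for both potentials, and the facts about the Neumann series are
  collected for Schwartz potentials; the later sections use the series only through this
  list.\<close>

lemma jost_system:
  fixes u :: "('m::finite, 'n::finite) pot" and v :: "('n, 'm) pot"
  assumes "schwartz u" "schwartz v"
  shows "\<And>z x. Im z \<ge> 0 \<Longrightarrow> (jostF u v z has_vector_derivative u x ** jostG u v z x) (at x)"
    and "\<And>z x. Im z \<ge> 0 \<Longrightarrow>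
      (jostG u v z has_vector_derivative cscale (2 * \<i> * z) (jostG u v z x) + v x ** jostF u v z x) (at x)"
    and "\<And>z. Im z \<ge> 0 \<Longrightarrow> (jostF u v z \<longlongrightarrow> mat 1) at_bot"
    and "\<And>z. Im z \<ge> 0 \<Longrightarrow> (jostG u v z \<longlongrightarrow> 0) at_bot"
    and "\<And>z. Im z \<ge> 0 \<Longrightarrow> (jostF u v z \<longlongrightarrow> jostA u v z) at_top"
    and "hol_uhp (jostA u v)"
    and "\<exists>B. \<forall>z x. Im z \<ge> 0 \<longrightarrow> norm (jostF u v z x) \<le> B \<and> norm (jostG u v z x) \<le> B"
proof -
  obtain K1 where K1: "K1 > 0" "\<And>y (X :: complex^'n^'m). norm (u y ** X) \<le> K1 * wt y * norm X"
    using mult_decay[OF assms(1)] by blast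
  obtain K2 where K2: "K2 > 0" "\<And>y (X :: complex^'n^'n). norm (v y ** X) \<le> K2 * wt y * norm X"
    using mult_decay[OF assms(2)] by blast
  define K where "K = K1 + K2"
  have K: "K \<ge> 0" using K1 K2 by (simp add: K_def)
  have mono: "k * wt y * N \<le> K * wt y * N" if "k \<le> K" "N \<ge> 0" for k N y
    using that one_plus_square_pos[of y] by (intro mult_right_mono) auto
  have uK: "norm (u y ** X) \<le> K * wt y * norm X" for y and X :: "complex^'n^'m"
    using order_trans[OF K1(2) mono] K2(1) by (simp add: K_def)
  have vK: "norm (v y ** X) \<le> K * wt y * norm X" for y and X :: "complex^'n^'n"
    using order_trans[OF K2(2) mono] K1(1) by (simp add: K_def)
  note a = schwartz_continuous[OF assms(1)] schwartz_continuous[OF assms(2)] K uK vK refl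
  show "\<And>z x. Im z \<ge> 0 \<Longrightarrow> (jostF u v z has_vector_derivative u x ** jostG u v z x) (at x)"
    "\<And>z x. Im z \<ge> 0 \<Longrightarrow>
      (jostG u v z has_vector_derivative cscale (2 * \<i> * z) (jostG u v z x) + v x ** jostF u v z x) (at x)"
    "\<And>z. Im z \<ge> 0 \<Longrightarrow> (jostF u v z \<longlongrightarrow> mat 1) at_bot"
    "\<And>z. Im z \<ge> 0 \<Longrightarrow> (jostG u v z \<longlongrightarrow> 0) at_bot"
    "\<And>z. Im z \<ge> 0 \<Longrightarrow> (jostF u v z \<longlongrightarrow> jostA u v z) at_top"
    "hol_uhp (jostA u v)"
    by (rule jost_ode[OF a] jostF_at_top[OF a] hol_uhp_jostA[OF a]; assumption)+
  show "\<exists>B. \<forall>z x. Im z \<ge> 0 \<longrightarrow> norm (jostF u v z x) \<le> B \<and> norm (jostG u v z x) \<le> B"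
    using jost_bound[OF a] by blast
qed

section \<open>Derivatives of determinants\<close>

definition replace_row :: "'n \<Rightarrow> 'a^'n \<Rightarrow> 'a^'n^'n \<Rightarrow> 'a^'n^'n::finite" where
  "replace_row i r A = (\<chi> k. if k = i then r else A $ k)"

lemma det_replace_row:
  fixes A :: "'a::comm_ring_1^'n^'n::finite"
  shows "det (replace_row i r A) =
    (\<Sum>p | p permutes (UNIV :: 'n set). of_int (sign p) * (r $ p i * (\<Prod>j\<in>UNIV - {i}. A $ j $ p j)))"
  unfolding det_def
proof (rule sum.cong[OF refl])
  fix p :: "'n \<Rightarrow> 'n"
  have "(\<Prod>j\<in>UNIV. replace_row i r A $ j $ p j) = replace_row i r A $ i $ p i * (\<Prod>j\<in>UNIV - {i}. replace_row i r A $ j $ p j)"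
    by (subst prod.remove[of UNIV i]) auto
  also have "\<dots> = r $ p i * (\<Prod>j\<in>UNIV - {i}. A $ j $ p j)"
    by (simp add: replace_row_def)
  finally show "of_int (sign p) * (\<Prod>j\<in>UNIV. replace_row i r A $ j $ p j) =
      of_int (sign p) * (r $ p i * (\<Prod>j\<in>UNIV - {i}. A $ j $ p j))" by simp
qed

lemma det_has_vector_derivative:
  fixes F :: "real \<Rightarrow> complex^'n^'n::finite"
  assumes "(F has_vector_derivative F') (at x)"
  shows "((\<lambda>x. det (F x)) has_vector_derivative (\<Sum>i\<in>UNIV. det (replace_row i (F' $ i) (F x)))) (at x)"
proof -
  have e: "((\<lambda>x. F x $ i $ j) has_derivative (\<lambda>h. h *\<^sub>R F' $ i $ j)) (at x)" for i j
    using bounded_linear.has_vector_derivative[OF bounded_linear_entry assms, of i j]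
    by (simp add: has_vector_derivative_def)
  have "((\<lambda>x. det (F x)) has_derivative (\<lambda>h. \<Sum>p | p permutes UNIV. of_int (sign p) *
      (\<Sum>i\<in>UNIV. h *\<^sub>R F' $ i $ p i * (\<Prod>j\<in>UNIV - {i}. F x $ j $ p j)))) (at x)"
    unfolding det_def by (intro has_derivative_sum has_derivative_mult_right has_derivative_prod e)
  moreover have "(\<Sum>p | p permutes UNIV. of_int (sign p) *
      (\<Sum>i\<in>UNIV. h *\<^sub>R F' $ i $ p i * (\<Prod>j\<in>UNIV - {i}. F x $ j $ p j))) =
      h *\<^sub>R (\<Sum>i\<in>UNIV. det (replace_row i (F' $ i) (F x)))" for h
    unfolding det_replace_row
    by (subst sum.swap) (simp add: sum_distrib_left scaleR_sum_right)
  ultimately show ?thesis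
    by (simp add: has_vector_derivative_def)
qed

lemma det_replace_row_add:
  "det (replace_row i (a + b) A) = det (replace_row i a A) + det (replace_row i b (A :: 'a::comm_ring_1^'n^'n::finite))"
  using det_row_add[of i "\<lambda>_. a" "\<lambda>_. b" "\<lambda>k. A $ k"] by (simp add: replace_row_def)

text \<open>Row i of M A is a combination of the rows of A, and every row other than the i-th
  produces two equal rows. This covers singular A, and it extracts the main term tr M det F of the
  derivative of det F.\<close>

lemma sum_det_replace_row_mult:
  fixes A M :: "complex^'n^'n::finite"
  shows "(\<Sum>i\<in>UNIV. det (replace_row i ((M ** A) $ i) A)) = trace M * det A"
proof -
  have "det (replace_row i ((M ** A) $ i) A) = M $ i $ i * det A" for i
  proof -
    have r: "(M ** A) $ i = (\<Sum>j\<in>UNIV. M $ i $ j *s A $ j)"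
      by (simp add: vec_eq_iff matrix_matrix_mult_def)
    have "det (replace_row i ((M ** A) $ i) A) = (\<Sum>j\<in>UNIV. det (replace_row i (M $ i $ j *s A $ j) A))"
      unfolding r replace_row_def
      by (rule det_linear_row_sum[of UNIV i "\<lambda>_ j. M $ i $ j *s A $ j" "\<lambda>k. A $ k", OF finite])
    also have "\<dots> = (\<Sum>j\<in>UNIV. M $ i $ j * det (replace_row i (A $ j) A))"
      using det_row_mul[of i _ "\<lambda>_. A $ _" "\<lambda>k. A $ k"] by (simp add: replace_row_def)
    also have "\<dots> = (\<Sum>j\<in>UNIV. if j = i then M $ i $ i * det A else 0)"
    proof (rule sum.cong[OF refl])
      fix j
      have "replace_row i (A $ i) A = A"
        by (auto simp: replace_row_def vec_eq_iff)
      moreover have "det (replace_row i (A $ j) A) = 0" if "j \<noteq> i"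
        by (rule det_identical_rows[OF that]) (use that in \<open>simp add: row_def replace_row_def vec_eq_iff\<close>)
      ultimately show "M $ i $ j * det (replace_row i (A $ j) A) = (if j = i then M $ i $ i * det A else 0)"
        by auto
    qed
    finally show ?thesis by simp
  qed
  then show ?thesis
    by (simp add: trace_def sum_distrib_right)
qed

text \<open>The Leibniz expansion has n! terms, each with n - 1 entries of A and one entry of
  r.\<close>

lemma norm_det_replace_row:
  fixes A :: "complex^'n^'n::finite"
  assumes "norm A \<le> B"
  shows "norm (det (replace_row i r A)) \<le> fact CARD('n) * B ^ (CARD('n) - 1) * norm r"
proof -
  have B: "B \<ge> 0" using assms norm_ge_zero order_trans by blast
  have entry: "norm (A $ j $ k) \<le> B" for j k
    using order_trans[OF order_trans[OF Finite_Cartesian_Product.norm_nth_le Finite_Cartesian_Product.norm_nth_le] assms] .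
  have "norm (det (replace_row i r A)) \<le> (\<Sum>p | p permutes (UNIV :: 'n set). norm r * B ^ (CARD('n) - 1))"
    unfolding det_replace_row
  proof (rule order_trans[OF norm_sum sum_mono])
    fix p :: "'n \<Rightarrow> 'n"
    have "norm (r $ p i * (\<Prod>j\<in>UNIV - {i}. A $ j $ p j)) \<le> norm r * (\<Prod>j\<in>UNIV - {i}. B)"
      unfolding norm_mult prod_norm[symmetric]
      by (intro mult_mono prod_mono Finite_Cartesian_Product.norm_nth_le) (auto intro!: entry prod_nonneg)
    moreover have "norm (of_int (sign p) :: complex) = 1"
      by (cases p rule: sign_cases) auto
    ultimately show "norm (of_int (sign p) * (r $ p i * (\<Prod>j\<in>UNIV - {i}. A $ j $ p j))) \<le> norm r * B ^ (CARD('n) - 1)"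
      by (simp add: norm_mult card_Diff_singleton)
  qed
  also have "\<dots> = fact CARD('n) * B ^ (CARD('n) - 1) * norm r"
    by (simp add: card_permutations[OF refl finite])
  finally show ?thesis .
qed


lemma tendsto_det:
  fixes F :: "'b \<Rightarrow> complex^'n^'n::finite"
  assumes "(F \<longlongrightarrow> A) net"
  shows "((\<lambda>x. det (F x)) \<longlongrightarrow> det A) net"
  unfolding det_def by (intro tendsto_intros assms)


section \<open>Asymptotics of the transmission coefficient\<close>

text \<open>Comparison with c arctan, whose total increase over the line is c \<pi>; then the left
  end point tends to -infinity.\<close>

lemma decay_estimate:
  fixes f :: "real \<Rightarrow> 'a::real_normed_vector"
  assumes d: "\<And>t. (f has_vector_derivative f' t) (at t)"
    and b: "\<And>t. t < x \<Longrightarrow> norm (f' t) \<le> c * wt t"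
    and lim: "(f \<longlongrightarrow> L) at_bot" and c: "c \<ge> 0"
  shows "norm (f x - L) \<le> c * pi"
proof -
  have "norm (f x - f y) \<le> c * pi" if "y < x" for y
  proof -
    have "norm (f x - f y) \<le> c * arctan x - c * arctan y"
    proof (rule differentiable_bound_general[OF that])
      show "continuous_on {y..x} f"
        using d by (meson continuous_at_imp_continuous_on has_vector_derivative_continuous)
      show "((\<lambda>x. c * arctan x) has_vector_derivative c * wt t) (at t)" for t
        unfolding has_real_derivative_iff_has_vector_derivative[symmetric]
        by (auto intro!: derivative_eq_intros)
    qed (use d b in \<open>auto intro!: continuous_intros\<close>)
    also have "\<dots> = c * (arctan x - arctan y)" by (simp add: algebra_simps)
    also have "\<dots> \<le> c * pi"
      using arctan_bounded[of x] arctan_bounded[of y] c by (intro mult_left_mono) auto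
    finally show ?thesis .
  qed
  then have "\<forall>\<^sub>F y in at_bot. norm (f x - f y) \<le> c * pi"
    using eventually_at_bot_dense by blast
  then show ?thesis
    by (rule tendsto_upperbound[OF tendsto_norm[OF tendsto_diff[OF tendsto_const lim]]]) simp
qed

text \<open>For \<open>Re \<zeta> \<le> 0\<close> the homogeneous part of the equation decays to the right.\<close>

lemma damped_decay_estimate:
  fixes E :: "real \<Rightarrow> complex^'b::finite^'a::finite"
  assumes d: "\<And>x. (E has_vector_derivative cscale \<zeta> (E x) + h x) (at x)"
    and b: "\<And>x. norm (h x) \<le> c * wt x"
    and lim: "(E \<longlongrightarrow> 0) at_bot" and \<zeta>: "Re \<zeta> \<le> 0" and c: "c \<ge> 0"
  shows "norm (E x) \<le> c * pi"
proof -
  \<comment> \<open>Integrating factor: its modulus is at most 1 for t \<le> x, and at t = x it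
    leaves \<open>E x\<close> unchanged.\<close>
  let ?f = "\<lambda>t. cscale (exp (\<zeta> * of_real (x - t))) (E t)"
  have dexp: "((\<lambda>t. exp (\<zeta> * of_real (x - t))) has_vector_derivative - \<zeta> * exp (\<zeta> * of_real (x - t))) (at t)" for t
  proof -
    have "((\<lambda>w. exp (\<zeta> * (of_real x - w))) has_field_derivative - \<zeta> * exp (\<zeta> * (of_real x - of_real t))) (at (of_real t))"
      by (auto intro!: derivative_eq_intros)
    from has_vector_derivative_real_field[OF this] show ?thesis by simp
  qed
  have df: "(?f has_vector_derivative cscale (exp (\<zeta> * of_real (x - t))) (h t)) (at t)" for t
    using cscale.has_vector_derivative[OF dexp d, of t]
    by (simp add: cscale.add_right cscale.minus_left mult.commute)
  have e1: "norm (cscale (exp (\<zeta> * of_real (x - t))) A) \<le> norm A" if "t \<le> x" for t and A :: "complex^'b^'a"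
    unfolding norm_cscale using \<zeta> that
    by (intro mult_left_le_one_le) (simp_all add: norm_exp_eq_Re mult_nonpos_nonneg)
  have "norm (?f x - 0) \<le> c * pi"
  proof (rule decay_estimate[OF df _ _ c])
    show "norm (cscale (exp (\<zeta> * of_real (x - t))) (h t)) \<le> c * wt t" if "t < x" for t
      using e1[of t "h t"] b[of t] that by linarith
    show "(?f \<longlongrightarrow> 0) at_bot"
    proof (rule Lim_null_comparison)
      show "\<forall>\<^sub>F t in at_bot. norm (?f t) \<le> norm (E t)"
        using eventually_le_at_bot[of x] by eventually_elim (rule e1)
      show "((\<lambda>t. norm (E t)) \<longlongrightarrow> 0) at_bot"
        using lim by (rule tendsto_norm_zero)
    qed
  qed
  then show ?thesis by simp
qed

section \<open>Truncations of the Riccati series and their residuals\<close>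

definition ric_sum :: "nat \<Rightarrow> complex \<Rightarrow> ('m::finite, 'n::finite) pot \<Rightarrow> ('n, 'm) pot \<Rightarrow> ('n, 'm) pot" where
  "ric_sum N t u v x = (\<Sum>k\<le>N. cscale (t ^ k) (ric u v k x))"

abbreviation ric_rem :: "nat \<Rightarrow> complex \<Rightarrow> ('m::finite, 'n::finite) pot \<Rightarrow> ('n, 'm) pot \<Rightarrow> ('n, 'm) pot" where
  "ric_rem N t u v x \<equiv> - cscale (t ^ N) (Dx (ric u v N) x)
      - (\<Sum>(a, b)\<in>{(a, b). a \<le> N \<and> b \<le> N \<and> N \<le> a + b}. cscale (t ^ (a + b)) (ric u v a x ** u x ** ric u v b x))"

text \<open>With t = 1/\<zeta> the recursion cancels all orders below N: the pairs with a + b < N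
  are those that occur in it. What survives is the derivative of the last coefficient and the pairs
  with a + b \<ge> N.\<close>

lemma ric_sum_residual:
  fixes u :: "('m::finite, 'n::finite) pot" and v :: "('n, 'm) pot"
  assumes "t \<noteq> 0" "N \<ge> 1"
  shows "v x + cscale (inverse t) (ric_sum N t u v x) - (\<Sum>k\<le>N. cscale (t ^ k) (Dx (ric u v k) x))
      - ric_sum N t u v x ** u x ** ric_sum N t u v x
    = ric_rem N t u v x"
proof -
  let ?r = "\<lambda>k. ric u v k x" and ?d = "\<lambda>k. Dx (ric u v k) x"
  let ?g = "\<lambda>a b. cscale (t ^ (a + b)) (?r a ** u x ** ?r b)"
  obtain M where M: "N = Suc M" using assms(2) by (cases N) auto
  have "cscale (inverse t) (ric_sum N t u v x) = (\<Sum>k\<le>N. cscale (inverse t * t ^ k) (?r k))"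
    by (simp add: ric_sum_def cscale.sum_right)
  also have "\<dots> = (\<Sum>k\<le>M. cscale (t ^ k) (?r (Suc k)))"
    unfolding M sum.atMost_Suc_shift
  proof -
    have *: "inverse t * t ^ Suc k = t ^ k" for k
      using assms(1) by simp
    then show "cscale (inverse t * t ^ 0) (?r 0) + (\<Sum>i\<le>M. cscale (inverse t * t ^ Suc i) (?r (Suc i))) =
        (\<Sum>k\<le>M. cscale (t ^ k) (?r (Suc k)))"
      unfolding * by (simp add: cscale.zero_right)
  qed
  also have "\<dots> = (\<Sum>k\<le>M. cscale (t ^ k) (?d k)) - (\<Sum>k\<le>M. if k = 0 then v x else 0) + (\<Sum>k\<le>M. \<Sum>a\<le>k. ?g a (k - a))"
    unfolding sum_subtractf[symmetric] sum.distrib[symmetric]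
    by (intro sum.cong refl)
       (auto simp: ric.simps(2) cscale.add_right cscale.diff_right cscale.sum_right cscale.zero_right intro!: sum.cong)
  also have "(\<Sum>k\<le>M. \<Sum>a\<le>k. ?g a (k - a)) = (\<Sum>(a, b)\<in>{(a, b). a + b < N}. ?g a b)"
    using sum.triangle_reindex[of ?g N] by (simp add: M lessThan_Suc_atMost)
  finally have 1: "cscale (inverse t) (ric_sum N t u v x) =
      (\<Sum>k\<le>M. cscale (t ^ k) (?d k)) - v x + (\<Sum>(a, b)\<in>{(a, b). a + b < N}. ?g a b)"
    by (simp add: sum.delta)
  have "ric_sum N t u v x ** u x ** ric_sum N t u v x = (\<Sum>a\<le>N. \<Sum>b\<le>N. ?g a b)"
    by (simp add: ric_sum_def mm.sum_left mm.sum_right power_add mult.commute)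
       (subst sum.swap, simp add: cscale.sum_right power_add mult.commute)
  also have "\<dots> = (\<Sum>(a, b)\<in>{..N} \<times> {..N}. ?g a b)"
    by (rule sum.cartesian_product)
  also have "{..N} \<times> {..N} = {(a, b). a + b < N} \<union> {(a, b). a \<le> N \<and> b \<le> N \<and> N \<le> a + b}"
    by auto
  also have "(\<Sum>(a, b)\<in>{(a, b). a + b < N} \<union> {(a, b). a \<le> N \<and> b \<le> N \<and> N \<le> a + b}. ?g a b) =
      (\<Sum>(a, b)\<in>{(a, b). a + b < N}. ?g a b) + (\<Sum>(a, b)\<in>{(a, b). a \<le> N \<and> b \<le> N \<and> N \<le> a + b}. ?g a b)"
    by (rule sum.union_disjoint)
       (auto intro: finite_subset[of _ "{..N} \<times> {..N}"])
  finally show ?thesis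
    unfolding 1 by (simp add: M)
qed

lemma decay_sum:
  assumes "finite I" "\<And>i. i \<in> I \<Longrightarrow> schwartz (f i)"
  shows "\<exists>c\<ge>0. \<forall>x. (\<Sum>i\<in>I. norm (f i x)) \<le> c * wt x"
proof -
  have "\<exists>c. \<forall>i\<in>I. c i > 0 \<and> (\<forall>x. norm (f i x) \<le> c i * wt x)"
    using schwartz_decay[OF assms(2)] by (intro bchoice) blast
  then obtain c where c: "\<And>i. i \<in> I \<Longrightarrow> c i > 0" "\<And>i x. i \<in> I \<Longrightarrow> norm (f i x) \<le> c i * wt x"
    by blast
  have "(\<Sum>i\<in>I. norm (f i x)) \<le> (\<Sum>i\<in>I. c i) * wt x" for x
    unfolding sum_distrib_right by (intro sum_mono c)
  then show ?thesis
    using c(1) by (intro exI[of _ "\<Sum>i\<in>I. c i"] conjI sum_nonneg) (auto intro: less_imp_le)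
qed

lemma ric_sum_residual_bound:
  fixes u :: "('m::finite, 'n::finite) pot" and v :: "('n, 'm) pot"
  assumes S: "schwartz u" "schwartz v"
  shows "\<exists>c\<ge>0. \<forall>t x. norm t \<le> 1 \<longrightarrow>
    norm (ric_rem N t u v x)
    \<le> norm t ^ N * (c * wt x)"
proof -
  let ?I = "{(a, b). a \<le> N \<and> b \<le> N \<and> N \<le> a + b}"
  have fin: "finite ?I" by (rule finite_subset[of _ "{..N} \<times> {..N}"]) auto
  obtain c1 where c1: "c1 > 0" "\<And>x. norm (Dx (ric u v N) x) \<le> c1 * wt x"
    using schwartz_decay[OF schwartz_Dx[OF schwartz_ric[OF S]]] by blast
  obtain c2 where c2: "c2 \<ge> 0" "\<And>x. (\<Sum>p\<in>?I. norm (ric u v (fst p) x ** u x ** ric u v (snd p) x)) \<le> c2 * wt x"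
    using decay_sum[OF fin, of "\<lambda>p x. ric u v (fst p) x ** u x ** ric u v (snd p) x"]
      schwartz_mult[OF schwartz_mult[OF schwartz_ric[OF S] S(1)] schwartz_ric[OF S]] by blast
  have "norm (- cscale (t ^ N) (Dx (ric u v N) x)
      - (\<Sum>(a, b)\<in>?I. cscale (t ^ (a + b)) (ric u v a x ** u x ** ric u v b x)))
    \<le> norm t ^ N * ((c1 + c2) * wt x)" if t: "norm t \<le> 1" for t x
  proof -
    have "norm (\<Sum>(a, b)\<in>?I. cscale (t ^ (a + b)) (ric u v a x ** u x ** ric u v b x))
        \<le> (\<Sum>p\<in>?I. norm t ^ N * norm (ric u v (fst p) x ** u x ** ric u v (snd p) x))"
    proof (rule order_trans[OF norm_sum sum_mono])
      fix p assume p: "p \<in> ?I"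
      have "norm t ^ (fst p + snd p) \<le> norm t ^ N"
        using p t by (intro power_decreasing) auto
      then show "norm (case p of (a, b) \<Rightarrow> cscale (t ^ (a + b)) (ric u v a x ** u x ** ric u v b x))
          \<le> norm t ^ N * norm (ric u v (fst p) x ** u x ** ric u v (snd p) x)"
        by (simp add: case_prod_beta norm_power mult_right_mono)
    qed
    also have "\<dots> \<le> norm t ^ N * (c2 * wt x)"
      unfolding sum_distrib_left[symmetric] by (intro mult_left_mono c2) auto
    finally have "norm (\<Sum>(a, b)\<in>?I. cscale (t ^ (a + b)) (ric u v a x ** u x ** ric u v b x))
        \<le> norm t ^ N * (c2 * wt x)" .
    moreover have "norm (- cscale (t ^ N) (Dx (ric u v N) x)) \<le> norm t ^ N * (c1 * wt x)"
      using c1(2)[of x] by (simp add: norm_power mult_left_mono)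
    ultimately show ?thesis
      using norm_triangle_ineq4[of "- cscale (t ^ N) (Dx (ric u v N) x)"
          "\<Sum>(a, b)\<in>?I. cscale (t ^ (a + b)) (ric u v a x ** u x ** ric u v b x)"]
      by (simp add: algebra_simps)
  qed
  then show ?thesis
    using c1 c2 by (intro exI[of _ "c1 + c2"]) auto
qed

lemma schwartz_ric_sum:
  assumes "schwartz u" "schwartz v"
  shows "schwartz (ric_sum N t u v)"
  unfolding ric_sum_def[abs_def] by (intro schwartz_intros schwartz_ric assms)

lemma ric_sum_has_derivative:
  assumes "schwartz u" "schwartz v"
  shows "(ric_sum N t u v has_vector_derivative (\<Sum>k\<le>N. cscale (t ^ k) (Dx (ric u v k) x))) (at x)"
  unfolding ric_sum_def[abs_def]
  by (intro has_vector_derivative_sum bounded_linear.has_vector_derivative[OF cscale.bounded_linear_right]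
      schwartz_has_derivative schwartz_ric assms)

text \<open>E = G - Y F satisfies E' = \<zeta> E + err F - Y u E, where err is of order |t|^N with t
  = 1/\<zeta>. As Y has no constant term, Y u is of order |t|, so for large z the last term can be
  absorbed: a bound S for E improves itself to a + S / 2 with a of order |t|^N.\<close>

lemma jostG_approximation:
  fixes u :: "('m::finite, 'n::finite) pot" and v :: "('n, 'm) pot"
  assumes S: "schwartz u" "schwartz v" and N: "N \<ge> 1"
  shows "\<exists>C R. C \<ge> 0 \<and> R > 0 \<and> (\<forall>z x. Im z \<ge> 0 \<longrightarrow> norm z \<ge> R \<longrightarrow>
    norm (jostG u v z x - ric_sum N (inverse (2 * \<i> * z)) u v x ** jostF u v z x) \<le> C * norm (inverse (2 * \<i> * z)) ^ N)"
proof -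
  obtain B where B: "\<And>z x. Im z \<ge> 0 \<Longrightarrow> norm (jostF u v z x) \<le> B" "\<And>z x. Im z \<ge> 0 \<Longrightarrow> norm (jostG u v z x) \<le> B"
    using jost_system(7)[OF S] by blast
  have B0: "B \<ge> 0" using order_trans[OF norm_ge_zero B(1)[of 0]] by simp
  obtain c1 where c1: "c1 \<ge> 0" "\<And>t x. norm t \<le> 1 \<Longrightarrow>
    norm (ric_rem N t u v x)
    \<le> norm t ^ N * (c1 * wt x)"
    using ric_sum_residual_bound[OF S, of N] by blast
  obtain b where b: "b > 0" "\<And>(A :: complex^'n^'m) (X :: complex^'n^'n). norm (A ** X) \<le> norm A * norm X * b"
    using mm.pos_bounded by blast
  have "\<exists>K. \<forall>k. K k > 0 \<and> (\<forall>x (X :: complex^'n^'m). norm (ric u v k x ** u x ** X) \<le> K k * wt x * norm X)"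
    by (intro choice allI mult_decay schwartz_mult schwartz_ric S)
  then obtain K where K: "\<And>k. K k > 0" "\<And>k x (X :: complex^'n^'m). norm (ric u v k x ** u x ** X) \<le> K k * wt x * norm X"
    by blast
  define c2 where "c2 = (\<Sum>k\<le>N. K k) + 1"
  have c2: "c2 > 0" using sum_nonneg[of "{..N}" K] K(1) by (simp add: c2_def less_imp_le add_nonneg_pos)
  define c3 where "c3 = c1 * B * b"
  have c3: "c3 \<ge> 0" using c1 B0 b by (simp add: c3_def)
  \<comment> \<open>The factor |t| is available because the coefficient of index 0 vanishes.\<close>
  have Yu: "norm (ric_sum N t u v x ** u x ** X) \<le> norm t * (c2 * wt x * norm X)" if t: "norm t \<le> 1" for t x and X :: "complex^'n^'m"
  proof -
    have "norm (ric_sum N t u v x ** u x ** X) \<le> (\<Sum>k\<le>N. norm t * (K k * (wt x * norm X)))"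
      unfolding ric_sum_def mm.sum_left
    proof (rule order_trans[OF norm_sum sum_mono])
      fix k
      show "norm (cscale (t ^ k) (ric u v k x) ** u x ** X) \<le> norm t * (K k * (wt x * norm X))"
      proof (cases k)
        case 0
        have "0 \<le> norm t * (K 0 * (wt x * norm X))"
          using K(1)[of 0] one_plus_square_pos[of x] by (intro mult_nonneg_nonneg) auto
        then show ?thesis using 0 by (simp add: cscale.zero_right)
      next
        case (Suc j)
        have "norm t ^ k \<le> norm t ^ 1"
          using t Suc by (intro power_decreasing) auto
        then have "norm t ^ k * norm (ric u v k x ** u x ** X) \<le> norm t * (K k * (wt x * norm X))"
          using K(2)[where k = k and x = x and X = X] by (intro mult_mono) (auto simp: mult.assoc)
        then show ?thesis by (simp add: norm_power)
      qed
    qed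
    also have "\<dots> = norm t * ((\<Sum>k\<le>N. K k) * (wt x * norm X))"
      by (simp add: sum_distrib_left sum_distrib_right)
    also have "\<dots> \<le> norm t * (c2 * wt x * norm X)"
      unfolding c2_def using one_plus_square_pos[of x]
      by (intro mult_left_mono) (auto simp: mult.assoc intro!: mult_right_mono mult_nonneg_nonneg)
    finally show ?thesis .
  qed
  have main: "norm (jostG u v z x - ric_sum N t u v x ** jostF u v z x) \<le> 2 * (pi * c3) * norm t ^ N"
    if z: "Im z \<ge> 0" "z \<noteq> 0" and t: "t = inverse (2 * \<i> * z)" "norm t \<le> 1" "norm t * (2 * pi * c2) \<le> 1" for z t x
  proof -
    let ?F = "jostF u v z" and ?G = "jostG u v z" and ?Y = "ric_sum N t u v" and ?\<zeta> = "2 * \<i> * z"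
    define E where "E x = ?G x - ?Y x ** ?F x" for x
    define err where "err x = ric_rem N t u v x" for x
    let ?Y' = "\<lambda>x. \<Sum>k\<le>N. cscale (t ^ k) (Dx (ric u v k) x)"
    have it: "inverse t = ?\<zeta>" "t \<noteq> 0"
      unfolding t(1) using z by (simp_all only: inverse_inverse_eq inverse_nonzero_iff_nonzero) simp
    have err: "v x + cscale ?\<zeta> (?Y x) - ?Y' x - ?Y x ** u x ** ?Y x = err x" for x
      using ric_sum_residual[OF it(2) N, of v x u] unfolding it err_def .
    have dE: "(E has_vector_derivative cscale ?\<zeta> (E x) + (err x ** ?F x - ?Y x ** u x ** E x)) (at x)" for x
    proof -
      have "(E has_vector_derivative (cscale ?\<zeta> (?G x) + v x ** ?F x)
          - (?Y x ** (u x ** ?G x) + ?Y' x ** ?F x)) (at x)"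
        unfolding E_def[abs_def]
        by (intro has_vector_derivative_diff mm.has_vector_derivative jost_system(1,2)[OF S z(1)] ric_sum_has_derivative S)
      also have "(cscale ?\<zeta> (?G x) + v x ** ?F x) - (?Y x ** (u x ** ?G x) + ?Y' x ** ?F x)
          = cscale ?\<zeta> (E x) + (err x ** ?F x - ?Y x ** u x ** E x)"
        unfolding err[symmetric] E_def
        by (simp add: mm.add_left mm.diff_left mm.diff_right cscale.diff_right matrix_mul_assoc)
      finally show ?thesis .
    qed
    have limE: "(E \<longlongrightarrow> 0) at_bot"
    proof -
      have "(E \<longlongrightarrow> 0 - 0 ** mat 1) at_bot"
        unfolding E_def[abs_def]
        by (intro tendsto_diff mm.tendsto jost_system(3,4)[OF S z(1)] schwartz_tendsto_0 schwartz_ric_sum S)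
      then show ?thesis by simp
    qed
    have Re: "Re ?\<zeta> \<le> 0" using z by simp
    have errF: "norm (err x ** ?F x) \<le> c3 * norm t ^ N * wt x" for x
    proof -
      have "norm (err x ** ?F x) \<le> norm (err x) * norm (?F x) * b" by (rule b)
      also have "\<dots> \<le> (norm t ^ N * (c1 * wt x)) * B * b"
        using c1(2)[OF t(2), of x] B(1)[OF z(1), of x] b B0 unfolding err_def[symmetric]
        by (intro mult_right_mono mult_mono) (auto intro: order_trans[OF norm_ge_zero])
      finally show ?thesis by (simp add: c3_def mult_ac)
    qed
    have improve: "norm (E x) \<le> pi * c3 * norm t ^ N + S0 / 2" if S0: "\<And>x. norm (E x) \<le> S0" for x S0
    proof -
      have S00: "S0 \<ge> 0" using order_trans[OF norm_ge_zero S0] .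
      have "norm (err x ** ?F x - ?Y x ** u x ** E x) \<le> (c3 * norm t ^ N + norm t * c2 * S0) * wt x" for x
      proof -
        have "norm t * (c2 * wt x * norm (E x)) \<le> norm t * (c2 * wt x * S0)"
          using S0[of x] c2 one_plus_square_pos[of x] by (intro mult_left_mono) auto
        then have "norm (?Y x ** u x ** E x) \<le> norm t * (c2 * wt x * S0)"
          using Yu[OF t(2), of x "E x"] by linarith
        then show ?thesis
          using errF[of x] norm_triangle_ineq4[of "err x ** ?F x" "?Y x ** u x ** E x"]
          by (simp add: algebra_simps)
      qed
      from damped_decay_estimate[OF dE this limE Re]
      have "norm (E x) \<le> (c3 * norm t ^ N + norm t * c2 * S0) * pi"
        using c3 c2 S00 by simp
      moreover have "norm t * (2 * pi * c2) * S0 \<le> 1 * S0"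
        using t(3) S00 by (rule mult_right_mono)
      ultimately show ?thesis by (simp add: algebra_simps)
    qed
    have bddE: "bdd_above (range (\<lambda>x. norm (E x)))"
    proof -
      obtain c where c: "\<And>x. norm (?Y x) \<le> c"
        using schwartz_bounded[OF schwartz_ric_sum[OF S], of 0 N t] by (auto simp: bounded_iff)
      have "norm (E x) \<le> B + c * B * b" for x
      proof -
        have "norm (?Y x ** ?F x) \<le> norm (?Y x) * norm (?F x) * b" by (rule b)
        also have "\<dots> \<le> c * B * b"
          using c[of x] B(1)[OF z(1), of x] b(1) order_trans[OF norm_ge_zero c[of x]]
          by (intro mult_right_mono mult_mono) auto
        finally show ?thesis
          unfolding E_def using B(2)[OF z(1), of x] norm_triangle_ineq4[of "?G x" "?Y x ** ?F x"] by linarith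
      qed
      then show ?thesis by (auto intro!: bdd_aboveI)
    qed
    define S0 where "S0 = (SUP x. norm (E x))"
    have le: "norm (E x) \<le> S0" for x
      unfolding S0_def by (rule cSUP_upper[OF UNIV_I bddE])
    \<comment> \<open>The supremum \<open>S0\<close> is finite by \<open>bddE\<close>, so this
      inequality can be solved for it; that is the origin of the factor 2 in the final
      bound.\<close>
    have "S0 \<le> pi * c3 * norm t ^ N + S0 / 2"
      unfolding S0_def by (rule cSUP_least) (use improve[OF le] in \<open>auto simp: S0_def\<close>)
    then show ?thesis
      using le[of x] unfolding E_def by (simp add: algebra_simps)
  qed
  \<comment> \<open>With t = 1 / (2 i z), norm z \<ge> \<pi> c2 is exactly the smallness condition 2
    \<pi> c2 |t| \<le> 1, and norm z \<ge> 1 gives |t| \<le> 1.\<close>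
  define R where "R = 1 + pi * c2"
  show ?thesis
  proof (rule exI[of _ "2 * (pi * c3)"], rule exI[of _ R], intro conjI allI impI)
    show "R > 0" using c2 by (simp add: R_def add_pos_nonneg)
    fix z x assume z: "Im z \<ge> 0" "norm z \<ge> R"
    have pos: "norm z > 0" using z \<open>R > 0\<close> by linarith
    show "norm (jostG u v z x - ric_sum N (inverse (2 * \<i> * z)) u v x ** jostF u v z x)
        \<le> 2 * (pi * c3) * norm (inverse (2 * \<i> * z)) ^ N"
    proof (rule main[OF z(1) _ refl])
      show "z \<noteq> 0" using pos by auto
      have "1 \<le> R" "pi * c2 \<le> R" using c2 by (simp_all add: R_def)
      then show "norm (inverse (2 * \<i> * z)) \<le> 1" "norm (inverse (2 * \<i> * z)) * (2 * pi * c2) \<le> 1"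
        using z(2) pos by (simp_all add: norm_mult norm_divide divide_simps)
    qed
  qed (use c3 in simp)
qed

text \<open>The weight with parameter 1 acts as a majorant that is bounded in x and yields a bound
  tending to 0 at -infinity.\<close>

lemma set_integral_atMost_decay:
  fixes h :: "real \<Rightarrow> 'a::euclidean_space"
  assumes "h \<in> borel_measurable borel" "\<And>x. norm (h x) \<le> c * wt x"
  shows "norm (LINT y:{..x}|lborel. h y) \<le> c * ((wexp 1 x - 1) / 2)"
proof -
  have c: "c \<ge> 0" using order_trans[OF norm_ge_zero assms(2)[of 0]] by simp
  have "norm (indicat_real {..x} y *\<^sub>R h y) \<le> c * vwt 1 y" for y
  proof -
    have "c * wt y * 1 \<le> c * wt y * wexp 1 y"
      using wexp_ge_1[of 1 y] c one_plus_square_pos[of y] by (intro mult_left_mono) auto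
    moreover have "norm (indicat_real {..x} y *\<^sub>R h y) \<le> norm (h y)"
      by (simp add: indicator_def)
    ultimately show ?thesis using assms(2)[of y] by simp
  qed
  moreover have "integrable lborel (\<lambda>y. indicat_real {..x} y *\<^sub>R h y)"
    by (intro integrable_mult_indicator integrable_decay[OF assms]) auto
  ultimately show ?thesis
    unfolding set_lebesgue_integral_def by (intro norm_half_line_integral) auto
qed

text \<open>The derivative of det F is tr (u Y) det F + e, where e collects the determinants with a
  row of u E. Multiplying by exp (-\<theta>) with \<theta>' = tr (u Y) removes the main part, so D =
  det F exp (-\<theta>) has a derivative of order |t|^N times an integrable weight. It runs from 1
  at -infinity to the product to be estimated at +infinity.\<close>

lemma det_jostA_estimate:
  fixes u :: "('m::finite, 'n::finite) pot" and v :: "('n, 'm) pot"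
  assumes S: "schwartz u" "schwartz v" and N: "N \<ge> 1"
  shows "\<exists>C R. R > 0 \<and> (\<forall>z. Im z \<ge> 0 \<longrightarrow> norm z \<ge> R \<longrightarrow>
    norm (det (jostA u v z) * exp (- (\<Sum>k=1..N. inverse (2 * \<i> * z) ^ k * loc_fun k u v)) - 1)
      \<le> C * norm (inverse (2 * \<i> * z)) ^ N)"
proof -
  obtain B where B: "\<And>z x. Im z \<ge> 0 \<Longrightarrow> norm (jostF u v z x) \<le> B"
    using jost_system(7)[OF S] by blast
  have B0: "B \<ge> 0" using order_trans[OF norm_ge_zero B[of 0]] by simp
  obtain C R where C: "C \<ge> 0" "R > 0" "\<And>z x. Im z \<ge> 0 \<Longrightarrow> norm z \<ge> R \<Longrightarrow>
    norm (jostG u v z x - ric_sum N (inverse (2 * \<i> * z)) u v x ** jostF u v z x) \<le> C * norm (inverse (2 * \<i> * z)) ^ N"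
    using jostG_approximation[OF S N] by blast
  obtain K where K: "K > 0" "\<And>y (X :: complex^'n^'m). norm (u y ** X) \<le> K * wt y * norm X"
    using mult_decay[OF S(1)] by blast
  have sch: "schwartz (\<lambda>x. trace (u x ** ric u v k x))" for k
    by (intro schwartz_intros schwartz_ric S)
  obtain c where c: "c \<ge> 0" "\<And>x. (\<Sum>k\<le>N. norm (trace (u x ** ric u v k x))) \<le> c * wt x"
    using decay_sum[of "{..N}" "\<lambda>k x. trace (u x ** ric u v k x)"] sch by blast
  \<comment> \<open>\<open>c5\<close> bounds |\<theta>|, as \<open>wexp 1\<close> is at most exp (2
    \<pi>). \<open>C6\<close> counts n replaced rows, each with its Leibniz bound times the bound K
    C for u E.\<close>
  define c5 where "c5 = c * ((exp (2 * pi) - 1) / 2)"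
  define C6 where "C6 = exp c5 * (of_nat CARD('n) * (fact CARD('n) * B ^ (CARD('n) - 1) * (K * C)))"
  have C6: "C6 \<ge> 0" using B0 K C by (simp add: C6_def)
  have main: "norm (det (jostA u v z) * exp (- (\<Sum>k=1..N. t ^ k * loc_fun k u v)) - 1) \<le> C6 * pi * norm t ^ N"
    if z: "Im z \<ge> 0" "norm z \<ge> R" and t: "t = inverse (2 * \<i> * z)" "norm t \<le> 1" for z t
  proof -
    let ?F = "jostF u v z" and ?G = "jostG u v z" and ?Y = "ric_sum N t u v"
    define E where "E x = ?G x - ?Y x ** ?F x" for x
    define h where "h x = trace (u x ** ?Y x)" for x
    define \<theta> where "\<theta> x = (LINT y:{..x}|lborel. h y)" for x
    have schh: "schwartz h"
      unfolding h_def[abs_def] by (intro schwartz_intros schwartz_ric_sum S)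
    have h_eq: "h x = (\<Sum>k\<le>N. t ^ k * trace (u x ** ric u v k x))" for x
      by (simp add: h_def ric_sum_def mm.sum_right trace_sum)
    have h_bound: "norm (h x) \<le> c * wt x" for x
    proof -
      have "norm (h x) \<le> (\<Sum>k\<le>N. 1 * norm (trace (u x ** ric u v k x)))"
        unfolding h_eq
        by (rule order_trans[OF norm_sum sum_mono])
           (unfold norm_mult norm_power, intro mult_right_mono power_le_one t, auto)
      then show ?thesis using c(2)[of x] by simp
    qed
    have h_cont: "continuous_on UNIV h" by (rule schwartz_continuous[OF schh])
    have h_meas: "h \<in> borel_measurable borel" by (rule borel_measurable_continuous_onI[OF h_cont])
    have \<theta>_bound: "norm (\<theta> x) \<le> c * ((wexp 1 x - 1) / 2)" for x
      unfolding \<theta>_def by (rule set_integral_atMost_decay[OF h_meas h_bound])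
    have \<theta>5: "norm (\<theta> x) \<le> c5" for x
    proof -
      have "c * ((wexp 1 x - 1) / 2) \<le> c5"
        unfolding c5_def using wexp_le[of 1 x] c(1) by (intro mult_left_mono divide_right_mono) auto
      then show ?thesis using \<theta>_bound[of x] by linarith
    qed
    have d\<theta>: "(\<theta> has_vector_derivative h x) (at x)" for x
      unfolding \<theta>_def[abs_def]
      by (rule set_integral_atMost_has_derivative[OF h_cont])
         (unfold set_integrable_def, intro integrable_mult_indicator schwartz_integrable schh, auto)
    have \<theta>_bot: "(\<theta> \<longlongrightarrow> 0) at_bot"
    proof (rule Lim_null_comparison)
      show "\<forall>\<^sub>F x in at_bot. norm (\<theta> x) \<le> c * ((wexp 1 x - 1) / 2)"
        using \<theta>_bound by simp
      have "((\<lambda>x. c * ((wexp 1 x - 1) / 2)) \<longlongrightarrow> c * ((1 - 1) / 2)) at_bot"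
        by (intro tendsto_intros wexp_at_bot) auto
      then show "((\<lambda>x. c * ((wexp 1 x - 1) / 2)) \<longlongrightarrow> 0) at_bot" by simp
    qed
    have \<theta>_top: "(\<theta> \<longlongrightarrow> (\<Sum>k=1..N. t ^ k * loc_fun k u v)) at_top"
    proof -
      have "(LINT x|lborel. h x) = (\<Sum>k\<le>N. t ^ k * loc_fun k u v)"
        unfolding h_eq loc_fun_def using schwartz_integrable[OF sch]
        by (simp add: Bochner_Integration.integral_sum)
      also have "\<dots> = (\<Sum>k=1..N. t ^ k * loc_fun k u v)"
      proof -
        have "loc_fun 0 u v = 0" by (simp add: loc_fun_def trace_def)
        then show ?thesis
          by (intro sum.mono_neutral_right) (auto simp: not_less_eq_eq)
      qed
      finally show ?thesis
        using tendsto_integral_at_top[of lborel h] schwartz_integrable[OF schh]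
        unfolding \<theta>_def[abs_def] set_lebesgue_integral_def by simp
    qed
    define D where "D x = det (?F x) * exp (- \<theta> x)" for x
    define e where "e x = (\<Sum>i\<in>UNIV. det (replace_row i ((u x ** E x) $ i) (?F x)))" for x
    have ddet: "((\<lambda>x. det (?F x)) has_vector_derivative h x * det (?F x) + e x) (at x)" for x
    proof -
      have "u x ** ?G x = u x ** ?Y x ** ?F x + u x ** E x"
        by (simp add: E_def mm.diff_right matrix_mul_assoc)
      then have "(\<Sum>i\<in>UNIV. det (replace_row i ((u x ** ?G x) $ i) (?F x))) = h x * det (?F x) + e x"
        by (simp add: det_replace_row_add sum.distrib sum_det_replace_row_mult h_def e_def)
      then show ?thesis
        using det_has_vector_derivative[OF jost_system(1)[OF S z(1), of x]] by simp
    qed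
    have dexp: "((\<lambda>x. exp (- \<theta> x)) has_vector_derivative - h x * exp (- \<theta> x)) (at x)" for x
    proof -
      have "((\<lambda>w. exp (- w)) has_field_derivative - exp (- \<theta> x)) (at (\<theta> x))"
        by (auto intro!: derivative_eq_intros)
      from field_vector_diff_chain_at[OF d\<theta> this] show ?thesis
        by (simp add: o_def)
    qed
    have dD: "(D has_vector_derivative e x * exp (- \<theta> x)) (at x)" for x
      using has_vector_derivative_mult[OF ddet dexp, of x] unfolding D_def[abs_def]
      by (simp add: algebra_simps)
    have bD: "norm (e x * exp (- \<theta> x)) \<le> (C6 * norm t ^ N) * wt x" for x
    proof -
      have uE: "norm (u x ** E x) \<le> K * wt x * (C * norm t ^ N)"
        using K(2)[of x "E x"] C(3)[OF z, of x] K(1) one_plus_square_pos[of x]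
        unfolding E_def t(1)[symmetric]
        by (elim order_trans) (intro mult_left_mono, auto)
      have "norm (e x) \<le> (\<Sum>i\<in>(UNIV :: 'n set). fact CARD('n) * B ^ (CARD('n) - 1) * (K * wt x * (C * norm t ^ N)))"
        unfolding e_def
      proof (rule order_trans[OF norm_sum sum_mono])
        fix i
        have "norm (det (replace_row i ((u x ** E x) $ i) (?F x))) \<le> fact CARD('n) * B ^ (CARD('n) - 1) * norm ((u x ** E x) $ i)"
          by (rule norm_det_replace_row[OF B[OF z(1)]])
        also have "\<dots> \<le> fact CARD('n) * B ^ (CARD('n) - 1) * (K * wt x * (C * norm t ^ N))"
          using order_trans[OF Finite_Cartesian_Product.norm_nth_le uE] B0 by (intro mult_left_mono) auto
        finally show "norm (det (replace_row i ((u x ** E x) $ i) (?F x))) \<le> fact CARD('n) * B ^ (CARD('n) - 1) * (K * wt x * (C * norm t ^ N))" .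
      qed
      moreover have "norm (exp (- \<theta> x)) \<le> exp c5"
        using norm_exp[of "- \<theta> x"] \<theta>5[of x] by (simp add: order_trans)
      ultimately have "norm (e x) * norm (exp (- \<theta> x)) \<le>
          (\<Sum>i\<in>(UNIV :: 'n set). fact CARD('n) * B ^ (CARD('n) - 1) * (K * wt x * (C * norm t ^ N))) * exp c5"
        by (intro mult_mono) (auto intro: order_trans[OF norm_ge_zero])
      also have "\<dots> = (C6 * norm t ^ N) * wt x"
        by (simp add: C6_def mult_ac)
      finally show ?thesis by (simp only: norm_mult)
    qed
    have Dbot: "(D \<longlongrightarrow> 1) at_bot"
    proof -
      have "(D \<longlongrightarrow> det (mat 1 :: complex^'n^'n) * exp (- 0)) at_bot"
        unfolding D_def[abs_def] by (intro tendsto_intros tendsto_det \<theta>_bot jost_system(3)[OF S z(1)])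
      then show ?thesis by simp
    qed
    have Dtop: "(D \<longlongrightarrow> det (jostA u v z) * exp (- (\<Sum>k=1..N. t ^ k * loc_fun k u v))) at_top"
      unfolding D_def[abs_def] by (intro tendsto_intros tendsto_det \<theta>_top jost_system(5)[OF S z(1)])
    have "norm (D x - 1) \<le> C6 * norm t ^ N * pi" for x
      by (rule decay_estimate[OF dD bD Dbot]) (use C6 in simp)
    then have "norm (det (jostA u v z) * exp (- (\<Sum>k=1..N. t ^ k * loc_fun k u v)) - 1) \<le> C6 * norm t ^ N * pi"
      by (intro tendsto_upperbound[OF tendsto_norm[OF tendsto_diff[OF Dtop tendsto_const]]]) auto
    then show ?thesis by (simp add: mult_ac)
  qed
  show ?thesis
  proof (rule exI[of _ "C6 * pi"], rule exI[of _ "max R 1"], intro conjI allI impI)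
    fix z assume z: "Im z \<ge> 0" "norm z \<ge> max R 1"
    then have "norm (inverse (2 * \<i> * z)) \<le> 1"
      by (simp add: norm_mult norm_divide divide_simps)
    then show "norm (det (jostA u v z) * exp (- (\<Sum>k=1..N. inverse (2 * \<i> * z) ^ k * loc_fun k u v)) - 1)
      \<le> C6 * pi * norm (inverse (2 * \<i> * z)) ^ N"
      using main[OF z(1) _ refl] z(2) by simp
  qed simp
qed

section \<open>Expansion of the logarithm\<close>

abbreviation uhp_infinity :: "complex filter" where
  "uhp_infinity \<equiv> inf at_infinity (principal {z. Im z > 0})"

lemma eventually_uhp_infinity:
  "eventually P uhp_infinity \<longleftrightarrow> (\<exists>R. \<forall>z. norm z \<ge> R \<longrightarrow> Im z > 0 \<longrightarrow> P z)"
  by (auto simp: eventually_inf_principal eventually_at_infinity)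

text \<open>The estimate is applied at order N + 1, where d = exp \<theta> (1 + \<eta>). The surplus
  order makes both \<eta> and the last term of \<theta> negligible against 1 / z^N.\<close>

lemma Ln_expansion:
  fixes d :: "complex \<Rightarrow> complex" and c :: "nat \<Rightarrow> complex"
  assumes est: "\<And>N. N \<ge> 1 \<Longrightarrow> \<exists>C R. R > 0 \<and> (\<forall>z. Im z \<ge> 0 \<longrightarrow> norm z \<ge> R \<longrightarrow>
    norm (d z * exp (- (\<Sum>k=1..N. c k / z ^ k)) - 1) \<le> C / norm z ^ N)"
  shows "(\<lambda>z. Ln (d z) - (\<Sum>k=1..N. c k / z ^ k)) \<in> o[uhp_infinity](\<lambda>z. 1 / z ^ N)"
proof (rule landau_o.smallI)
  fix e :: real assume e: "e > 0"
  obtain C R where C: "R > 0" "\<And>z. Im z \<ge> 0 \<Longrightarrow> norm z \<ge> R \<Longrightarrow>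
    norm (d z * exp (- (\<Sum>k=1..Suc N. c k / z ^ k)) - 1) \<le> C / norm z ^ Suc N"
    using est[of "Suc N"] by auto
  define S where "S = (\<Sum>k=1..Suc N. norm (c k))"
  define D where "D = \<bar>C\<bar> + 1"
  define q where "q = (norm (c (Suc N)) + 2 * D) / e"
  \<comment> \<open>One threshold for all demands: 1 makes powers of |z| monotone, S gives
    |\<theta>| \<le> 1, 4 D gives |\<eta>| \<le> 1/4, and q pushes the remainder below e /
    |z|^N.\<close>
  define R' where "R' = R + 1 + S + 4 * D + q"
  have D1: "D \<ge> 1" by (simp add: D_def)
  have S0: "S \<ge> 0" by (simp add: S_def sum_nonneg)
  have q0: "q \<ge> 0" using e by (simp add: D_def q_def)
  have main: "norm (Ln (d z) - (\<Sum>k=1..N. c k / z ^ k)) \<le> e * norm (1 / z ^ N)"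
    if z: "norm z \<ge> R'" "Im z > 0" for z
  proof -
    have big: "norm z \<ge> R" "norm z \<ge> 1" "norm z \<ge> S" "norm z \<ge> 4 * D" "norm z \<ge> q"
      using z(1) C(1) S0 q0 D1 unfolding R'_def by linarith+
    define \<theta> where "\<theta> = (\<Sum>k=1..Suc N. c k / z ^ k)"
    define \<eta> where "\<eta> = d z * exp (- \<theta>) - 1"
    have "norm \<eta> \<le> C / norm z ^ Suc N"
      using C(2)[of z] z big unfolding \<eta>_def \<theta>_def by simp
    also have "\<dots> \<le> D / norm z ^ Suc N"
      by (intro divide_right_mono) (auto simp: D_def)
    finally have \<eta>: "norm \<eta> \<le> D / norm z ^ Suc N" .
    have "D / norm z ^ Suc N \<le> D / norm z ^ 1"
    proof -
      have "z \<noteq> 0" using big(2) by auto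
      then show ?thesis
        using big(2) D1 by (intro divide_left_mono power_increasing) (auto simp: zero_less_mult_iff)
    qed
    also have "\<dots> \<le> 1 / 4"
    proof -
      have "norm z > 0" using big(2) by linarith
      then show ?thesis using big(4) by (simp add: divide_le_eq)
    qed
    finally have \<eta>4: "norm \<eta> \<le> 1 / 4"
      using \<eta> by linarith
    have Ln\<eta>: "norm (Ln (1 + \<eta>)) \<le> 2 * norm \<eta>"
      by (rule norm_Ln_le) (use \<eta>4 in simp)
    have "norm \<theta> \<le> (\<Sum>k=1..Suc N. norm (c k) / norm z)"
      unfolding \<theta>_def
    proof (rule order_trans[OF norm_sum sum_mono])
      fix k assume k: "k \<in> {1..Suc N}"
      have "norm z ^ 1 \<le> norm z ^ k"
        using big(2) k by (intro power_increasing) auto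
      moreover have "z \<noteq> 0" using big(2) by auto
      ultimately show "norm (c k / z ^ k) \<le> norm (c k) / norm z"
        unfolding norm_divide norm_power
        by (intro divide_left_mono) (auto simp: zero_less_mult_iff)
    qed
    also have "\<dots> = S / norm z" by (simp only: S_def sum_divide_distrib)
    also have "\<dots> \<le> 1"
    proof -
      have "norm z > 0" using big(2) by linarith
      then show ?thesis using big(3) by (simp add: divide_le_eq)
    qed
    finally have \<theta>1: "norm \<theta> \<le> 1" .
    have "1 + \<eta> \<noteq> 0"
    proof
      assume "1 + \<eta> = 0"
      then have "\<eta> = - 1" by (simp add: eq_neg_iff_add_eq_0 add.commute)
      then show False using \<eta>4 by simp
    qed
    then have "exp (\<theta> + Ln (1 + \<eta>)) = d z"
      by (simp add: exp_add \<eta>_def exp_minus)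
    \<comment> \<open>Branch check: |\<theta>| \<le> 1 and |Ln (1 + \<eta>)| \<le> 1/2 keep the
      imaginary part below \<pi>, so no multiple of 2 \<pi> i appears.\<close>
    moreover have "\<bar>Im (\<theta> + Ln (1 + \<eta>))\<bar> < pi"
    proof -
      have "\<bar>Im (\<theta> + Ln (1 + \<eta>))\<bar> \<le> norm (\<theta> + Ln (1 + \<eta>))" by (rule abs_Im_le_cmod)
      also have "\<dots> \<le> 1 + 1 / 2"
        using norm_triangle_ineq[of \<theta> "Ln (1 + \<eta>)"] \<theta>1 Ln\<eta> \<eta>4 by linarith
      finally show ?thesis using pi_gt3 by linarith
    qed
    ultimately have "Ln (d z) = \<theta> + Ln (1 + \<eta>)"
      by (intro Ln_unique) auto
    then have "Ln (d z) - (\<Sum>k=1..N. c k / z ^ k) = c (Suc N) / z ^ Suc N + Ln (1 + \<eta>)"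
      by (simp add: \<theta>_def)
    then have "norm (Ln (d z) - (\<Sum>k=1..N. c k / z ^ k)) \<le> norm (c (Suc N)) / norm z ^ Suc N + 2 * (D / norm z ^ Suc N)"
      using norm_triangle_ineq[of "c (Suc N) / z ^ Suc N" "Ln (1 + \<eta>)"] Ln\<eta> \<eta>
      by (simp add: norm_divide norm_power norm_mult)
    also have "\<dots> = (norm (c (Suc N)) + 2 * D) / norm z * (1 / norm z ^ N)"
      by (simp add: add_divide_distrib)
    also have "\<dots> \<le> e * (1 / norm z ^ N)"
    proof -
      have zp: "norm z > 0" using big(2) by linarith
      have "norm (c (Suc N)) + 2 * D \<le> e * norm z"
        using big(5) e unfolding q_def by (simp add: divide_le_eq mult.commute)
      then have "(norm (c (Suc N)) + 2 * D) / norm z \<le> e"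
        using zp by (simp add: divide_le_eq)
      then show ?thesis by (intro mult_right_mono) auto
    qed
    finally show ?thesis by (simp add: norm_divide norm_power)
  qed
  then show "\<forall>\<^sub>F z in uhp_infinity. norm (Ln (d z) - (\<Sum>k=1..N. c k / z ^ k)) \<le> e * norm (1 / z ^ N)"
    unfolding eventually_uhp_infinity by blast
qed

text \<open>By strong induction the truncations at N differ only by (c N - c' N) / z^N. This is o(1
  / z^N), which is tested at a point on the positive imaginary axis.\<close>

lemma expansion_unique:
  fixes f :: "complex \<Rightarrow> complex"
  assumes "\<And>N. (\<lambda>z. f z - (\<Sum>k=1..N. c k / z ^ k)) \<in> o[uhp_infinity](\<lambda>z. 1 / z ^ N)"
    and "\<And>N. (\<lambda>z. f z - (\<Sum>k=1..N. c' k / z ^ k)) \<in> o[uhp_infinity](\<lambda>z. 1 / z ^ N)"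
    and "k \<ge> 1"
  shows "c k = c' k"
  using assms(3)
proof (induction k rule: less_induct)
  case (less N)
  have "(\<lambda>z. (f z - (\<Sum>k=1..N. c' k / z ^ k)) - (f z - (\<Sum>k=1..N. c k / z ^ k))) \<in> o[uhp_infinity](\<lambda>z. 1 / z ^ N)"
    by (rule sum_in_smallo(2)[OF assms(2,1)])
  moreover have "(f z - (\<Sum>k=1..N. c' k / z ^ k)) - (f z - (\<Sum>k=1..N. c k / z ^ k)) = (c N - c' N) * (1 / z ^ N)" for z
  proof -
    obtain M where M: "N = Suc M" using less(2) by (cases N) auto
    have "(\<Sum>k=1..M. c k / z ^ k) = (\<Sum>k=1..M. c' k / z ^ k)"
      using less(1) M by (intro sum.cong) auto
    then show ?thesis by (simp add: M diff_divide_distrib)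
  qed
  ultimately have o: "(\<lambda>z. (c N - c' N) * (1 / z ^ N)) \<in> o[uhp_infinity](\<lambda>z. 1 / z ^ N)"
    by simp
  show ?case
  proof (rule ccontr)
    assume ne: "c N \<noteq> c' N"
    then have "norm (c N - c' N) / 2 > 0" by simp
    from landau_o.smallD[OF o this] obtain R
      where R: "\<And>z. norm z \<ge> R \<Longrightarrow> Im z > 0 \<Longrightarrow> norm ((c N - c' N) * (1 / z ^ N)) \<le> norm (c N - c' N) / 2 * norm (1 / z ^ N)"
      unfolding eventually_uhp_infinity by blast
    define z where "z = \<i> * of_real (max R 1)"
    have "norm z = max R 1" "Im z = max R 1"
      by (simp_all add: z_def norm_mult)
    then have z: "norm z \<ge> R" "Im z > 0" "z \<noteq> 0"
      by auto
    have "norm (c N - c' N) * norm (1 / z ^ N) \<le> norm (c N - c' N) / 2 * norm (1 / z ^ N)"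
      using R[OF z(1,2)] by (simp only: norm_mult)
    moreover have "norm (1 / z ^ N) > 0" using z by simp
    ultimately have "norm (c N - c' N) \<le> norm (c N - c' N) / 2"
      by (rule mult_right_le_imp_le)
    then show False using ne by simp
  qed
qed

text \<open>Extension by 0 to the lower half-plane is continuous, hence entire by pasting across the
  real line, and it vanishes on an open set.\<close>

lemma zero_on_real_line_imp_zero:
  assumes hol: "f holomorphic_on {z. Im z > 0}" and cont: "continuous_on {z. Im z \<ge> 0} f"
    and zero: "\<And>x::real. f (of_real x) = 0" and z: "Im z > 0"
  shows "f z = 0"
proof -
  define g where "g z = (if Im z \<ge> 0 then f z else 0)" for z
  have "g holomorphic_on UNIV"
  proof (rule holomorphic_on_paste_across_line[where d = \<i> and k = 0])
    have "f holomorphic_on (UNIV \<inter> {z. 0 < \<i> \<bullet> z})"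
      using hol by (simp add: inner_complex_def)
    then show "g holomorphic_on (UNIV \<inter> {z. 0 < \<i> \<bullet> z})"
      by (rule holomorphic_transform) (auto simp: g_def inner_complex_def)
    have "(\<lambda>z. 0) holomorphic_on (UNIV \<inter> {z. \<i> \<bullet> z < 0})" by simp
    then show "g holomorphic_on (UNIV \<inter> {z. \<i> \<bullet> z < 0})"
      by (rule holomorphic_transform) (auto simp: g_def inner_complex_def)
    have "continuous_on ({z. Im z \<ge> 0} \<union> {z. Im z \<le> 0}) (\<lambda>z. if Im z \<ge> 0 then f z else 0)"
    proof (rule continuous_on_If)
      show "closed {z. Im z \<ge> 0}" "closed {z. Im z \<le> 0}"
        by (rule closed_halfspace_Im_ge closed_halfspace_Im_le)+
      fix x assume "x \<in> {z. Im z \<le> 0}" "0 \<le> Im x"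
      then have "x = of_real (Re x)" by (simp add: complex_eq_iff)
      then show "f x = 0" using zero by metis
    qed (use cont in auto)
    moreover have "{z. Im z \<ge> 0} \<union> {z. Im z \<le> 0} = UNIV" by auto
    ultimately show "continuous_on UNIV g" by (simp add: g_def[abs_def])
  qed auto
  then have "g w = 0" for w
  proof (rule analytic_continuation_open[where s = "{z. Im z < 0}" and s' = UNIV and g = "\<lambda>_. 0", rotated 5])
    show "{z. Im z < 0} \<noteq> {}" using exI[of "\<lambda>z. Im z < 0" "- \<i>"] by auto
  qed (auto simp: g_def open_halfspace_Im_lt)
  then have "g z = 0" .
  then show ?thesis using z by (simp add: g_def)
qed

lemma extension_unique:
  assumes "extends_to_upper_half_plane f A" "extends_to_upper_half_plane f A'" "Im z > 0"
  shows "A z = A' z"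
proof -
  have "A z $ i $ j - A' z $ i $ j = 0" for i j
  proof (rule zero_on_real_line_imp_zero[where f = "\<lambda>z. A z $ i $ j - A' z $ i $ j"])
    show "(\<lambda>z. A z $ i $ j - A' z $ i $ j) holomorphic_on {z. Im z > 0}"
      using assms unfolding extends_to_upper_half_plane_def by (auto intro!: holomorphic_intros)
    show "continuous_on {z. Im z \<ge> 0} (\<lambda>z. A z $ i $ j - A' z $ i $ j)"
      using assms unfolding extends_to_upper_half_plane_def by (auto intro!: continuous_intros)
  qed (use assms in \<open>auto simp: extends_to_upper_half_plane_def\<close>)
  then show ?thesis
    by (simp add: vec_eq_iff)
qed

lemma ln_det_expansion_unique:
  assumes "ln_det_expansion f c" "ln_det_expansion f c'" "k \<ge> 1"
  shows "c k = c' k"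
proof -
  obtain A where A: "extends_to_upper_half_plane f A"
      "\<And>N. (\<lambda>z. Ln (det (A z)) - (\<Sum>k=1..N. c k / z ^ k)) \<in> o[uhp_infinity](\<lambda>z. 1 / z ^ N)"
    using assms(1) unfolding ln_det_expansion_def by blast
  obtain A' where A': "extends_to_upper_half_plane f A'"
      "\<And>N. (\<lambda>z. Ln (det (A' z)) - (\<Sum>k=1..N. c' k / z ^ k)) \<in> o[uhp_infinity](\<lambda>z. 1 / z ^ N)"
    using assms(2) unfolding ln_det_expansion_def by blast
  have ev: "\<forall>\<^sub>F z in uhp_infinity. Ln (det (A' z)) - (\<Sum>k=1..N. c' k / z ^ k) = Ln (det (A z)) - (\<Sum>k=1..N. c' k / z ^ k)" for N
    unfolding eventually_uhp_infinity using extension_unique[OF A(1) A'(1)] by auto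
  have "(\<lambda>z. Ln (det (A z)) - (\<Sum>k=1..N. c' k / z ^ k)) \<in> o[uhp_infinity](\<lambda>z. 1 / z ^ N)" for N
    using A'(2)[of N] landau_o.small.in_cong[OF ev[of N]] by blast
  then show ?thesis
    using expansion_unique[OF A(2) _ assms(3)] by blast
qed

text \<open>The estimates are in powers of 1/\<zeta> = 1 / (2 i z); the factor (2 i)^k converts them
  to powers of 1 / z.\<close>

lemma ln_det_expansion_jostA:
  fixes u :: "('m::finite, 'n::finite) pot" and v :: "('n, 'm) pot"
  assumes S: "schwartz u" "schwartz v" and f: "\<And>l::real. f l = jostA u v (of_real l)"
  shows "ln_det_expansion f (\<lambda>k. loc_fun k u v / (2 * \<i>) ^ k)"
  unfolding ln_det_expansion_def
proof (intro exI[of _ "jostA u v"] conjI allI)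
  show "extends_to_upper_half_plane f (jostA u v)"
    using jost_system(6)[OF S] f unfolding extends_to_upper_half_plane_def hol_uhp_def by simp
  fix N
  show "(\<lambda>z. Ln (det (jostA u v z)) - (\<Sum>k=1..N. loc_fun k u v / (2 * \<i>) ^ k / z ^ k)) \<in> o[uhp_infinity](\<lambda>z. 1 / z ^ N)"
  proof (rule Ln_expansion)
    fix N :: nat assume N: "N \<ge> 1"
    obtain C R where C: "R > 0" "\<And>z. Im z \<ge> 0 \<Longrightarrow> norm z \<ge> R \<Longrightarrow>
      norm (det (jostA u v z) * exp (- (\<Sum>k=1..N. inverse (2 * \<i> * z) ^ k * loc_fun k u v)) - 1)
      \<le> C * norm (inverse (2 * \<i> * z)) ^ N"
      using det_jostA_estimate[OF S N] by blast
    have eq: "loc_fun k u v / (2 * \<i>) ^ k / z ^ k = inverse (2 * \<i> * z) ^ k * loc_fun k u v" for k z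
      by (simp only: divide_inverse inverse_mult_distrib power_inverse power_mult_distrib mult_ac)
    have eq2: "C * norm (inverse (2 * \<i> * z)) ^ N = C / 2 ^ N / norm z ^ N" for z
    proof -
      have "norm (inverse (2 * \<i> * z)) = inverse (2 * norm z)"
        by (simp only: norm_inverse norm_mult norm_ii norm_numeral mult_1_right)
      then show ?thesis
        by (simp only: divide_inverse inverse_mult_distrib power_inverse power_mult_distrib mult.assoc)
    qed
    show "\<exists>C R. R > 0 \<and> (\<forall>z. Im z \<ge> 0 \<longrightarrow> norm z \<ge> R \<longrightarrow>
      norm (det (jostA u v z) * exp (- (\<Sum>k=1..N. loc_fun k u v / (2 * \<i>) ^ k / z ^ k)) - 1) \<le> C / norm z ^ N)"
      unfolding eq using C unfolding eq2 by (intro exI[of _ "C / 2 ^ N"] exI[of _ R]) simp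
  qed
qed

lemma THE_expansion_coefficient:
  assumes "ln_det_expansion f c" "k \<ge> 1"
  shows "(THE v. \<exists>c. ln_det_expansion f c \<and> c k = v) = c k"
  by (rule the_equality) (use assms ln_det_expansion_unique in blast)+

section \<open>Block matrices\<close>

lemma sum_UNIV_Plus:
  "(\<Sum>i\<in>(UNIV :: ('n::finite + 'm::finite) set). f i) = (\<Sum>i\<in>UNIV. f (Inl i)) + (\<Sum>i\<in>UNIV. f (Inr i))"
  unfolding UNIV_Plus_UNIV[symmetric] by (simp add: sum.Plus o_def del: UNIV_Plus_UNIV)

lemma block_mat_nth [simp]:
  "block_mat A B C D $ Inl i $ Inl j = A $ i $ j"
  "block_mat A B C D $ Inl i $ Inr j' = B $ i $ j'"
  "block_mat A B C D $ Inr i' $ Inl j = C $ i' $ j"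
  "block_mat A B C D $ Inr i' $ Inr j' = D $ i' $ j'"
  by (simp_all add: block_mat_def)

lemma matrix_sum_eqI:
  fixes M N :: "'a^('n::finite + 'm::finite)^('n + 'm)"
  assumes "\<And>i j. M $ Inl i $ Inl j = N $ Inl i $ Inl j" "\<And>i j. M $ Inl i $ Inr j = N $ Inl i $ Inr j"
    "\<And>i j. M $ Inr i $ Inl j = N $ Inr i $ Inl j" "\<And>i j. M $ Inr i $ Inr j = N $ Inr i $ Inr j"
  shows "M = N"
proof -
  have "M $ i $ j = N $ i $ j" for i j
    using assms by (cases i; cases j) auto
  then show ?thesis by (simp add: vec_eq_iff)
qed

lemma block_mat_mult:
  fixes A :: "complex^'n::finite^'n" and D :: "complex^'m::finite^'m"
  shows "block_mat A B C D ** block_mat A' B' C' D' =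
    block_mat (A ** A' + B ** C') (A ** B' + B ** D') (C ** A' + D ** C') (C ** B' + D ** D')"
  by (rule matrix_sum_eqI) (simp_all add: matrix_matrix_mult_def sum_UNIV_Plus)

lemma block_mat_add:
  "block_mat A B C D + block_mat A' B' C' D' = block_mat (A + A') (B + B') (C + C') (D + D')"
  by (rule matrix_sum_eqI) simp_all

lemma block_mat_diff:
  "block_mat A B C D - block_mat A' B' C' D' = block_mat (A - A') (B - B') (C - C') (D - D')"
  for A :: "complex^'n::finite^'n" and D :: "complex^'m::finite^'m"
  by (rule matrix_sum_eqI) simp_all

lemma block_mat_uminus:
  "- block_mat A B C D = block_mat (- A) (- B) (- C) (- D)"
  for A :: "complex^'n::finite^'n" and D :: "complex^'m::finite^'m"
  by (rule matrix_sum_eqI) simp_all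

lemma cscale_block_mat:
  "cscale c (block_mat A B C D) = block_mat (cscale c A) (cscale c B) (cscale c C) (cscale c D)"
  by (rule matrix_sum_eqI) simp_all

lemma block_mat_one: "block_mat (mat 1) 0 0 (mat 1) = mat 1"
  by (rule matrix_sum_eqI) (simp_all add: mat_def)

lemma transpose_block_mat:
  "transpose (block_mat A B C D) = block_mat (transpose A) (transpose C) (transpose B) (transpose D)"
  by (rule matrix_sum_eqI) (simp_all add: transpose_def)

lemma upper_left_block_mat: "upper_left (block_mat A B C D) = A"
  by (simp add: upper_left_def vec_eq_iff)

lemma lower_right_block_mat: "lower_right (block_mat A B C D) = D"
  by (simp add: lower_right_def vec_eq_iff)

lemma block_mat_split:
  "block_mat A B C D = block_mat A 0 0 0 + block_mat 0 B 0 0 + block_mat 0 0 C 0 + block_mat 0 0 0 D"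
  for A :: "complex^'n::finite^'n" and D :: "complex^'m::finite^'m"
  by (rule matrix_sum_eqI) simp_all

lemma bounded_linear_matrix_fun:
  fixes f :: "complex^'a::finite^'b::finite \<Rightarrow> complex^'c::finite^'d::finite"
  assumes "\<And>x y. f (x + y) = f x + f y" "\<And>r x. f (r *\<^sub>R x) = r *\<^sub>R f x"
  shows "bounded_linear f"
  using linearI[OF assms] by (simp add: linear_conv_bounded_linear)

lemma bounded_linear_block_mat:
  "bounded_linear (\<lambda>A. block_mat A 0 0 0 :: complex^('n::finite + 'm::finite)^('n + 'm))"
  "bounded_linear (\<lambda>B. block_mat 0 B 0 0 :: complex^('n::finite + 'm::finite)^('n + 'm))"
  "bounded_linear (\<lambda>C. block_mat 0 0 C 0 :: complex^('n::finite + 'm::finite)^('n + 'm))"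
  "bounded_linear (\<lambda>D. block_mat 0 0 0 D :: complex^('n::finite + 'm::finite)^('n + 'm))"
  by (rule bounded_linear_matrix_fun; rule matrix_sum_eqI; simp)+

lemma bounded_linear_upper_left: "bounded_linear (upper_left :: complex^('n::finite + 'm::finite)^('n + 'm) \<Rightarrow> _)"
  by (rule bounded_linear_matrix_fun) (simp_all add: upper_left_def vec_eq_iff)

lemma bounded_linear_lower_right: "bounded_linear (lower_right :: complex^('n::finite + 'm::finite)^('n + 'm) \<Rightarrow> _)"
  by (rule bounded_linear_matrix_fun) (simp_all add: lower_right_def vec_eq_iff)

lemma bounded_linear_transpose: "bounded_linear (transpose :: complex^'a::finite^'b::finite \<Rightarrow> _)"
  by (rule bounded_linear_matrix_fun) (simp_all add: transpose_def vec_eq_iff)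

lemma tendsto_block_mat:
  assumes "(A \<longlongrightarrow> A') F" "(B \<longlongrightarrow> B') F" "(C \<longlongrightarrow> C') F" "(D \<longlongrightarrow> D') F"
  shows "((\<lambda>x. block_mat (A x) (B x) (C x) (D x) :: complex^('n::finite + 'm::finite)^('n + 'm)) \<longlongrightarrow> block_mat A' B' C' D') F"
proof -
  have "((\<lambda>x. block_mat (A x) 0 0 0 + block_mat 0 (B x) 0 0 + block_mat 0 0 (C x) 0 + block_mat 0 0 0 (D x)
      :: complex^('n + 'm)^('n + 'm)) \<longlongrightarrow> block_mat A' 0 0 0 + block_mat 0 B' 0 0 + block_mat 0 0 C' 0 + block_mat 0 0 0 D') F"
    by (intro tendsto_add bounded_linear.tendsto[OF bounded_linear_block_mat(1)] bounded_linear.tendsto[OF bounded_linear_block_mat(2)]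
     bounded_linear.tendsto[OF bounded_linear_block_mat(3)] bounded_linear.tendsto[OF bounded_linear_block_mat(4)] assms)
  then show ?thesis by (simp only: block_mat_split[symmetric])
qed

lemma has_vector_derivative_block_mat:
  assumes "(A has_vector_derivative A') F" "(B has_vector_derivative B') F" "(C has_vector_derivative C') F" "(D has_vector_derivative D') F"
  shows "((\<lambda>x. block_mat (A x) (B x) (C x) (D x) :: complex^('n::finite + 'm::finite)^('n + 'm)) has_vector_derivative block_mat A' B' C' D') F"
proof -
  have "((\<lambda>x. block_mat (A x) 0 0 0 + block_mat 0 (B x) 0 0 + block_mat 0 0 (C x) 0 + block_mat 0 0 0 (D x)
      :: complex^('n + 'm)^('n + 'm)) has_vector_derivative
      block_mat A' 0 0 0 + block_mat 0 B' 0 0 + block_mat 0 0 C' 0 + block_mat 0 0 0 D') F"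
    by (intro has_vector_derivative_add bounded_linear.has_vector_derivative[OF bounded_linear_block_mat(1)]
     bounded_linear.has_vector_derivative[OF bounded_linear_block_mat(2)]
     bounded_linear.has_vector_derivative[OF bounded_linear_block_mat(3)]
     bounded_linear.has_vector_derivative[OF bounded_linear_block_mat(4)] assms)
  then show ?thesis by (simp only: block_mat_split[symmetric])
qed

lemma mat_eq_cscale: "mat c = cscale c (mat 1)"
  by (simp add: vec_eq_iff mat_def)


section \<open>The linear system\<close>

lemma exp_J_inverse: "exp_J z x ** exp_J (- z) x = mat 1"
  unfolding exp_J_def block_mat_mult block_mat_one[symmetric]
  by (simp add: mult_mat_eq_cscale cscale.zero_right) (simp add: mat_eq_cscale[of "exp _"] exp_minus_inverse mult_exp_exp)

lemma exp_J_reflect: "exp_J (- z) (- x) = exp_J z x"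
  by (simp add: exp_J_def)

lemma transpose_exp_J: "transpose (exp_J z x) = exp_J z x"
  by (simp add: exp_J_def transpose_block_mat transpose_mat) (simp add: transpose_def zero_vec_def)

lemma exp_J_bounded:
  "\<exists>B>0. \<forall>l x. norm (exp_J (of_real l) x :: complex^('n::finite + 'm::finite)^('n + 'm)) \<le> B"
proof -
  let ?P = "block_mat (mat 1) 0 0 0 :: complex^('n + 'm)^('n + 'm)" and ?P' = "block_mat 0 0 0 (mat 1) :: complex^('n + 'm)^('n + 'm)"
  have "norm (exp_J (of_real l) x :: complex^('n + 'm)^('n + 'm)) \<le> norm ?P + norm ?P' + 1" for l x
  proof -
    have "exp_J (of_real l) x = cscale (exp (\<i> * of_real l * of_real x)) ?P + cscale (exp (- \<i> * of_real l * of_real x)) ?P'"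
      unfolding exp_J_def mat_eq_cscale[of "exp _"]
      by (simp add: cscale_block_mat block_mat_add cscale.zero_right)
    moreover have "norm (exp (\<i> * of_real l * of_real x)) = 1" "norm (exp (- \<i> * of_real l * of_real x)) = 1"
      by (simp_all add: norm_exp_eq_Re)
    ultimately show ?thesis
      using norm_triangle_ineq[of "cscale (exp (\<i> * of_real l * of_real x)) ?P" "cscale (exp (- \<i> * of_real l * of_real x)) ?P'"]
      by simp
  qed
  then show ?thesis
    by (intro exI[of _ "norm ?P + norm ?P' + 1"]) (auto intro: add_nonneg_pos)
qed

text \<open>For real \<open>l\<close> the conjugating factors are bounded, although they do not converge.\<close>

lemma tendsto_conj_exp_J:
  fixes f :: "real \<Rightarrow> complex^('n::finite + 'm::finite)^('n + 'm)" and l :: real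
  assumes "(f \<longlongrightarrow> mat 1) F"
  shows "((\<lambda>x. exp_J (of_real l) x ** f x ** exp_J (- of_real l) x) \<longlongrightarrow> mat 1) F"
proof -
  obtain B where B: "B > 0" "\<And>l x. norm (exp_J (of_real l) x :: complex^('n + 'm)^('n + 'm)) \<le> B"
    using exp_J_bounded by blast
  obtain K where K: "K > 0" "\<And>(A :: complex^('n + 'm)^('n + 'm)) (C :: complex^('n + 'm)^('n + 'm)). norm (A ** C) \<le> norm A * norm C * K"
    using mm.pos_bounded by blast
  have bound: "norm (exp_J (of_real l) x ** f x ** exp_J (- of_real l) x - mat 1) \<le> norm (f x - mat 1) * (B * K * B * K)" for x
  proof -
    have "exp_J (of_real l) x ** f x ** exp_J (- of_real l) x - mat 1 = exp_J (of_real l) x ** (f x - mat 1) ** exp_J (- of_real l) x"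
      by (simp add: mm.diff_left mm.diff_right exp_J_inverse)
    then have "norm (exp_J (of_real l) x ** f x ** exp_J (- of_real l) x - mat 1)
        \<le> norm (exp_J (of_real l) x ** (f x - mat 1)) * norm (exp_J (- of_real l) x :: complex^('n + 'm)^('n + 'm)) * K"
      using K(2)[of "exp_J (of_real l) x ** (f x - mat 1)" "exp_J (- of_real l) x"] by simp
    also have "\<dots> \<le> (B * norm (f x - mat 1) * K) * B * K"
    proof (intro mult_right_mono mult_mono)
      show "norm (exp_J (of_real l) x ** (f x - mat 1)) \<le> B * norm (f x - mat 1) * K"
        using K(1) B(2)[of l x] by (intro order_trans[OF K(2)] mult_right_mono) auto
      show "norm (exp_J (- of_real l) x :: complex^('n + 'm)^('n + 'm)) \<le> B"
        using B(2)[of "- l" x] by simp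
    qed (use K B in auto)
    finally show ?thesis by (simp add: mult_ac)
  qed
  have "((\<lambda>x. norm (f x - mat 1) * (B * K * B * K)) \<longlongrightarrow> 0) F"
    using assms by (intro tendsto_mult_left_zero tendsto_norm_zero) (simp add: LIM_zero_iff)
  then have "((\<lambda>x. exp_J (of_real l) x ** f x ** exp_J (- of_real l) x - mat 1) \<longlongrightarrow> 0) F"
    by (rule Lim_null_comparison[OF always_eventually, rotated]) (use bound in auto)
  then show ?thesis by (simp add: LIM_zero_iff)
qed

lemma solves_system_iff:
  fixes \<psi> :: "real \<Rightarrow> complex^('n::finite + 'm::finite)^('n + 'm)"
  shows "solves_system q r z \<psi> \<longleftrightarrow>
    (\<forall>x. (\<psi> has_vector_derivative cscale \<i> ((Q_mat q r x - mat z ** J_mat) ** \<psi> x)) (at x))"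
proof -
  have eq: "mat \<i> ** D + M = 0 \<longleftrightarrow> D = cscale \<i> M" for D M :: "complex^('n + 'm)^('n + 'm)"
  proof
    assume "mat \<i> ** D + M = 0"
    then have "cscale \<i> D = - M" by (simp add: mat_mult_eq_cscale eq_neg_iff_add_eq_0)
    then have "cscale (- \<i>) (cscale \<i> D) = cscale (- \<i>) (- M)" by simp
    then show "D = cscale \<i> M" by (simp add: cscale.minus_left cscale.minus_right)
  next
    assume "D = cscale \<i> M"
    then show "mat \<i> ** D + M = 0" by (simp add: mat_mult_eq_cscale cscale.minus_left)
  qed
  have vd: "\<psi> differentiable (at x) \<and> vector_derivative \<psi> (at x) = D \<longleftrightarrow> (\<psi> has_vector_derivative D) (at x)" for x D
    using vector_derivative_works[of \<psi> "at x"] vector_derivative_at[of \<psi> D x] differentiableI_vector[of \<psi> D "at x"]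
    by blast
  show ?thesis
    unfolding solves_system_def eq vd by (rule refl)
qed

text \<open>The Jost normalization puts the exponential on the right, but T can be read off \<phi> =
  \<psi> T in the limit only with the exponential on the left. Conjugation by \<open>exp_J\<close>
  moves it across, because the limit is the identity.\<close>

lemma tendsto_exp_J_left:
  assumes "((\<lambda>x. \<phi> x ** exp_J (of_real l) x) \<longlongrightarrow> mat 1) F"
  shows "((\<lambda>x. exp_J (of_real l) x ** \<phi> x) \<longlongrightarrow> mat 1) F"
proof -
  have "exp_J (of_real l) x ** (\<phi> x ** exp_J (of_real l) x) ** exp_J (- of_real l) x = exp_J (of_real l) x ** \<phi> x" for x
    by (simp add: matrix_mul_assoc[symmetric] exp_J_inverse)
  then show ?thesis
    using tendsto_conj_exp_J[OF assms, of l] by simp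
qed

lemma jost_phi_left: "jost_phi q r l \<phi> \<Longrightarrow> ((\<lambda>x. exp_J (of_real l) x ** \<phi> x) \<longlongrightarrow> mat 1) at_bot"
  and jost_psi_left: "jost_psi q r l \<psi> \<Longrightarrow> ((\<lambda>x. exp_J (of_real l) x ** \<psi> x) \<longlongrightarrow> mat 1) at_top"
  by (simp_all add: jost_phi_def jost_psi_def tendsto_exp_J_left)

lemma mat_J_mat: "mat z ** J_mat = block_mat (mat z) 0 0 (- mat z)"
  unfolding J_mat_def mat_mult_eq_cscale cscale_block_mat
  by (simp add: cscale.zero_right cscale.minus_right mat_eq_cscale[of z])

text \<open>The second block column is the first one of the system with u and v interchanged and z
  replaced by -z. Both parameters lie in the closed upper half-plane since l is real.\<close>

definition phi_sol ::
  "('m::finite, 'n::finite) pot \<Rightarrow> ('n, 'm) pot \<Rightarrow> real \<Rightarrow> real \<Rightarrow> complex^('n + 'm)^('n + 'm)" where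
  "phi_sol q r l x =
    (let u = (imul q); v = (imul r); z = of_real l;
         e1 = exp (- \<i> * z * of_real x); e2 = exp (\<i> * z * of_real x)
     in block_mat (cscale e1 (jostF u v z x)) (cscale e2 (jostG v u (- z) x))
                  (cscale e1 (jostG u v z x)) (cscale e2 (jostF v u (- z) x)))"

lemma jost_phi_phi_sol:
  fixes q :: "('m::finite, 'n::finite) pot"
  assumes "schwartz q" "schwartz r"
  shows "jost_phi q r l (phi_sol q r l)"
proof -
  define u where "u = (imul q)"
  define v where "v = (imul r)"
  define z where "z = complex_of_real l"
  have S: "schwartz u" "schwartz v"
    unfolding u_def v_def by (intro schwartz_cscale assms)+
  have Im: "Im z \<ge> 0" "Im (- z) \<ge> 0" by (simp_all add: z_def)
  have eq: "phi_sol q r l = (\<lambda>x. block_mat (cscale (exp (- \<i> * z * of_real x)) (jostF u v z x)) (cscale (exp (\<i> * z * of_real x)) (jostG v u (- z) x))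
     (cscale (exp (- \<i> * z * of_real x)) (jostG u v z x)) (cscale (exp (\<i> * z * of_real x)) (jostF v u (- z) x)))"
    by (simp add: fun_eq_iff phi_sol_def Let_def u_def v_def z_def)
  have dexp: "((\<lambda>x. exp (w * of_real x)) has_vector_derivative w * exp (w * of_real x)) (at x)" for w :: complex and x :: real
  proof -
    have "((\<lambda>y. exp (w * y)) has_field_derivative w * exp (w * of_real x)) (at (of_real x))"
      by (auto intro!: derivative_eq_intros)
    from has_vector_derivative_real_field[OF this] show ?thesis by simp
  qed
  note d1 = jost_system(1,2)[OF S Im(1)] and d2 = jost_system(1,2)[OF S(2,1) Im(2)]
  have "solves_system q r (of_real l) (phi_sol q r l)"
    unfolding solves_system_iff
  proof
    fix x
    let ?e1 = "exp (- \<i> * z * of_real x)" and ?e2 = "exp (\<i> * z * of_real x)"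
    have "(phi_sol q r l has_vector_derivative block_mat
       (cscale ?e1 (u x ** jostG u v z x) + cscale (- \<i> * z * ?e1) (jostF u v z x))
       (cscale ?e2 (cscale (2 * \<i> * - z) (jostG v u (- z) x) + u x ** jostF v u (- z) x) + cscale (\<i> * z * ?e2) (jostG v u (- z) x))
       (cscale ?e1 (cscale (2 * \<i> * z) (jostG u v z x) + v x ** jostF u v z x) + cscale (- \<i> * z * ?e1) (jostG u v z x))
       (cscale ?e2 (v x ** jostG v u (- z) x) + cscale (\<i> * z * ?e2) (jostF v u (- z) x))) (at x)"
      unfolding eq by (intro has_vector_derivative_block_mat cscale.has_vector_derivative dexp d1 d2)
    also have "block_mat
       (cscale ?e1 (u x ** jostG u v z x) + cscale (- \<i> * z * ?e1) (jostF u v z x))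
       (cscale ?e2 (cscale (2 * \<i> * - z) (jostG v u (- z) x) + u x ** jostF v u (- z) x) + cscale (\<i> * z * ?e2) (jostG v u (- z) x))
       (cscale ?e1 (cscale (2 * \<i> * z) (jostG u v z x) + v x ** jostF u v z x) + cscale (- \<i> * z * ?e1) (jostG u v z x))
       (cscale ?e2 (v x ** jostG v u (- z) x) + cscale (\<i> * z * ?e2) (jostF v u (- z) x))
      = cscale \<i> ((Q_mat q r x - mat (of_real l) ** J_mat) ** phi_sol q r l x)"
      unfolding mat_J_mat Q_mat_def eq block_mat_diff block_mat_mult cscale_block_mat z_def[symmetric]
      by (rule arg_cong4[where f = block_mat])
         (simp_all add: u_def v_def mm.diff_left mm.minus_left mat_mult_eq_cscale vec_eq_iff algebra_simps)
    finally show "(phi_sol q r l has_vector_derivative cscale \<i> ((Q_mat q r x - mat (of_real l) ** J_mat) ** phi_sol q r l x)) (at x)" .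
  qed
  moreover have "((\<lambda>x. phi_sol q r l x ** exp_J (of_real l) x) \<longlongrightarrow> mat 1) at_bot"
  proof -
    have "exp (- \<i> * z * of_real x) * exp (\<i> * z * of_real x) = 1" for x
      by (simp add: exp_minus)
    then have "phi_sol q r l x ** exp_J (of_real l) x = block_mat (jostF u v z x) (jostG v u (- z) x) (jostG u v z x) (jostF v u (- z) x)" for x
      unfolding eq exp_J_def block_mat_mult z_def[symmetric] by (simp add: mult_mat_eq_cscale mult.commute)
    moreover have "((\<lambda>x. block_mat (jostF u v z x) (jostG v u (- z) x) (jostG u v z x) (jostF v u (- z) x)) \<longlongrightarrow>
        block_mat (mat 1) 0 0 (mat 1)) at_bot"
      by (intro tendsto_block_mat jost_system(3,4)[OF S Im(1)] jost_system(3,4)[OF S(2,1) Im(2)])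
    ultimately show ?thesis by (simp add: block_mat_one)
  qed
  ultimately show ?thesis by (simp add: jost_phi_def)
qed

lemma upper_left_phi_sol:
  "upper_left (exp_J (of_real l) x ** phi_sol q r l x) = jostF (imul q) (imul r) (of_real l) x"
  unfolding exp_J_def phi_sol_def Let_def block_mat_mult upper_left_block_mat mat_mult_eq_cscale
  by (simp add: exp_minus cscale.zero_right)

lemma lower_right_phi_sol:
  "lower_right (exp_J (of_real l) x ** phi_sol q r l x) = jostF (imul r) (imul q) (- of_real l) x"
  unfolding exp_J_def phi_sol_def Let_def block_mat_mult lower_right_block_mat mat_mult_eq_cscale
  by (simp add: exp_minus cscale.zero_right)

text \<open>Under x -> -x the potential becomes -Q(-x) and the parameter -l; \<open>exp_J\<close> is
  unchanged when both signs flip, so the normalization simply moves from -infinity to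
  +infinity.\<close>

lemma jost_psi_reflect:
  assumes "jost_phi (nrefl q) (nrefl r) (- l) \<phi>"
  shows "jost_psi q r l (\<lambda>x. \<phi> (- x))"
  unfolding jost_psi_def
proof
  have d: "(\<phi> has_vector_derivative cscale \<i> ((Q_mat (nrefl q) (nrefl r) x - mat (of_real (- l)) ** J_mat) ** \<phi> x)) (at x)" for x
    using assms unfolding jost_phi_def solves_system_iff by blast
  have Q: "- (Q_mat (nrefl q) (nrefl r) (- x) - mat (of_real (- l)) ** J_mat) = Q_mat q r x - mat (of_real l) ** J_mat" for x
    unfolding mat_J_mat Q_mat_def block_mat_diff block_mat_uminus
    by (rule arg_cong4[where f = block_mat]) (simp_all add: mat_eq_cscale[of "of_real _"] mat_eq_cscale[of "- of_real _"] cscale.minus_left)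
  show "solves_system q r (of_real l) (\<lambda>x. \<phi> (- x))"
    unfolding solves_system_iff Q[symmetric] mm.minus_left cscale.minus_right
    by (intro allI has_vector_derivative_reflect d)
  have "((\<lambda>x. \<phi> x ** exp_J (of_real (- l)) x) \<longlongrightarrow> mat 1) at_bot"
    using assms by (simp add: jost_phi_def)
  then show "((\<lambda>x. \<phi> (- x) ** exp_J (of_real l) x) \<longlongrightarrow> mat 1) at_top"
    unfolding filterlim_at_bot_mirror by (simp add: exp_J_reflect)
qed

text \<open>The inverse of a fundamental solution is the transpose of a solution of the system with
  potential \<open>- Q\<^sup>T\<close> and spectral parameter \<open>- l\<close>.\<close>

lemma adjoint_solution:
  fixes q :: "('m::finite, 'n::finite) pot"
  assumes "schwartz q" "schwartz r"
  shows "\<exists>X. (\<forall>\<omega>. solves_system q r (of_real l) \<omega> \<longrightarrow> (\<exists>M. \<forall>x. X x ** \<omega> x = M)) \<and>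
    (\<forall>\<phi>. jost_phi q r l \<phi> \<longrightarrow> (\<forall>x. X x ** \<phi> x = mat 1))"
proof -
  define q' where "q' = (\<lambda>x. - transpose (r x))"
  define r' where "r' = (\<lambda>x. - transpose (q x))"
  have S: "schwartz q'" "schwartz r'"
    unfolding q'_def r'_def by (intro schwartz_uminus schwartz_linear[OF bounded_linear_transpose] assms)+
  define \<phi>' where "\<phi>' = phi_sol q' r' (- l)"
  define X where "X = (\<lambda>x. transpose (\<phi>' x))"
  have j: "jost_phi q' r' (- l) \<phi>'"
    unfolding \<phi>'_def by (rule jost_phi_phi_sol[OF S])
  have Q: "transpose (Q_mat q' r' x - mat (of_real (- l)) ** J_mat) = - (Q_mat q r x - mat (of_real l) ** J_mat)" for x
    unfolding mat_J_mat Q_mat_def block_mat_diff block_mat_uminus transpose_block_mat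
    by (rule arg_cong4[where f = block_mat])
       (simp_all add: q'_def r'_def vec_eq_iff transpose_def mat_def)
  have dX: "(X has_vector_derivative - cscale \<i> (X x ** (Q_mat q r x - mat (of_real l) ** J_mat))) (at x)" for x
  proof -
    have tc: "transpose (cscale c A) = cscale c (transpose A)" for c and A :: "complex^'a::finite^'b::finite"
      by (simp add: vec_eq_iff transpose_def)
    have "(\<phi>' has_vector_derivative cscale \<i> ((Q_mat q' r' x - mat (of_real (- l)) ** J_mat) ** \<phi>' x)) (at x)"
      using j unfolding jost_phi_def solves_system_iff by blast
    from bounded_linear.has_vector_derivative[OF bounded_linear_transpose this]
    show ?thesis
      unfolding X_def[symmetric] tc matrix_transpose_mul Q by (simp add: X_def mm.minus_right cscale.minus_right del: minus_diff_eq)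
  qed
  have const: "\<exists>M. \<forall>x. X x ** \<omega> x = M" if "solves_system q r (of_real l) \<omega>" for \<omega>
  proof -
    have d\<omega>: "(\<omega> has_vector_derivative cscale \<i> ((Q_mat q r x - mat (of_real l) ** J_mat) ** \<omega> x)) (at x)" for x
      using that unfolding solves_system_iff by blast
    have "((\<lambda>x. X x ** \<omega> x) has_vector_derivative 0) (at x)" for x
      using mm.has_vector_derivative[OF dX d\<omega>, of x] by (simp add: mm.minus_left matrix_mul_assoc)
    then obtain M where "\<And>x. X x ** \<omega> x = M"
      using has_vector_derivative_zero_constant[of UNIV "\<lambda>x. X x ** \<omega> x"] by auto
    then show ?thesis by blast
  qed
  have limX: "((\<lambda>x. exp_J (- of_real l) x ** X x) \<longlongrightarrow> mat 1) at_bot"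
  proof -
    have "((\<lambda>x. transpose (\<phi>' x ** exp_J (of_real (- l)) x)) \<longlongrightarrow> transpose (mat 1)) at_bot"
      by (rule bounded_linear.tendsto[OF bounded_linear_transpose]) (use j in \<open>simp add: jost_phi_def\<close>)
    then show ?thesis
      by (simp add: matrix_transpose_mul transpose_exp_J X_def transpose_mat)
  qed
  have one: "\<forall>x. X x ** \<phi> x = mat 1" if \<phi>: "jost_phi q r l \<phi>" for \<phi>
  proof -
    obtain M where M: "\<And>x. X x ** \<phi> x = M"
      using const \<phi> unfolding jost_phi_def by blast
    have "((\<lambda>x. (exp_J (- of_real l) x ** X x) ** (\<phi> x ** exp_J (of_real l) x)) \<longlongrightarrow> mat 1 ** mat 1) at_bot"
      by (intro mm.tendsto limX) (use \<phi> in \<open>simp add: jost_phi_def\<close>)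
    moreover have "(exp_J (- of_real l) x ** X x) ** (\<phi> x ** exp_J (of_real l) x) = exp_J (- of_real l) x ** M ** exp_J (of_real l) x" for x
      unfolding M[of x, symmetric] by (simp add: matrix_mul_assoc)
    ultimately have "((\<lambda>x. exp_J (- of_real l) x ** M ** exp_J (of_real l) x) \<longlongrightarrow> mat 1) at_bot"
      by simp
    \<comment> \<open>A second conjugation undoes the first one, so the constant M itself tends to
      the identity.\<close>
    from tendsto_conj_exp_J[OF this, of l]
    have "((\<lambda>x. exp_J (of_real l) x ** (exp_J (- of_real l) x ** M ** exp_J (of_real l) x) ** exp_J (- of_real l) x) \<longlongrightarrow> mat 1) at_bot" .
    moreover have "exp_J (of_real l) x ** (exp_J (- of_real l) x ** M ** exp_J (of_real l) x) ** exp_J (- of_real l) x = M" for x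
    proof -
      have "exp_J (of_real l) x ** (exp_J (- of_real l) x ** M ** exp_J (of_real l) x) ** exp_J (- of_real l) x
          = (exp_J (of_real l) x ** exp_J (- of_real l) x) ** M ** (exp_J (of_real l) x ** exp_J (- of_real l) x)"
        by (simp only: matrix_mul_assoc)
      then show ?thesis by (simp add: exp_J_inverse)
    qed
    ultimately have "M = mat 1"
      by (simp add: tendsto_const_iff)
    then show ?thesis using M by simp
  qed
  show ?thesis
    using const one by (intro exI[of _ X]) blast
qed


section \<open>The scattering matrix\<close>

lemma matrix_inv_eqI:
  fixes T M :: "complex^'a::finite^'a"
  assumes "M ** T = mat 1"
  shows "matrix_inv T = M"
proof -
  have TM: "T ** M = mat 1"
    using assms by (simp add: matrix_left_right_inverse)
  have "T ** matrix_inv T = mat 1"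
    unfolding matrix_inv_def by (rule someI2[where a = M]) (use assms TM in auto)
  then have "M ** (T ** matrix_inv T) = M" by simp
  then show ?thesis using assms by (simp add: matrix_mul_assoc)
qed

text \<open>The adjoint solution \<open>X\<close> inverts every Jost solution \<phi>, which yields
  both the uniqueness of \<phi> and \<psi> = \<phi> M with constant M. T is the limit of
  \<open>exp_J\<close> times \<phi> at +infinity, its inverse M is the limit of \<open>exp_J\<close>
  times \<psi> at -infinity, and the relevant diagonal blocks of these products are functions
  \<open>jostF\<close>.\<close>

lemma scattering_matrix_blocks:
  fixes q :: "('m::finite, 'n::finite) pot"
  assumes S: "schwartz q" "schwartz r"
  shows "a_plus q r l = jostA (imul q) (imul r) (of_real l)"
    and "c_plus q r l = jostA (imul (nrefl r)) (imul (nrefl q)) (of_real l)"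
proof -
  let ?q = "nrefl q" and ?r = "nrefl r"
  have S': "schwartz ?q" "schwartz ?r"
    by (intro schwartz_uminus schwartz_reflect S)+
  define \<phi> where "\<phi> = phi_sol q r l"
  define \<psi> where "\<psi> = (\<lambda>x. phi_sol ?q ?r (- l) (- x))"
  have \<phi>: "jost_phi q r l \<phi>"
    unfolding \<phi>_def by (rule jost_phi_phi_sol[OF S])
  have \<psi>: "jost_psi q r l \<psi>"
    unfolding \<psi>_def by (rule jost_psi_reflect[OF jost_phi_phi_sol[OF S']])
  obtain X where X: "\<And>\<omega>. solves_system q r (of_real l) \<omega> \<Longrightarrow> \<exists>M. \<forall>x. X x ** \<omega> x = M"
    "\<And>\<phi> x. jost_phi q r l \<phi> \<Longrightarrow> X x ** \<phi> x = mat 1"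
    using adjoint_solution[OF S, of l] by blast
  have X\<phi>: "\<phi>' x ** X x = mat 1" if "jost_phi q r l \<phi>'" for \<phi>' x
    using X(2)[OF that] by (simp add: matrix_left_right_inverse)
  have \<phi>_unique: "\<phi>' = \<phi>" if "jost_phi q r l \<phi>'" for \<phi>'
  proof
    fix x
    have "\<phi>' x = \<phi>' x ** (X x ** \<phi> x)" using X(2)[OF \<phi>] by simp
    then show "\<phi>' x = \<phi> x" using X\<phi>[OF that] by (simp add: matrix_mul_assoc)
  qed
  obtain M where M: "\<And>x. X x ** \<psi> x = M"
    using X(1) \<psi> unfolding jost_psi_def by blast
  have \<psi>M: "\<psi> x = \<phi> x ** M" for x
    using X\<phi>[OF \<phi>, of x] M[of x] by (metis matrix_mul_assoc matrix_mul_lid)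
  \<comment> \<open>A singular M would make the determinant of \<open>exp_J\<close> times \<psi>
    vanish identically, while it tends to 1 at +infinity.\<close>
  have "det M \<noteq> 0"
  proof
    assume "det M = 0"
    then have "det (exp_J (of_real l) x ** \<psi> x) = 0" for x
      by (simp add: \<psi>M det_mul)
    moreover have "((\<lambda>x. det (exp_J (of_real l) x ** \<psi> x)) \<longlongrightarrow> det (mat 1 :: complex^('n + 'm)^('n + 'm))) at_top"
      by (rule tendsto_det[OF jost_psi_left[OF \<psi>]])
    ultimately show False by (simp add: tendsto_const_iff)
  qed
  then obtain T where T: "M ** T = mat 1"
    using invertible_det_nz[of M] unfolding invertible_def by blast
  have \<phi>T: "\<phi> x = \<psi> x ** T" for x
    unfolding \<psi>M using T by (simp add: matrix_mul_assoc[symmetric])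
  \<comment> \<open>Every admissible pair produces its T' as the same limit of \<open>exp_J\<close>
    times \<phi>, which settles uniqueness in the definite description.\<close>
  have limT: "((\<lambda>x. exp_J (of_real l) x ** \<phi> x) \<longlongrightarrow> T') at_top"
    if "jost_psi q r l \<psi>'" "\<And>x. \<phi> x = \<psi>' x ** T'" for \<psi>' T'
    using mm.tendsto[OF jost_psi_left[OF that(1)] tendsto_const, of T'] that(2)
    by (simp add: matrix_mul_assoc)
  have sT: "scattering_matrix q r l = T"
    unfolding scattering_matrix_def
  proof (rule the_equality)
    show "\<exists>\<psi> \<phi>. jost_psi q r l \<psi> \<and> jost_phi q r l \<phi> \<and> (\<forall>x. \<phi> x = \<psi> x ** T)"
      using \<phi> \<psi> \<phi>T by blast
    fix T' assume "\<exists>\<psi> \<phi>. jost_psi q r l \<psi> \<and> jost_phi q r l \<phi> \<and> (\<forall>x. \<phi> x = \<psi> x ** T')"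
    then obtain \<psi>' where "jost_psi q r l \<psi>'" "\<And>x. \<phi> x = \<psi>' x ** T'"
      using \<phi>_unique by blast
    from limT[OF this] show "T' = T"
      using tendsto_unique[OF _ _ limT[OF \<psi> \<phi>T]] by simp
  qed
  have "((\<lambda>x. upper_left (exp_J (of_real l) x ** \<phi> x)) \<longlongrightarrow> upper_left T) at_top"
    by (rule bounded_linear.tendsto[OF bounded_linear_upper_left limT[OF \<psi> \<phi>T]])
  then have 1: "(jostF (imul q) (imul r) (of_real l) \<longlongrightarrow> upper_left T) at_top"
    unfolding \<phi>_def upper_left_phi_sol .
  have 2: "(jostF (imul q) (imul r) (of_real l) \<longlongrightarrow>
      jostA (imul q) (imul r) (of_real l)) at_top"
    by (rule jost_system(5)) (auto intro: schwartz_cscale S)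
  show "a_plus q r l = jostA (imul q) (imul r) (of_real l)"
    unfolding a_plus_def sT using tendsto_unique[OF _ 1 2] by simp
  have iT: "matrix_inv T = M"
    by (rule matrix_inv_eqI[OF T])
  have "((\<lambda>x. exp_J (of_real l) x ** \<psi> x) \<longlongrightarrow> mat 1 ** M) at_bot"
    unfolding \<psi>M matrix_mul_assoc by (intro mm.tendsto jost_phi_left[OF \<phi>] tendsto_const)
  then have lim: "((\<lambda>x. lower_right (exp_J (of_real l) x ** \<psi> x)) \<longlongrightarrow> lower_right M) at_bot"
    using bounded_linear.tendsto[OF bounded_linear_lower_right] by fastforce
  have "((\<lambda>x. lower_right (exp_J (of_real (- l)) x ** phi_sol ?q ?r (- l) x)) \<longlongrightarrow> lower_right M) at_top"
  proof -
    have "exp_J (of_real l) (- x) = (exp_J (- of_real l) x :: complex^('n + 'm)^('n + 'm))" for x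
      using exp_J_reflect[of "- of_real l" x] by simp
    then show ?thesis
      using lim unfolding filterlim_at_bot_mirror \<psi>_def by simp
  qed
  \<comment> \<open>The block for the reflected potential has parameter -(-l) = l, and the limit at
    -infinity has become one at +infinity.\<close>
  then have 3: "(jostF (imul ?r) (imul ?q) (of_real l) \<longlongrightarrow> lower_right M) at_top"
    unfolding lower_right_phi_sol by simp
  have 4: "(jostF (imul ?r) (imul ?q) (of_real l) \<longlongrightarrow>
      jostA (imul ?r) (imul ?q) (of_real l)) at_top"
    by (rule jost_system(5)) (simp_all add: schwartz_cscale S')
  show "c_plus q r l = jostA (imul ?r) (imul ?q) (of_real l)"
    unfolding c_plus_def sT iT using tendsto_unique[OF _ 3 4] by simp
qed

section \<open>Functional derivatives and involution\<close>

lemma I_fun_eq_loc_fun: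
  assumes "schwartz q" "schwartz r" "k \<ge> 1"
  shows "I_fun k q r = loc_fun k (imul q) (imul r) / (2 * \<i>) ^ k"
  unfolding I_fun_def
  by (rule THE_expansion_coefficient[OF ln_det_expansion_jostA assms(3)])
     (intro schwartz_cscale assms scattering_matrix_blocks(1))+

lemma J_fun_eq_loc_fun:
  assumes "schwartz q" "schwartz r" "k \<ge> 1"
  shows "J_fun k q r = loc_fun k (imul (nrefl r)) (imul (nrefl q)) / (2 * \<i>) ^ k"
  unfolding J_fun_def
  by (rule THE_expansion_coefficient[OF ln_det_expansion_jostA assms(3)])
     (intro schwartz_cscale schwartz_uminus schwartz_reflect assms scattering_matrix_blocks(2))+

text \<open>The transposes match the entrywise pairing of \<open>has_functional_derivative\<close>
  with tr (h C) and tr (B g). The factors \<i> come from u = i q and v = i r, the powers of 2 i from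
  \<zeta> = 2 i \<lambda>.\<close>

definition grad_q :: "nat \<Rightarrow> ('m::finite, 'n::finite) pot \<Rightarrow> ('n, 'm) pot \<Rightarrow> ('m, 'n) pot" where
  "grad_q k q r x = cscale (\<i> / (2 * \<i>) ^ k)
     (transpose (res_mn (imul q) (imul r) k x))"

definition grad_r :: "nat \<Rightarrow> ('m::finite, 'n::finite) pot \<Rightarrow> ('n, 'm) pot \<Rightarrow> ('n, 'm) pot" where
  "grad_r k q r x = cscale (- \<i> / (2 * \<i>) ^ k)
     (transpose (res (imul q) (imul r) k x))"

lemma schwartz_grad:
  assumes "schwartz q" "schwartz r"
  shows "schwartz (grad_q k q r)" "schwartz (grad_r k q r)"
proof -
  have S: "schwartz (imul q)" "schwartz (imul r)"
    by (intro schwartz_cscale assms)+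
  note L = local_sysD(3,4)[OF local_sys_res[OF S]]
  show "schwartz (grad_q k q r)" "schwartz (grad_r k q r)"
    unfolding grad_q_def[abs_def] grad_r_def[abs_def]
    by (intro schwartz_cscale schwartz_linear[OF bounded_linear_transpose] L)+
qed

lemma trace_uminus: "trace (- A) = - trace (A :: complex^'n::finite^'n)"
  by (simp add: trace_def sum_negf)

lemma sum_transpose_eq_trace:
  fixes A :: "complex^'n::finite^'m::finite" and B :: "complex^'m^'n"
  shows "(\<Sum>k\<in>UNIV. \<Sum>s\<in>UNIV. A $ s $ k * B $ k $ s) = trace (B ** A)"
  by (simp add: trace_def matrix_matrix_mult_def mult.commute)

abbreviation first_var :: "nat \<Rightarrow> ('m::finite, 'n::finite) pot \<Rightarrow> ('n, 'm) pot \<Rightarrow> ('m, 'n) pot \<Rightarrow> ('n, 'm) pot \<Rightarrow> complex" where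
  "first_var k q r h g \<equiv> (LINT x|lborel. trace (cscale \<i> (h x) ** res_mn (imul q) (imul r) k x)
          - trace (res (imul q) (imul r) k x ** cscale \<i> (g x))) / (2 * \<i>) ^ k"

text \<open>Both \<open>I\<^sub>k\<close> and \<open>J\<^sub>k\<close> satisfy the hypothesis on the first variation, with the same right-hand
  side.\<close>

lemma has_functional_derivative_grad:
  fixes q :: "('m::finite, 'n::finite) pot" and r :: "('n, 'm) pot"
  assumes S: "schwartz q" "schwartz r"
    and var: "\<And>h g. schwartz h \<Longrightarrow> schwartz g \<Longrightarrow>
      ((\<lambda>\<epsilon>. F (\<lambda>x. q x + cscale \<epsilon> (h x)) (\<lambda>x. r x + cscale \<epsilon> (g x))) has_field_derivative
        first_var k q r h g) (at 0)"
  shows "has_functional_derivative F q r (grad_q k q r) (grad_r k q r)"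
  unfolding has_functional_derivative_def Let_def mat_mult_eq_cscale
proof (intro conjI allI impI)
  show "continuous_on UNIV (grad_q k q r)" "continuous_on UNIV (grad_r k q r)"
    by (rule schwartz_continuous, rule schwartz_grad[OF S])+
  fix h :: "('m, 'n) pot" and g :: "('n, 'm) pot"
  assume hg: "schwartz h" "schwartz g"
  let ?C = "res_mn (imul q) (imul r) k" and ?B = "res (imul q) (imul r) k"
  let ?w = "\<lambda>x. trace (cscale \<i> (h x) ** ?C x) - trace (?B x ** cscale \<i> (g x))"
  have v: "(\<Sum>k'\<in>UNIV. \<Sum>s\<in>UNIV. grad_q k q r x $ k' $ s * h x $ k' $ s + grad_r k q r x $ s $ k' * g x $ s $ k')
      = ?w x / (2 * \<i>) ^ k" for x
  proof -
    let ?c = "1 / (2 * \<i>) ^ k"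
    have "(\<Sum>k'\<in>UNIV. \<Sum>s\<in>UNIV. grad_q k q r x $ k' $ s * h x $ k' $ s + grad_r k q r x $ s $ k' * g x $ s $ k')
        = ?c * \<i> * (\<Sum>k'\<in>UNIV. \<Sum>s\<in>UNIV. ?C x $ s $ k' * h x $ k' $ s)
          - ?c * \<i> * (\<Sum>k'\<in>UNIV. \<Sum>s\<in>UNIV. g x $ s $ k' * ?B x $ k' $ s)"
      unfolding sum_distrib_left sum_subtractf[symmetric]
      by (intro sum.cong refl) (simp add: grad_q_def grad_r_def transpose_def field_simps)
    then show ?thesis
      unfolding sum_transpose_eq_trace by (simp add: diff_divide_distrib)
  qed
  have "schwartz ?w"
  proof -
    have S': "schwartz (imul q)" "schwartz (imul r)"
      by (intro schwartz_cscale S)+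
    show ?thesis
      by (intro schwartz_intros hg local_sysD(3,4)[OF local_sys_res[OF S']])
  qed
  then have i: "integrable lborel ?w"
    by (rule schwartz_integrable)
  show "integrable lborel (\<lambda>x. \<Sum>k'\<in>UNIV. \<Sum>s\<in>UNIV. grad_q k q r x $ k' $ s * h x $ k' $ s + grad_r k q r x $ s $ k' * g x $ s $ k')"
    unfolding v using i by (rule integrable_divide_zero)
  show "((\<lambda>\<epsilon>. F (\<lambda>x. q x + cscale \<epsilon> (h x)) (\<lambda>x. r x + cscale \<epsilon> (g x))) has_field_derivative
      (LINT x|lborel. (\<Sum>k'\<in>UNIV. \<Sum>s\<in>UNIV. grad_q k q r x $ k' $ s * h x $ k' $ s + grad_r k q r x $ s $ k' * g x $ s $ k'))) (at 0)"
    unfolding v integral_divide_zero by (rule var[OF hg])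
qed

lemma has_functional_derivative_I_fun:
  fixes q :: "('m::finite, 'n::finite) pot" and r :: "('n, 'm) pot"
  assumes S: "schwartz q" "schwartz r" and k: "k \<ge> 1"
  shows "has_functional_derivative (I_fun k) q r (grad_q k q r) (grad_r k q r)"
proof (rule has_functional_derivative_grad[OF S])
  fix h :: "('m, 'n) pot" and g :: "('n, 'm) pot"
  assume hg: "schwartz h" "schwartz g"
  have *: "cscale \<i> (a + cscale \<epsilon> b) = cscale \<i> a + cscale \<epsilon> (cscale \<i> b)" for \<epsilon> and a b :: "complex^'a::finite^'b::finite"
    by (simp add: cscale.add_right mult.commute)
  \<comment> \<open>The perturbed potentials are Schwartz for every complex \<epsilon>, so the local
    formula may replace \<open>I_fun\<close> along the whole line before differentiating.\<close>
  have eq: "I_fun k (\<lambda>x. q x + cscale \<epsilon> (h x)) (\<lambda>x. r x + cscale \<epsilon> (g x)) =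
      loc_fun k (\<lambda>x. cscale \<i> (q x) + cscale \<epsilon> (cscale \<i> (h x))) (\<lambda>x. cscale \<i> (r x) + cscale \<epsilon> (cscale \<i> (g x))) / (2 * \<i>) ^ k" for \<epsilon>
    unfolding *[symmetric] by (rule I_fun_eq_loc_fun[OF _ _ k]) (intro schwartz_intros S hg)+
  show "((\<lambda>\<epsilon>. I_fun k (\<lambda>x. q x + cscale \<epsilon> (h x)) (\<lambda>x. r x + cscale \<epsilon> (g x))) has_field_derivative
        first_var k q r h g) (at 0)"
    unfolding eq by (intro DERIV_cdivide loc_fun_variation schwartz_cscale S hg)
qed

text \<open>The reflected series solves the local system of (u, v) with C and B interchanged, so
  uniqueness identifies the two.\<close>

lemma res_reflect:
  assumes S: "schwartz u" "schwartz v"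
  shows "res_mn (nrefl v) (nrefl u) k (- x) = res u v k x"
    and "res (nrefl v) (nrefl u) k (- x) = res_mn u v k x"
proof -
  have S': "schwartz (nrefl v)" "schwartz (nrefl u)"
    by (intro schwartz_uminus schwartz_reflect S)+
  from local_sys_unique[OF local_sys_reflect[OF local_sys_res[OF S']] local_sys_res[OF S], of k]
  show "res_mn (nrefl v) (nrefl u) k (- x) = res u v k x"
    "res (nrefl v) (nrefl u) k (- x) = res_mn u v k x"
    by (auto simp: fun_eq_iff)
qed

text \<open>\<open>J_fun\<close> is a local functional of the reflected potentials in swapped order,
  so its variation pairs g with the reflected C and h with the reflected B. After x -> -x,
  \<open>res_reflect\<close> swaps C and B back, and the two minus signs of \<open>nrefl\<close>
  restore the first variation of \<open>I_fun\<close>.\<close>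

lemma has_functional_derivative_J_fun:
  fixes q :: "('m::finite, 'n::finite) pot" and r :: "('n, 'm) pot"
  assumes S: "schwartz q" "schwartz r" and k: "k \<ge> 1"
  shows "has_functional_derivative (J_fun k) q r (grad_q k q r) (grad_r k q r)"
proof (rule has_functional_derivative_grad[OF S])
  fix h :: "('m, 'n) pot" and g :: "('n, 'm) pot"
  assume hg: "schwartz h" "schwartz g"
  define u where "u = (imul q)"
  define v where "v = (imul r)"
  have S': "schwartz u" "schwartz v"
    unfolding u_def v_def by (intro schwartz_cscale S)+
  have *: "cscale \<i> (- (a + cscale \<epsilon> b)) = - cscale \<i> a + cscale \<epsilon> (- cscale \<i> b)" for \<epsilon> and a b :: "complex^'a::finite^'b::finite"
    by (simp add: cscale.add_right cscale.minus_right cscale.diff_right mult.commute)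
  have eq: "J_fun k (\<lambda>x. q x + cscale \<epsilon> (h x)) (\<lambda>x. r x + cscale \<epsilon> (g x)) =
      loc_fun k (\<lambda>x. - v (- x) + cscale \<epsilon> (- cscale \<i> (g (- x)))) (\<lambda>x. - u (- x) + cscale \<epsilon> (- cscale \<i> (h (- x)))) / (2 * \<i>) ^ k" for \<epsilon>
    unfolding u_def v_def *[symmetric] by (rule J_fun_eq_loc_fun[OF _ _ k]) (intro schwartz_intros S hg)+
  have "((\<lambda>\<epsilon>. J_fun k (\<lambda>x. q x + cscale \<epsilon> (h x)) (\<lambda>x. r x + cscale \<epsilon> (g x))) has_field_derivative
      (LINT x|lborel. trace (- cscale \<i> (g (- x)) ** res_mn (nrefl v) (nrefl u) k x)
        - trace (res (nrefl v) (nrefl u) k x ** - cscale \<i> (h (- x)))) / (2 * \<i>) ^ k) (at 0)"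
    unfolding eq by (intro DERIV_cdivide loc_fun_variation schwartz_uminus schwartz_reflect S' schwartz_cscale)
       (intro schwartz_reflect hg)+
  also have "(LINT x|lborel. trace (- cscale \<i> (g (- x)) ** res_mn (nrefl v) (nrefl u) k x)
        - trace (res (nrefl v) (nrefl u) k x ** - cscale \<i> (h (- x))))
      = (LINT x|lborel. trace (- cscale \<i> (g x) ** res_mn (nrefl v) (nrefl u) k (- x))
        - trace (res (nrefl v) (nrefl u) k (- x) ** - cscale \<i> (h x)))"
    by (subst integral_reflect[symmetric]) simp
  also have "\<dots> = (LINT x|lborel. trace (cscale \<i> (h x) ** res_mn u v k x) - trace (res u v k x ** cscale \<i> (g x)))"
  proof -
    have "trace (- cscale \<i> (g x) ** res u v k x) - trace (res_mn u v k x ** - cscale \<i> (h x))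
        = trace (cscale \<i> (h x) ** res_mn u v k x) - trace (res u v k x ** cscale \<i> (g x))" for x
      using trace_mul_sym[of "g x" "res u v k x"] trace_mul_sym[of "h x" "res_mn u v k x"]
      by (simp add: mm.minus_left mm.minus_right trace_uminus)
    then show ?thesis
      unfolding res_reflect[OF S'] by simp
  qed
  finally show "((\<lambda>\<epsilon>. J_fun k (\<lambda>x. q x + cscale \<epsilon> (h x)) (\<lambda>x. r x + cscale \<epsilon> (g x))) has_field_derivative
        first_var k q r h g) (at 0)"
    unfolding u_def v_def .
qed

text \<open>\<open>I_fun\<close> and \<open>J_fun\<close> share their gradients, so one computation
  serves all three brackets. The factors i and -i multiply to 1, and the density is 1 / (2 i)^(k +
  p) times that of \<open>local_sys_involution\<close>.\<close>

lemma has_poisson_bracket_grad: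
  fixes q :: "('m::finite, 'n::finite) pot"
  assumes S: "schwartz q" "schwartz r"
    and F: "has_functional_derivative F q r (grad_q k q r) (grad_r k q r)"
    and G: "has_functional_derivative G q r (grad_q p q r) (grad_r p q r)"
  shows "has_poisson_bracket F G q r 0"
proof -
  let ?u = "imul q" and ?v = "imul r"
  have S': "schwartz ?u" "schwartz ?v"
    by (intro schwartz_cscale S)+
  note L = local_sys_res[OF S']
  let ?K = "\<lambda>x. trace (res_mn ?u ?v k x ** res ?u ?v p x) - trace (res ?u ?v k x ** res_mn ?u ?v p x)"
  let ?c = "1 / (2 * \<i>) ^ (k + p)"
  have v: "(\<Sum>i\<in>UNIV. \<Sum>s\<in>UNIV. grad_q k q r x $ i $ s * grad_r p q r x $ s $ i - grad_r k q r x $ s $ i * grad_q p q r x $ i $ s)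
      = ?c * ?K x" for x
  proof -
    have "(\<Sum>i\<in>UNIV. \<Sum>s\<in>UNIV. grad_q k q r x $ i $ s * grad_r p q r x $ s $ i - grad_r k q r x $ s $ i * grad_q p q r x $ i $ s)
        = ?c * (\<Sum>i\<in>UNIV. \<Sum>s\<in>UNIV. res_mn ?u ?v k x $ s $ i * res ?u ?v p x $ i $ s)
          - ?c * (\<Sum>i\<in>UNIV. \<Sum>s\<in>UNIV. res_mn ?u ?v p x $ s $ i * res ?u ?v k x $ i $ s)"
      unfolding sum_distrib_left sum_subtractf[symmetric]
      by (intro sum.cong refl) (simp add: grad_q_def grad_r_def transpose_def power_add mult_ac)
    then show ?thesis
      unfolding sum_transpose_eq_trace
      using trace_mul_sym[of "res ?u ?v p x" "res_mn ?u ?v k x"] by (simp add: right_diff_distrib)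
  qed
  have "integrable lborel ?K"
    by (intro schwartz_integrable schwartz_intros local_sysD(3,4)[OF L])
  then have i: "integrable lborel (\<lambda>x. ?c * ?K x)"
    by (rule integrable_mult_right)
  have "(LINT x|lborel. ?c * ?K x) = 0"
    unfolding integral_mult_right_zero local_sys_involution[OF L] by simp
  then show ?thesis
    unfolding has_poisson_bracket_def Let_def
    by (intro exI[of _ "grad_q k q r"] exI[of _ "grad_r k q r"] exI[of _ "grad_q p q r"] exI[of _ "grad_r p q r"] conjI F G)
       (use i in \<open>simp_all only: v mult_zero_right\<close>)
qed

theorem mainTheorem2:
  fixes q :: "real \<Rightarrow> complex^'m::finite^'n::finite"
    and r :: "real \<Rightarrow> complex^'n^'m"
    and k p :: nat
  assumes "schwartz q" and "schwartz r"
    and "k \<ge> 1" and "p \<ge> 1"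
  shows "has_poisson_bracket (I_fun k) (I_fun p) q r 0 \<and>
    has_poisson_bracket (I_fun k) (J_fun p) q r 0 \<and>
    has_poisson_bracket (J_fun k) (J_fun p) q r 0"
  by (intro conjI has_poisson_bracket_grad[where k = k and p = p] has_functional_derivative_I_fun
      has_functional_derivative_J_fun assms)

end
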